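(* Let $n\geq 3$ and let $a,b$ be real constants with $ab>0$. Let $X_1,\ldots,X_n,Y_1,\ldots,Y_n$ be independent real random variables such that $X_1,\ldots,X_n$ are identically distributed with $E(X_i^2)<\infty$ and $Y_1,\ldots,Y_n$ are identically distributed with $E(Y_i^2)<\infty$. Put $\bar X=(X_1+\cdots+X_n)/n$ and $\bar Y=(Y_1+\cdots+Y_n)/n$. Then the relation \[ E\{a\bar X+b\bar Y\mid X_1-\bar X+Y_1-\bar Y,\ldots,X_n-\bar X+Y_n-\bar Y\}=\mathrm{const}\quad\text{(almost surely)} \] holds if and only if $X_i$ and $Y_i$ are both Gaussian.
   Context: The common distribution of the $X_i$ and the common distribution of the $Y_i$ may differ. The conditional expectation is with respect to the $\sigma$-algebra generated by the $n$ listed random variables. "Gaussian" means normally distributed with some mean and some variance $\sigma^2\ge 0$; a constant random variable counts as (degenerate) Gaussian. *)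

theory Defs
  imports "HOL-Probability.Probability"
begin

definition sample_mean :: "nat \<Rightarrow> (nat \<Rightarrow> 'a \<Rightarrow> real) \<Rightarrow> 'a \<Rightarrow> real" where
  "sample_mean n X \<omega> = (\<Sum>i=1..n. X i \<omega>) / real n"

text \<open>The density formulation covers variance \<open>\<sigma>\<^sup>2 > 0\<close> only; \<^const>\<open>normal_density\<close>
  with \<open>\<sigma> = 0\<close> is the zero function, so the degenerate case (a random variable that is almost
  surely equal to its mean \<open>\<mu>\<close>) is listed separately.\<close>

definition gaussian_rv :: "'a measure \<Rightarrow> ('a \<Rightarrow> real) \<Rightarrow> bool" where
  "gaussian_rv M X \<longleftrightarrow>
     X \<in> borel_measurable M \<and>
     (\<exists>\<mu>. (AE \<omega> in M. X \<omega> = \<mu>) \<or>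
          (\<exists>\<sigma>>0. distributed M lborel X (normal_density \<mu> \<sigma>)))"

definition generated_algebra ::
    "'a measure \<Rightarrow> 'i set \<Rightarrow> ('i \<Rightarrow> 'a \<Rightarrow> real) \<Rightarrow> 'a measure" where
  "generated_algebra M I Z =
     sigma (space M) (\<Union>i\<in>I. {Z i -` A \<inter> space M | A. A \<in> sets borel})"

text \<open>\<^const>\<open>real_cond_exp\<close> is identically zero unless its second argument is a subalgebra of the
  first.\<close>

lemma subalgebra_generated_algebra:
  assumes "\<And>i. i \<in> I \<Longrightarrow> Z i \<in> borel_measurable M"
  shows "subalgebra M (generated_algebra M I Z)"
proof -
  have gen: "(\<Union>i\<in>I. {Z i -` A \<inter> space M | A. A \<in> sets borel}) \<subseteq> sets M"
    using assms by (auto intro: measurable_sets)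
  then have "(\<Union>i\<in>I. {Z i -` A \<inter> space M | A. A \<in> sets borel}) \<subseteq> Pow (space M)"
    using sets.space_closed by blast
  with gen show ?thesis
    unfolding subalgebra_def generated_algebra_def
    by (simp add: space_measure_of_conv sets_measure_of sets.sigma_sets_subset)
qed

end

theory Submission
  imports Defs "HOL-Complex_Analysis.Complex_Analysis"
begin

text \<open>Let \<open>f\<close>, \<open>g\<close> be the characteristic functions of \<open>X\<^sub>1\<close>, \<open>Y\<^sub>1\<close> and put
  \<open>r(t) = a E(X\<^sub>1 exp(i t X\<^sub>1))/f(t) + b E(Y\<^sub>1 exp(i t Y\<^sub>1))/g(t)\<close>. Testing the conditional expectation against
  exponentials of linear forms in the residuals shows that it is the constant \<open>c\<close> iff
  \<open>r(s\<^sub>1) + \<dots> + r(s\<^sub>n) = n c\<close> whenever \<open>s\<^sub>1 + \<dots> + s\<^sub>n = 0\<close>. Gaussian variables have an affine \<open>r\<close>, which gives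
  one direction. Conversely, since \<open>n \<ge> 3\<close>, \<open>r - r(0)\<close> is additive, which first prevents
  \<open>\<bar>f\<bar>\<^sup>a\<bar>g\<bar>\<^sup>b\<close> from vanishing and then makes \<open>r\<close> affine.

  For the centered variables and \<open>S = X + Y\<close> this is a Stein identity
  \<open>E((aX + bY) \<phi>(S)) = v E(\<phi>'(S))\<close>, valid for trigonometric \<open>\<phi>'\<close>. For nondecreasing \<open>\<phi>\<close> the left-hand side
  dominates \<open>min(a, b) E(S \<phi>(S))\<close>, so the moments of \<open>S\<close> grow at most like Gaussian ones. Hence
  \<open>f\<close>, \<open>g\<close> are entire of order at most 2, the equation \<open>a f'/f + b g'/g = - v z\<close> (for centered variables)
  persists on the complex plane and excludes zeros, and \<open>f = e\<^sup>P\<close> with \<open>P\<close> a polynomial of degree at most 2.\<close>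

subsection \<open>Entire functions and zeros\<close>

text \<open>For \<open>n = 2\<close> the relation would only make \<open>r(t) + r(-t)\<close>, hence
  the real part of \<open>r\<close>, constant, which all symmetric laws satisfy. A third frequency
  allows the choice \<open>x/2, x/2, -x\<close>, that is \<open>r(x) = 2 r(x/2) - r(0)\<close>. So
  \<open>r\<close> stays bounded up to a first zero \<open>d\<close> of \<open>f g\<close>, because
  the values \<open>x/2\<close> lie in \<open>[0, d/2]\<close>, where nothing vanishes. Since
  \<open>Re (i r)\<close> is the derivative of the logarithm of \<open>|f|^a |g|^b\<close>, such a
  zero cannot occur. The obstacle after that: with arbitrary real exponents, a Gaussian
  \<open>|f|^a |g|^b\<close> does not say directly that some sum of independent variables is
  Gaussian, and only second moments are given, so neither Cramer's theorem nor analytic continuation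
  is at hand. The Stein identity supplies the moments. Its test functions need trigonometric
  derivatives, because higher powers of \<open>S\<close> are not yet known to be integrable; powers
  of \<open>sin(e s)/e\<close> increase in modulus at most to those of \<open>s\<close> and replace
  them. Equal signs of \<open>a\<close> and \<open>b\<close> matter twice: a zero of one factor
  cannot be compensated by the other, and \<open>aX + bY\<close> can be compared with
  \<open>S\<close>.\<close>

text \<open>An upper bound on the real part alone already bounds \<open>cmod (P z - P 0)\<close> by
  a multiple of \<open>(cmod z)\<^sup>2\<close>, and Liouville's theorem for polynomial growth
  finishes. For the logarithm of a zero-free entire function of order at most 2 this is Hadamard
  factorization.\<close>

lemma entire_quadratic:
  fixes P :: "complex \<Rightarrow> complex"
  assumes hol: "P holomorphic_on UNIV"
    and bound: "\<And>z. Re (P z) \<le> B * (1 + (cmod z)\<^sup>2)"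
  obtains p0 p1 p2 where "\<And>z. P z = p0 + p1 * z + p2 * z\<^sup>2"
proof -
  define Q where "Q z = P z - P 0" for z
  have Qhol: "Q holomorphic_on UNIV"
    unfolding Q_def by (intro holomorphic_intros hol)
  have growth: "cmod (Q \<xi>) \<le> 2 * (5 * \<bar>B\<bar> + cmod (P 0) + 1) * cmod \<xi> ^ 2" if "1 \<le> cmod \<xi>" for \<xi>
  proof -
    \<comment> \<open>Twice the modulus, so that \<open>\<xi> / R\<close> has modulus 1/2 in the
      Schwarz lemma. In \<open>M\<close> the summand 1 makes both \<open>M > 0\<close> and
      \<open>Re Q < M\<close> strict.\<close>
    define R where "R = 2 * cmod \<xi>"
    define M where "M = \<bar>B\<bar> * (1 + R\<^sup>2) + cmod (P 0) + 1"
    \<comment> \<open>Borel-Caratheodory: \<open>\<phi>\<close> maps the unit disc into itself because \<open>Re Q < M\<close> on the disc of radius \<open>R\<close>.\<close>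
    define \<phi> where "\<phi> w = Q (of_real R * w) / (2 * of_real M - Q (of_real R * w))" for w
    have Rpos: "R > 0" using that by (auto simp: R_def)
    have Mpos: "M > 0" unfolding M_def by (smt (verit) mult_nonneg_nonneg norm_ge_zero zero_le_power2)
    have ReQ: "Re (Q (of_real R * w)) < M" if "cmod w < 1" for w
    proof -
      have "(cmod (of_real R * w))\<^sup>2 \<le> R\<^sup>2"
        using that Rpos by (intro power_mono) (auto simp: norm_mult mult_le_cancel_left1)
      then have "B * (1 + (cmod (of_real R * w))\<^sup>2) \<le> \<bar>B\<bar> * (1 + R\<^sup>2)"
        by (intro mult_mono) auto
      moreover have "- Re (P 0) \<le> cmod (P 0)"
        using abs_Re_le_cmod[of "P 0"] by linarith
      ultimately show ?thesis
        using bound[of "of_real R * w"] by (simp add: Q_def M_def)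
    qed
    have den: "2 * of_real M - Q (of_real R * w) \<noteq> 0" if "cmod w < 1" for w
    proof
      assume "2 * of_real M - Q (of_real R * w) = 0"
      then have "Re (Q (of_real R * w)) = 2 * M"
        by (metis Re_complex_of_real eq_iff_diff_eq_0 of_real_mult of_real_numeral)
      with ReQ[OF that] Mpos show False by simp
    qed
    have "(\<lambda>w. Q (of_real R * w)) holomorphic_on ball 0 1"
      using holomorphic_on_compose_gen[of "\<lambda>w. of_real R * w" "ball 0 1" Q UNIV] Qhol
      by (auto simp: o_def intro!: holomorphic_intros)
    then have \<phi>hol: "\<phi> holomorphic_on ball 0 1"
      unfolding \<phi>_def using den by (intro holomorphic_intros) auto
    have \<phi>lt: "cmod (\<phi> w) < 1" if "cmod w < 1" for w
    proof -
      let ?q = "Q (of_real R * w)"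
      \<comment> \<open>Points of the half-plane \<open>Re q < M\<close> are closer to 0 than to its
        mirror image \<open>2 * M\<close>.\<close>
      have "(cmod ?q)\<^sup>2 < (cmod (2 * of_real M - ?q))\<^sup>2"
      proof -
        have "(cmod (2 * of_real M - ?q))\<^sup>2 - (cmod ?q)\<^sup>2 = 4 * M * (M - Re ?q)"
          by (simp add: cmod_power2) (simp add: power2_eq_square algebra_simps)
        moreover have "4 * M * (M - Re ?q) > 0"
          using ReQ[OF that] Mpos by simp
        ultimately show ?thesis by linarith
      qed
      then have "cmod ?q < cmod (2 * of_real M - ?q)"
        by (rule power2_less_imp_less) simp
      then show ?thesis
        using den[OF that] by (simp add: \<phi>_def norm_divide)
    qed
    have *: "cmod (\<xi> / of_real R) = 1 / 2"
      using Rpos that by (auto simp: norm_divide R_def)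
    have "cmod (\<phi> (\<xi> / of_real R)) \<le> 1 / 2"
      using Schwarz_Lemma(1)[OF \<phi>hol _ \<phi>lt, of "\<xi> / of_real R"] * by (simp add: \<phi>_def Q_def)
    moreover have "\<phi> (\<xi> / of_real R) = Q \<xi> / (2 * of_real M - Q \<xi>)"
      using Rpos by (simp add: \<phi>_def)
    moreover have "2 * of_real M - Q \<xi> \<noteq> 0"
      using den[of "\<xi> / of_real R"] * Rpos by simp
    ultimately have "cmod (Q \<xi>) \<le> 1 / 2 * cmod (2 * of_real M - Q \<xi>)"
      by (simp add: norm_divide divide_le_eq)
    also have "cmod (2 * of_real M - Q \<xi>) \<le> 2 * M + cmod (Q \<xi>)"
      using norm_triangle_ineq4[of "2 * complex_of_real M" "Q \<xi>"] Mpos by (simp add: norm_mult)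
    finally have "cmod (Q \<xi>) \<le> 2 * M" by simp
    also have "M \<le> (5 * \<bar>B\<bar> + cmod (P 0) + 1) * cmod \<xi> ^ 2"
    proof -
      have 1: "1 \<le> (cmod \<xi>)\<^sup>2" using that by simp
      have "\<bar>B\<bar> * (1 + R\<^sup>2) \<le> \<bar>B\<bar> * (5 * (cmod \<xi>)\<^sup>2)"
        using 1 by (intro mult_left_mono) (auto simp: R_def power_mult_distrib)
      moreover have "(cmod (P 0) + 1) * 1 \<le> (cmod (P 0) + 1) * (cmod \<xi>)\<^sup>2"
        using 1 by (intro mult_left_mono) auto
      ultimately show ?thesis by (simp add: M_def algebra_simps)
    qed
    finally show ?thesis by (simp only: mult.assoc)
  qed
  have Q: "Q z = (\<Sum>k\<le>2. (deriv ^^ k) Q 0 / fact k * z ^ k)" for z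
    by (rule Liouville_polynomial[OF Qhol growth])
  have "P z = (P 0 + Q 0) + deriv Q 0 * z + deriv (deriv Q) 0 / 2 * z\<^sup>2" for z
  proof -
    have "P z = P 0 + Q z" by (simp add: Q_def)
    also have "Q z = Q 0 + deriv Q 0 * z + deriv (deriv Q) 0 / 2 * z\<^sup>2"
      by (subst Q) (simp add: numeral_2_eq_2)
    finally show ?thesis by (simp only: add.assoc)
  qed
  then show thesis by (rule that)
qed

text \<open>The left-hand side is half the logarithm of a positive real quadratic expression in
  \<open>Re f\<close> and \<open>Im f\<close>, so no branch of the complex logarithm is chosen. This
  turns bounds on logarithmic derivatives into bounds on moduli.\<close>

lemma has_real_derivative_ln_cmod:
  assumes "(f has_vector_derivative f') (at t within S)" "f t \<noteq> 0"
  shows "((\<lambda>t. ln (cmod (f t))) has_real_derivative Re (f' / f t)) (at t within S)"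
proof -
  have re: "((\<lambda>t. Re (f t)) has_real_derivative Re f') (at t within S)"
    and im: "((\<lambda>t. Im (f t)) has_real_derivative Im f') (at t within S)"
    by (intro has_field_derivative_Re has_field_derivative_Im assms(1))+
  have pos: "(Re (f t))\<^sup>2 + (Im (f t))\<^sup>2 > 0"
    using assms(2) by (metis cmod_power2 zero_less_norm_iff zero_less_power)
  have "((\<lambda>t. (Re (f t))\<^sup>2 + (Im (f t))\<^sup>2) has_real_derivative
      2 * Re (f t) * Re f' + 2 * Im (f t) * Im f') (at t within S)"
    using DERIV_add[OF DERIV_power[OF re, of 2] DERIV_power[OF im, of 2]] by (simp add: mult_ac)
  from DERIV_cdivide[OF DERIV_chain2[OF DERIV_ln_divide[OF pos] this], of 2]
  have "((\<lambda>t. ln ((Re (f t))\<^sup>2 + (Im (f t))\<^sup>2) / 2) has_real_derivative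
     (2 * Re (f t) * Re f' + 2 * Im (f t) * Im f') / ((Re (f t))\<^sup>2 + (Im (f t))\<^sup>2) / 2) (at t within S)"
    by simp
  moreover have "ln ((Re (f t))\<^sup>2 + (Im (f t))\<^sup>2) / 2 = ln (cmod (f t))" for t
    by (simp add: cmod_def ln_sqrt)
  moreover have "(2 * Re (f t) * Re f' + 2 * Im (f t) * Im f') / ((Re (f t))\<^sup>2 + (Im (f t))\<^sup>2) / 2
     = Re (f' / f t)"
  proof -
    have "(2 * x + 2 * y) / D / 2 = (x + y) / D" for x y D :: real
      by (simp add: add_divide_distrib)
    then show ?thesis
      by (simp only: Re_divide mult.assoc mult.commute[of "Re f'"] mult.commute[of "Im f'"])
  qed
  ultimately show ?thesis by simp
qed

text \<open>The logarithm of \<open>\<bar>f\<bar>\<^sup>a\<bar>g\<bar>\<^sup>b\<close> cannot tend to \<open>-\<infinity>\<close> at \<open>d\<close> when its derivative is bounded below;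
  positivity of both exponents is essential.\<close>

lemma weighted_product_nonvanishing_endpoint:
  fixes f g f' g' :: "real \<Rightarrow> complex" and a b d K :: real
  assumes "a > 0" "b > 0" "d > 0"
    and f: "\<And>t. t \<in> {0..d} \<Longrightarrow> (f has_vector_derivative f' t) (at t within {0..d})"
    and g: "\<And>t. t \<in> {0..d} \<Longrightarrow> (g has_vector_derivative g' t) (at t within {0..d})"
    and nz: "\<And>t. t \<in> {0..<d} \<Longrightarrow> f t \<noteq> 0 \<and> g t \<noteq> 0"
    and K: "\<And>t. t \<in> {0<..<d} \<Longrightarrow> - K \<le> Re (a * f' t / f t + b * g' t / g t)"
  shows "f d \<noteq> 0 \<and> g d \<noteq> 0"
proof -
  \<comment> \<open>The term \<open>K * t\<close> turns the lower bound \<open>- K\<close> on the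
    derivative of the weighted logarithm into monotonicity of \<open>H\<close>.\<close>
  define H where "H t = a * ln (cmod (f t)) + b * ln (cmod (g t)) + K * t" for t
  have Hd: "(H has_real_derivative Re (a * f' t / f t + b * g' t / g t) + K) (at t within {0..d})"
    if "t \<in> {0..<d}" for t
  proof -
    have t: "t \<in> {0..d}" using that by auto
    have "(H has_real_derivative a * Re (f' t / f t) + b * Re (g' t / g t) + K) (at t within {0..d})"
      unfolding H_def using nz[OF that]
      by (intro DERIV_add DERIV_cmult DERIV_cmult_Id has_real_derivative_ln_cmod f[OF t] g[OF t]) auto
    moreover have "a * Re (f' t / f t) + b * Re (g' t / g t) = Re (a * f' t / f t + b * g' t / g t)"
      by (simp only: times_divide_eq_right[symmetric] plus_complex.sel Re_complex_of_real Im_complex_of_real times_complex.sel)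
    ultimately show ?thesis by simp
  qed
  have Hmono: "H 0 \<le> H t" if t: "0 < t" "t < d" for t
  proof (rule DERIV_nonneg_imp_increasing_open[of 0 t H])
    fix x assume x: "0 < x" "x < t"
    then have "at x within {0..d} = at x"
      using t by (intro at_within_interior) auto
    then show "\<exists>y. DERIV H x :> y \<and> 0 \<le> y"
      using Hd[of x] K[of x] x t by (intro exI[of _ "Re (a * f' x / f x + b * g' x / g x) + K"]) auto
  next
    have "continuous_on {0..<d} H"
      unfolding continuous_on_eq_continuous_within
      using Hd by (meson DERIV_continuous atLeastLessThan_subseteq_atLeastAtMost_iff continuous_within_subset order_refl)
    then show "continuous_on {0..t} H"
      by (rule continuous_on_subset) (use t in auto)
  qed (use t in auto)
  have fc: "continuous_on {0..d} f" and gc: "continuous_on {0..d} g"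
    unfolding continuous_on_eq_continuous_within using f g by (blast intro: has_vector_derivative_continuous)+
  \<comment> \<open>Stated for interchangeable functions to serve both factors. On the compact
    interval \<open>h2\<close> is bounded by some \<open>G\<close>, and since \<open>b1 > 0\<close>
    its logarithm cannot compensate a fall of \<open>ln (cmod (h1 t))\<close> to minus infinity;
    \<open>e\<close> is the resulting lower bound.\<close>
  have lower: "h1 d \<noteq> 0"
    if h: "a1 > 0" "b1 > 0" "continuous_on {0..d} h1" "continuous_on {0..d} h2"
       "\<And>t. t \<in> {0..<d} \<Longrightarrow> h1 t \<noteq> 0 \<and> h2 t \<noteq> 0"
       "\<And>t. H t = a1 * ln (cmod (h1 t)) + b1 * ln (cmod (h2 t)) + K * t"
     for h1 h2 :: "real \<Rightarrow> complex" and a1 b1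
  proof -
    have "compact (h2 ` {0..d})"
      by (intro compact_continuous_image h) auto
    then obtain G where G: "\<And>t. t \<in> {0..d} \<Longrightarrow> cmod (h2 t) \<le> G" and "G > 0"
      using compact_imp_bounded bounded_pos by (metis imageI)
    define e where "e = exp ((H 0 - \<bar>K\<bar> * d - b1 * ln G) / a1)"
    have "cmod (h1 t) \<ge> e" if t: "t \<in> {0<..<d}" for t
    proof -
      have "b1 * ln (cmod (h2 t)) \<le> b1 * ln G"
        using G[of t] h(5)[of t] t \<open>G > 0\<close> h by (intro mult_left_mono) auto
      moreover have "K * t \<le> \<bar>K\<bar> * d"
        using t by (intro mult_mono) auto
      ultimately have "H 0 - \<bar>K\<bar> * d - b1 * ln G \<le> a1 * ln (cmod (h1 t))"
        using Hmono[of t] t h(6)[of t] by auto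
      then have "(H 0 - \<bar>K\<bar> * d - b1 * ln G) / a1 \<le> ln (cmod (h1 t))"
        using h(1) by (simp add: field_simps)
      then have "e \<le> exp (ln (cmod (h1 t)))" unfolding e_def by simp
      then show ?thesis using h(5)[of t] t by simp
    qed
    moreover have "((\<lambda>t. cmod (h1 t)) \<longlongrightarrow> cmod (h1 d)) (at_left d)"
    proof -
      have "(h1 \<longlongrightarrow> h1 d) (at d within {0..d})"
        using h(3) \<open>d > 0\<close> by (auto simp: continuous_on_def)
      then have "(h1 \<longlongrightarrow> h1 d) (at_left d)"
        using \<open>d > 0\<close> by (simp add: at_within_Icc_at_left)
      then show ?thesis by (rule tendsto_norm)
    qed
    moreover have "eventually (\<lambda>t. t \<in> {0<..<d}) (at_left d)"
      by (rule eventually_at_left_real[OF \<open>d > 0\<close>])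
    ultimately have "cmod (h1 d) \<ge> e"
      by (intro tendsto_lowerbound[where F = "at_left d"]) (auto elim!: eventually_mono)
    moreover have "e > 0" by (simp add: e_def)
    ultimately show ?thesis by auto
  qed
  show ?thesis
    using lower[of a b f g] lower[of b a g f] fc gc nz assms(1,2) by (auto simp: H_def)
qed

text \<open>Otherwise the closed zero set of \<open>f * g\<close> has a least element
  \<open>d > 0\<close>, which the endpoint lemma excludes. The bound \<open>K\<close> may depend on
  \<open>d\<close> and is requested only if nothing vanishes before \<open>d\<close>: for
  characteristic functions it comes from a relation that is available only where they do not
  vanish.\<close>

lemma weighted_product_nonvanishing:
  fixes f g f' g' :: "real \<Rightarrow> complex" and a b T :: real
  assumes "a > 0" "b > 0" "T \<ge> 0"
    and f: "\<And>t. t \<in> {0..T} \<Longrightarrow> (f has_vector_derivative f' t) (at t within {0..T})"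
    and g: "\<And>t. t \<in> {0..T} \<Longrightarrow> (g has_vector_derivative g' t) (at t within {0..T})"
    and nz: "f 0 \<noteq> 0" "g 0 \<noteq> 0"
    and K: "\<And>d. d \<in> {0<..T} \<Longrightarrow> (\<And>t. t \<in> {0..<d} \<Longrightarrow> f t \<noteq> 0 \<and> g t \<noteq> 0) \<Longrightarrow>
       \<exists>K. \<forall>t\<in>{0<..<d}. - K \<le> Re (a * f' t / f t + b * g' t / g t)"
  shows "f T \<noteq> 0 \<and> g T \<noteq> 0"
proof (rule ccontr)
  assume neg: "\<not> (f T \<noteq> 0 \<and> g T \<noteq> 0)"
  define Z where "Z = {t \<in> {0..T}. f t * g t = 0}"
  have "continuous_on {0..T} f" "continuous_on {0..T} g"
    unfolding continuous_on_eq_continuous_within using f g by (blast intro: has_vector_derivative_continuous)+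
  then have "continuous_on {0..T} (\<lambda>t. f t * g t)"
    by (intro continuous_intros)
  then have "closed Z"
    unfolding Z_def by (intro continuous_closed_preimage_constant) auto
  moreover have "Z \<noteq> {}" "bdd_below Z"
    using neg \<open>T \<ge> 0\<close> by (auto simp: Z_def intro!: bdd_belowI[of _ 0])
  ultimately have d: "Inf Z \<in> Z"
    by (intro closed_contains_Inf)
  define d where "d = Inf Z"
  have dT: "d \<in> {0..T}" "f d * g d = 0" using d by (auto simp: Z_def d_def)
  then have dpos: "d > 0" using nz by (cases "d = 0") auto
  have nzd: "f t \<noteq> 0 \<and> g t \<noteq> 0" if "t \<in> {0..<d}" for t
    using that dT cInf_lower[of t Z] \<open>bdd_below Z\<close> by (fastforce simp: Z_def d_def)
  obtain K where "\<forall>t\<in>{0<..<d}. - K \<le> Re (a * f' t / f t + b * g' t / g t)"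
    using K[OF _ nzd] dT dpos by auto
  moreover have "(f has_vector_derivative f' t) (at t within {0..d})"
     "(g has_vector_derivative g' t) (at t within {0..d})" if "t \<in> {0..d}" for t
    using f[of t] g[of t] that dT by (auto elim!: has_vector_derivative_within_subset)
  ultimately have "f d \<noteq> 0 \<and> g d \<noteq> 0"
    using assms(1,2) dpos nzd by (intro weighted_product_nonvanishing_endpoint[of a b d f f' g g' K]) auto
  with dT show False by auto
qed

text \<open>Along the segment from 0 to \<open>z\<close> the weighted logarithmic derivative is
  \<open>q (t * z) * z\<close>, which is bounded by compactness, so the real-variable lemma applies.
  The equation is free of divisions because nonvanishing is the conclusion.\<close>

lemma entire_weighted_product_nonvanishing:
  fixes f g q :: "complex \<Rightarrow> complex" and a b :: real
  assumes "a > 0" "b > 0" "f holomorphic_on UNIV" "g holomorphic_on UNIV"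
    and "continuous_on UNIV q"
    and eq: "\<And>z. a * deriv f z * g z + b * f z * deriv g z = q z * f z * g z"
    and nz: "f 0 \<noteq> 0" "g 0 \<noteq> 0"
  shows "f z \<noteq> 0 \<and> g z \<noteq> 0"
proof -
  have der: "((\<lambda>t. h (of_real t * z)) has_vector_derivative deriv h (of_real t * z) * z) (at t within S)"
    if "h holomorphic_on UNIV" for h S and t :: real
  proof -
    have "(h has_field_derivative deriv h (of_real t * z)) (at (of_real t * z))"
      using that by (auto intro: holomorphic_derivI)
    moreover have "((\<lambda>t. of_real t * z) has_vector_derivative z) (at t within S)"
      by (auto intro!: derivative_eq_intros simp: has_vector_derivative_def scaleR_conv_of_real)
    ultimately show ?thesis
      using field_vector_diff_chain_within[of "\<lambda>t. of_real t * z" z t S h "deriv h (of_real t * z)"]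
      by (auto simp: o_def mult.commute intro: has_field_derivative_at_within)
  qed
  have "continuous_on {0..1} (\<lambda>t. q (of_real t * z) * z)"
    by (intro continuous_intros continuous_on_compose2[OF assms(5)]) auto
  then have "bounded ((\<lambda>t. q (of_real t * z) * z) ` {0..1})"
    by (intro compact_imp_bounded compact_continuous_image) auto
  then obtain K where K: "\<And>t. t \<in> {0..1} \<Longrightarrow> cmod (q (of_real t * z) * z) \<le> K"
    unfolding bounded_iff by blast
  have "f (of_real 1 * z) \<noteq> 0 \<and> g (of_real 1 * z) \<noteq> 0"
  proof (rule weighted_product_nonvanishing[OF assms(1,2), where T = 1])
    fix d :: real assume d: "d \<in> {0<..1}"
      and n: "\<And>t. t \<in> {0..<d} \<Longrightarrow> f (of_real t * z) \<noteq> 0 \<and> g (of_real t * z) \<noteq> 0"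
    have "- K \<le> Re (a * (deriv f (of_real t * z) * z) / f (of_real t * z) +
                      b * (deriv g (of_real t * z) * z) / g (of_real t * z))" if "t \<in> {0<..<d}" for t
    proof -
      have n': "f (of_real t * z) \<noteq> 0" "g (of_real t * z) \<noteq> 0" using n[of t] that by auto
      have "a * (deriv f (of_real t * z) * z) / f (of_real t * z) +
            b * (deriv g (of_real t * z) * z) / g (of_real t * z) =
            (a * deriv f (of_real t * z) * g (of_real t * z) + b * f (of_real t * z) * deriv g (of_real t * z))
             / (f (of_real t * z) * g (of_real t * z)) * z"
        using n' by (simp add: field_simps)
      also have "\<dots> = q (of_real t * z) * z"
        unfolding eq using n' by simp
      finally show ?thesis
        using K[of t] abs_Re_le_cmod[of "q (of_real t * z) * z"] that d by auto
    qed
    then show "\<exists>K. \<forall>t\<in>{0<..<d}. - K \<le> Re (a * (deriv f (of_real t * z) * z) / f (of_real t * z) +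
                      b * (deriv g (of_real t * z) * z) / g (of_real t * z))" by blast
  qed (use assms der in auto)
  then show ?thesis by simp
qed

subsection \<open>Moments from a Stein identity\<close>

lemma sin_mult_divide_tendsto:
  fixes t :: "nat \<Rightarrow> real"
  assumes "t \<longlonglongrightarrow> 0" "\<And>n. t n \<noteq> 0"
  shows "(\<lambda>n. sin (t n * s) / t n) \<longlonglongrightarrow> s"
proof -
  have "((\<lambda>h. sin (h * s)) has_real_derivative s) (at 0)"
    by (auto intro!: derivative_eq_intros)
  then have "((\<lambda>h. sin (h * s) / h) \<longlongrightarrow> s) (at 0)"
    by (simp add: DERIV_def)
  moreover have "filterlim t (at 0) sequentially"
    using assms by (auto simp: filterlim_at)
  ultimately show ?thesis
    by (rule filterlim_compose)
qed

text \<open>Product-to-sum formulas reduce each kernel to cosines, whose antiderivatives are the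
  sines in \<open>stein\<close>. The exception is frequency 0, with antiderivative \<open>s\<close>;
  it is reached as the limit of \<open>sin (t * s) / t\<close>, and this is the first claim. For
  \<open>\<tau> = 0\<close> the kernel is \<open>2 ^ j * sin (e * s) ^ (2 * j)\<close>, a
  nonnegative substitute for an even power.\<close>

lemma (in prob_space) stein_identity_trig_powers:
  fixes S T :: "'a \<Rightarrow> real" and v e :: real
  assumes [measurable]: "S \<in> borel_measurable M" and T: "integrable M T"
    and TS: "integrable M (\<lambda>x. T x * S x)"
    and stein: "\<And>t. expectation (\<lambda>x. T x * sin (t * S x)) = v * t * expectation (\<lambda>x. cos (t * S x))"
  shows "expectation (\<lambda>x. T x * S x) = v"
    and "\<exists>\<phi>. \<phi> 0 = 0 \<and> (\<forall>s. (\<phi> has_real_derivative (1 - cos (2 * e * s)) ^ j * cos (\<tau> * s)) (at s)) \<and>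
           integrable M (\<lambda>x. T x * \<phi> (S x)) \<and>
           expectation (\<lambda>x. T x * \<phi> (S x)) = v * expectation (\<lambda>x. (1 - cos (2 * e * S x)) ^ j * cos (\<tau> * S x))"
proof -
  have [measurable]: "T \<in> borel_measurable M" using T by auto
  define t where "t n = inverse (real (Suc n))" for n
  have t0: "t \<longlonglongrightarrow> 0" unfolding t_def by (rule LIMSEQ_inverse_real_of_nat)
  have tpos: "t n > 0" for n by (simp add: t_def)
  have lim1: "(\<lambda>n. expectation (\<lambda>x. T x * (sin (t n * S x) / t n))) \<longlonglongrightarrow> expectation (\<lambda>x. T x * S x)"
  proof (rule integral_dominated_convergence[where w = "\<lambda>x. \<bar>T x * S x\<bar>"])
    show "AE x in M. (\<lambda>n. T x * (sin (t n * S x) / t n)) \<longlonglongrightarrow> T x * S x"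
      using tpos by (intro AE_I2 tendsto_mult tendsto_const sin_mult_divide_tendsto t0) (simp add: less_imp_neq[symmetric])
    show "AE x in M. norm (T x * (sin (t n * S x) / t n)) \<le> \<bar>T x * S x\<bar>" for n
    proof (intro AE_I2)
      fix x
      have "\<bar>sin (t n * S x) / t n\<bar> \<le> \<bar>S x\<bar>"
        using abs_sin_x_le_abs_x[of "t n * S x"] tpos[of n] by (simp add: abs_mult divide_le_eq mult.commute)
      then show "norm (T x * (sin (t n * S x) / t n)) \<le> \<bar>T x * S x\<bar>"
        unfolding real_norm_def abs_mult by (rule mult_left_mono) simp
    qed
  qed (use TS in auto)
  have eq: "expectation (\<lambda>x. T x * (sin (t n * S x) / t n)) = v * expectation (\<lambda>x. cos (t n * S x))" for n
  proof -
    have "expectation (\<lambda>x. T x * (sin (t n * S x) / t n)) = expectation (\<lambda>x. T x * sin (t n * S x)) / t n"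
      by simp
    then show ?thesis
      using tpos[of n] by (simp add: stein)
  qed
  have lim2: "(\<lambda>n. v * expectation (\<lambda>x. cos (t n * S x))) \<longlonglongrightarrow> v * expectation (\<lambda>x. cos (0 * S x))"
    by (intro tendsto_intros integral_dominated_convergence[where w = "\<lambda>x. 1"] AE_I2 t0) auto
  show TSv: "expectation (\<lambda>x. T x * S x) = v"
    using LIMSEQ_unique[OF lim1[unfolded eq] lim2] by (simp add: prob_space)
  show "\<exists>\<phi>. \<phi> 0 = 0 \<and> (\<forall>s. (\<phi> has_real_derivative (1 - cos (2 * e * s)) ^ j * cos (\<tau> * s)) (at s)) \<and>
           integrable M (\<lambda>x. T x * \<phi> (S x)) \<and>
           expectation (\<lambda>x. T x * \<phi> (S x)) = v * expectation (\<lambda>x. (1 - cos (2 * e * S x)) ^ j * cos (\<tau> * S x))"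
  \<comment> \<open>Another factor \<open>1 - cos (2 * e * s)\<close> brings in the frequencies
    \<open>\<tau> + 2 * e\<close> and \<open>\<tau> - 2 * e\<close>, so \<open>\<tau>\<close> must
    be free. It may become 0 on the way, hence the case distinction in the base case.\<close>
  proof (induction j arbitrary: \<tau>)
    case 0
    show ?case
    proof (cases "\<tau> = 0")
      case True
      show ?thesis
        by (rule exI[of _ "\<lambda>s. s"]) (use True TS TSv in \<open>auto simp: prob_space\<close>)
    next
      case False
      have "integrable M (\<lambda>x. T x * (sin (\<tau> * S x) / \<tau>))"
        by (rule Bochner_Integration.integrable_bound[where f = "\<lambda>x. T x / \<tau>"])
          (use T in \<open>auto simp: abs_mult divide_right_mono mult_left_le\<close>)
      moreover have "((\<lambda>s. sin (\<tau> * s) / \<tau>) has_real_derivative cos (\<tau> * s)) (at s)" for s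
        using False by (auto intro!: derivative_eq_intros)
      moreover have "expectation (\<lambda>x. T x * (sin (\<tau> * S x) / \<tau>)) = v * expectation (\<lambda>x. cos (\<tau> * S x))"
      proof -
        have "expectation (\<lambda>x. T x * (sin (\<tau> * S x) / \<tau>)) = expectation (\<lambda>x. T x * sin (\<tau> * S x)) / \<tau>"
          by simp
        then show ?thesis using False by (simp add: stein)
      qed
      ultimately show ?thesis
        by (intro exI[of _ "\<lambda>s. sin (\<tau> * s) / \<tau>"]) simp
    qed
  next
    case (Suc j)
    let ?k = "\<lambda>\<tau> s. (1 - cos (2 * e * s)) ^ j * cos (\<tau> * s)"
    have split: "(1 - cos (2 * e * s)) ^ Suc j * cos (\<tau> * s)
        = ?k \<tau> s - (?k (\<tau> + 2 * e) s / 2 + ?k (\<tau> - 2 * e) s / 2)" for s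
    proof -
      have "cos ((\<tau> + 2 * e) * s) / 2 + cos ((\<tau> - 2 * e) * s) / 2 = cos (\<tau> * s) * cos (2 * e * s)"
        by (simp add: distrib_right left_diff_distrib cos_add cos_diff field_simps)
      moreover have "A ^ Suc j * t = A ^ j * t - (A ^ j * p / 2 + A ^ j * q / 2)"
        if "p / 2 + q / 2 = t * (1 - A)" for A t p q :: real
      proof -
        have "A ^ j * p / 2 + A ^ j * q / 2 = A ^ j * (t * (1 - A))"
          by (simp flip: that add: distrib_left)
        then show ?thesis by (simp add: algebra_simps)
      qed
      ultimately show ?thesis by simp
    qed
    have int: "integrable M (\<lambda>x. ?k \<tau> (S x))" for \<tau>
    proof (rule Bochner_Integration.integrable_bound[where f = "\<lambda>x. 2 ^ j :: real"])
      have "\<bar>1 - cos y\<bar> ^ j * \<bar>cos z\<bar> \<le> 2 ^ j * 1" for y z :: real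
        using cos_le_one[of y] cos_ge_minus_one[of y] by (intro mult_mono power_mono) auto
      then show "AE x in M. norm (?k \<tau> (S x)) \<le> norm (2 ^ j :: real)"
        by (auto simp: abs_mult power_abs)
    qed auto
    from Suc[of \<tau>] Suc[of "\<tau> + 2 * e"] Suc[of "\<tau> - 2 * e"] obtain p q r where
      p: "p 0 = 0" "\<And>s. (p has_real_derivative ?k \<tau> s) (at s)" "integrable M (\<lambda>x. T x * p (S x))"
         "expectation (\<lambda>x. T x * p (S x)) = v * expectation (\<lambda>x. ?k \<tau> (S x))" and
      q: "q 0 = 0" "\<And>s. (q has_real_derivative ?k (\<tau> + 2 * e) s) (at s)" "integrable M (\<lambda>x. T x * q (S x))"
         "expectation (\<lambda>x. T x * q (S x)) = v * expectation (\<lambda>x. ?k (\<tau> + 2 * e) (S x))" and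
      r: "r 0 = 0" "\<And>s. (r has_real_derivative ?k (\<tau> - 2 * e) s) (at s)" "integrable M (\<lambda>x. T x * r (S x))"
         "expectation (\<lambda>x. T x * r (S x)) = v * expectation (\<lambda>x. ?k (\<tau> - 2 * e) (S x))"
      by blast
    define \<phi> where "\<phi> s = p s - (q s / 2 + r s / 2)" for s
    have T\<phi>: "T x * \<phi> (S x) = T x * p (S x) - (T x * q (S x) / 2 + T x * r (S x) / 2)" for x
      by (simp add: \<phi>_def algebra_simps)
    have "(\<phi> has_real_derivative (1 - cos (2 * e * s)) ^ Suc j * cos (\<tau> * s)) (at s)" for s
      unfolding split \<phi>_def by (intro DERIV_diff DERIV_add DERIV_cdivide p q r)
    moreover have "integrable M (\<lambda>x. T x * \<phi> (S x))"
      unfolding T\<phi> using p q r by auto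
    moreover have "expectation (\<lambda>x. T x * \<phi> (S x)) = v * expectation (\<lambda>x. (1 - cos (2 * e * S x)) ^ Suc j * cos (\<tau> * S x))"
    proof -
      have "expectation (\<lambda>x. T x * \<phi> (S x)) = expectation (\<lambda>x. T x * p (S x)) -
          (expectation (\<lambda>x. T x * q (S x)) / 2 + expectation (\<lambda>x. T x * r (S x)) / 2)"
        unfolding T\<phi> using p(3) q(3) r(3) by simp
      also have "\<dots> = v * (expectation (\<lambda>x. ?k \<tau> (S x)) -
          (expectation (\<lambda>x. ?k (\<tau> + 2 * e) (S x)) / 2 + expectation (\<lambda>x. ?k (\<tau> - 2 * e) (S x)) / 2))"
        unfolding p(4) q(4) r(4) by (simp only: right_diff_distrib distrib_left times_divide_eq_right)
      also have "\<dots> = v * expectation (\<lambda>x. ?k \<tau> (S x) - (?k (\<tau> + 2 * e) (S x) / 2 + ?k (\<tau> - 2 * e) (S x) / 2))"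
        using int[of \<tau>] int[of "\<tau> + 2 * e"] int[of "\<tau> - 2 * e"] by simp
      finally show ?thesis unfolding split .
    qed
    moreover have "\<phi> 0 = 0" by (simp add: \<phi>_def p q r)
    ultimately show ?case by blast
  qed
qed

text \<open>A Chebyshev-type association inequality: for a fixed value of \<open>Y\<close> both
  factors are nondecreasing in \<open>X\<close>, and \<open>X\<close> has mean 0. The linear bound
  on \<open>\<phi>\<close> gives integrability from second moments alone.\<close>

lemma (in prob_space) expectation_mult_mono_indep_nonneg:
  fixes X Y :: "'a \<Rightarrow> real" and \<phi> :: "real \<Rightarrow> real"
  assumes indep: "indep_var borel X borel Y"
    and X2: "integrable M (\<lambda>x. (X x)\<^sup>2)" and Y2: "integrable M (\<lambda>x. (Y x)\<^sup>2)"
    and X0: "expectation X = 0" and mono: "mono \<phi>" and bound: "\<And>s. \<bar>\<phi> s\<bar> \<le> K * \<bar>s\<bar>"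
  shows "integrable M (\<lambda>x. X x * \<phi> (X x + Y x))" and "0 \<le> expectation (\<lambda>x. X x * \<phi> (X x + Y x))"
proof -
  have [measurable]: "X \<in> borel_measurable M" "Y \<in> borel_measurable M"
    using indep by (auto dest: indep_var_rv1 indep_var_rv2)
  have [measurable]: "\<phi> \<in> borel_measurable borel"
    by (rule borel_measurable_mono[OF mono])
  have "K \<ge> 0" using bound[of 1] abs_ge_zero[of "\<phi> 1"] by simp
  have sq: "\<bar>x * y\<bar> \<le> x\<^sup>2 + y\<^sup>2" for x y :: real
  proof -
    have "2 * \<bar>x * y\<bar> \<le> x\<^sup>2 + y\<^sup>2"
      using sum_squares_bound[of "\<bar>x\<bar>" "\<bar>y\<bar>"] by (simp add: abs_mult)
    moreover have "0 \<le> \<bar>x * y\<bar>" by simp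
    ultimately show ?thesis by linarith
  qed
  have bd: "integrable M (\<lambda>x. K * (2 * (X x)\<^sup>2 + (Y x)\<^sup>2))"
    using X2 Y2 by auto
  show int1: "integrable M (\<lambda>x. X x * \<phi> (X x + Y x))"
  proof (rule Bochner_Integration.integrable_bound[OF bd])
    show "AE x in M. norm (X x * \<phi> (X x + Y x)) \<le> norm (K * (2 * (X x)\<^sup>2 + (Y x)\<^sup>2))"
    proof (intro AE_I2)
      fix x
      have "\<bar>X x * \<phi> (X x + Y x)\<bar> \<le> \<bar>X x\<bar> * (K * (\<bar>X x\<bar> + \<bar>Y x\<bar>))"
        unfolding abs_mult using bound[of "X x + Y x"] mult_left_mono[OF abs_triangle_ineq \<open>K \<ge> 0\<close>, of "X x" "Y x"]
        by (intro mult_left_mono) auto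
      also have "\<dots> = K * ((X x)\<^sup>2 + \<bar>X x * Y x\<bar>)"
        by (simp add: abs_mult algebra_simps flip: power2_eq_square)
      also have "\<dots> \<le> K * (2 * (X x)\<^sup>2 + (Y x)\<^sup>2)"
        using sq[of "X x" "Y x"] \<open>K \<ge> 0\<close> by (intro mult_left_mono) auto
      finally show "norm (X x * \<phi> (X x + Y x)) \<le> norm (K * (2 * (X x)\<^sup>2 + (Y x)\<^sup>2))" by simp
    qed
  qed measurable
  have iX: "integrable M X" by (rule square_integrable_imp_integrable[OF _ X2]) measurable
  have iY: "integrable M Y" by (rule square_integrable_imp_integrable[OF _ Y2]) measurable
  have i\<phi>: "integrable M (\<lambda>x. \<phi> (Y x))"
    by (rule Bochner_Integration.integrable_bound[where f = "\<lambda>x. K * \<bar>Y x\<bar>"])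
      (use iY bound \<open>K \<ge> 0\<close> in auto)
  have "indep_var borel ((\<lambda>x. x) \<circ> X) borel (\<phi> \<circ> Y)"
    by (rule indep_var_compose[OF indep]) measurable
  then have ind: "indep_var borel X borel (\<lambda>x. \<phi> (Y x))" by (simp add: o_def)
  \<comment> \<open>Subtracting this null term makes the integrand pointwise nonnegative.\<close>
  have 2: "expectation (\<lambda>x. X x * \<phi> (Y x)) = 0" "integrable M (\<lambda>x. X x * \<phi> (Y x))"
    using indep_var_lebesgue_integral[OF ind iX i\<phi>] indep_var_integrable[OF ind iX i\<phi>] X0 by auto
  have "expectation (\<lambda>x. X x * \<phi> (X x + Y x)) = expectation (\<lambda>x. X x * \<phi> (X x + Y x)) - expectation (\<lambda>x. X x * \<phi> (Y x))"
    using 2 by simp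
  also have "\<dots> = expectation (\<lambda>x. X x * (\<phi> (X x + Y x) - \<phi> (Y x)))"
    using int1 2 by (simp add: right_diff_distrib)
  also have "\<dots> \<ge> 0"
  proof (intro integral_nonneg_AE AE_I2)
    fix x
    show "0 \<le> X x * (\<phi> (X x + Y x) - \<phi> (Y x))"
      using monoD[OF mono, of "Y x" "X x + Y x"] monoD[OF mono, of "X x + Y x" "Y x"]
      by (cases "X x \<ge> 0") (auto intro: mult_nonneg_nonneg mult_nonpos_nonpos)
  qed
  finally show "0 \<le> expectation (\<lambda>x. X x * \<phi> (X x + Y x))" .
qed

text \<open>For \<open>s \<ge> 0\<close> this is dominated convergence of the derivatives on
  \<open>{0..s}\<close>, where the continuous \<open>h\<close> is integrable. Negative
  \<open>s\<close> is reduced to this by reflection, which is why \<open>pos\<close> quantifies over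
  all its data.\<close>

lemma antiderivative_tendsto:
  fixes \<phi> :: "nat \<Rightarrow> real \<Rightarrow> real"
  assumes zero: "\<And>n. \<phi> n 0 = 0" "\<psi> 0 = 0"
    and der: "\<And>n s. (\<phi> n has_real_derivative k n s) (at s)" "\<And>s. (\<psi> has_real_derivative l s) (at s)"
    and lim: "\<And>s. (\<lambda>n. k n s) \<longlonglongrightarrow> l s"
    and bound: "\<And>n s. \<bar>k n s\<bar> \<le> h s" and h: "continuous_on UNIV h"
  shows "(\<lambda>n. \<phi> n s) \<longlonglongrightarrow> \<psi> s"
proof -
  have pos: "(\<lambda>n. \<phi> n s) \<longlonglongrightarrow> \<psi> s"
    if "s \<ge> 0" "\<And>n. \<phi> n 0 = 0" "\<psi> 0 = 0" 
      "\<And>n s. (\<phi> n has_real_derivative k n s) (at s)" "\<And>s. (\<psi> has_real_derivative l s) (at s)"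
      "\<And>s. (\<lambda>n. k n s) \<longlonglongrightarrow> l s" "\<And>n s. \<bar>k n s\<bar> \<le> h s" "continuous_on UNIV h"
    for \<phi> k :: "nat \<Rightarrow> real \<Rightarrow> real" and \<psi> l h :: "real \<Rightarrow> real" and s
  proof -
    have ftc: "(q has_integral p s - p 0) {0..s}" if "\<And>s. (p has_real_derivative q s) (at s)" for p q :: "real \<Rightarrow> real"
      using that \<open>s \<ge> 0\<close>
      by (intro fundamental_theorem_of_calculus)
        (auto intro: has_field_derivative_at_within simp flip: has_real_derivative_iff_has_vector_derivative)
    have "(\<lambda>n. integral {0..s} (k n)) \<longlonglongrightarrow> integral {0..s} l"
    proof (rule dominated_convergence(2)[where h = h])
      show "h integrable_on {0..s}"
        using that by (intro integrable_continuous_real) (auto intro: continuous_on_subset)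
      show "k n integrable_on {0..s}" for n
        using ftc[OF that(4)] by (rule has_integral_integrable)
    qed (use that in auto)
    moreover have "integral {0..s} (k n) = \<phi> n s" "integral {0..s} l = \<psi> s" for n
      using ftc[OF that(4)] ftc[OF that(5)] that(2,3) by (auto intro!: integral_unique)
    ultimately show ?thesis by simp
  qed
  show ?thesis
  proof (cases "s \<ge> 0")
    case True
    then show ?thesis using pos[of s \<phi> \<psi> k l h] assms by blast
  next
    case False
    have "(\<lambda>n. - \<phi> n (- (- s))) \<longlonglongrightarrow> - \<psi> (- (- s))"
    proof (rule pos[where s = "- s" and \<phi> = "\<lambda>n s. - \<phi> n (- s)" and \<psi> = "\<lambda>s. - \<psi> (- s)"
          and k = "\<lambda>n s. k n (- s)" and l = "\<lambda>s. l (- s)" and h = "\<lambda>s. h (- s)"])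
      show "((\<lambda>s. - \<phi> n (- s)) has_real_derivative k n (- s)) (at s)" for n s
        using DERIV_minus[OF DERIV_chain2[OF der(1)[of n "- s"] DERIV_minus[OF DERIV_ident]]] by simp
      show "((\<lambda>s. - \<psi> (- s)) has_real_derivative l (- s)) (at s)" for s
        using DERIV_minus[OF DERIV_chain2[OF der(2)[of "- s"] DERIV_minus[OF DERIV_ident]]] by simp
      show "continuous_on UNIV (\<lambda>s. h (- s))"
        by (intro continuous_on_compose2[OF h] continuous_intros) auto
    qed (use False assms in auto)
    then show ?thesis by (simp add: tendsto_minus_cancel_left)
  qed
qed

text \<open>Fatou's lemma. Its use is for moments whose finiteness is the very thing to be proved,
  so that no dominating function is at hand.\<close>

lemma nn_integral_le_of_tendsto:
  fixes u :: "nat \<Rightarrow> 'a \<Rightarrow> ennreal"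
  assumes "\<And>n. u n \<in> borel_measurable M" "\<And>x. x \<in> space M \<Longrightarrow> (\<lambda>n. u n x) \<longlonglongrightarrow> w x"
    and "\<And>n. (\<integral>\<^sup>+x. u n x \<partial>M) \<le> C"
  shows "(\<integral>\<^sup>+x. w x \<partial>M) \<le> C"
proof -
  have "(\<integral>\<^sup>+x. w x \<partial>M) = (\<integral>\<^sup>+x. liminf (\<lambda>n. u n x) \<partial>M)"
    by (intro nn_integral_cong) (use assms(2) in \<open>metis lim_imp_Liminf sequentially_bot\<close>)
  also have "\<dots> \<le> liminf (\<lambda>n. \<integral>\<^sup>+x. u n x \<partial>M)"
    by (rule nn_integral_liminf) (use assms in auto)
  also have "\<dots> \<le> C"
    by (rule Liminf_le) (use assms in auto)
  finally show ?thesis .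
qed

lemma (in prob_space) indep_vars_reindex:
  assumes inj: "inj_on f I" and indep: "indep_vars M' X (f ` I)"
  shows "indep_vars (\<lambda>i. M' (f i)) (\<lambda>i. X (f i)) I"
  unfolding indep_vars_def2
proof (intro conjI ballI)
  show "random_variable (M' (f i)) (X (f i))" if "i \<in> I" for i
    using indep that by (auto simp: indep_vars_def2)
  let ?F = "\<lambda>k. {X k -` A \<inter> space M | A. A \<in> sets (M' k)}"
  have S: "indep_sets ?F (f ` I)"
    using indep by (simp add: indep_vars_def2)
  show "indep_sets (\<lambda>i. ?F (f i)) I"
  proof (rule indep_setsI)
    show "?F (f i) \<subseteq> events" if "i \<in> I" for i
      using S that unfolding indep_sets_def by blast
    fix A J assume J: "J \<noteq> {}" "J \<subseteq> I" "finite J" "\<forall>j\<in>J. A j \<in> ?F (f j)"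
    define B where "B k = A (the_inv_into I f k)" for k
    have B: "B (f j) = A j" if "j \<in> J" for j
      using that J inj by (auto simp: B_def the_inv_into_f_f)
    have injJ: "inj_on f J" using inj J by (auto intro: inj_on_subset)
    have "prob (\<Inter>k\<in>f ` J. B k) = (\<Prod>k\<in>f ` J. prob (B k))"
      by (rule indep_setsD[OF S]) (use J B in auto)
    then show "prob (\<Inter>j\<in>J. A j) = (\<Prod>j\<in>J. prob (A j))"
      using B by (simp add: prod.reindex[OF injJ] cong: INF_cong prod.cong)
  qed
qed

lemma (in prob_space) indep_var_of_indep_vars:
  assumes "indep_vars M' X I" "i \<in> I" "j \<in> I" "i \<noteq> j"
  shows "indep_var (M' i) (X i) (M' j) (X j)"
proof -
  have "inj_on (case_bool i j) UNIV"
    using assms by (auto simp: inj_on_def split: bool.splits)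
  moreover have "indep_vars M' X (case_bool i j ` UNIV)"
    by (rule indep_vars_subset[OF assms(1)]) (use assms in \<open>auto split: bool.splits\<close>)
  ultimately have "indep_vars (\<lambda>k. M' (case_bool i j k)) (\<lambda>k. X (case_bool i j k)) UNIV"
    by (rule indep_vars_reindex)
  moreover have "(\<lambda>k. M' (case_bool i j k)) = case_bool (M' i) (M' j)"
    "(\<lambda>k. X (case_bool i j k)) = case_bool (X i) (X j)"
    by (auto split: bool.split)
  ultimately show ?thesis by (simp add: indep_var_def)
qed

lemma (in prob_space) indep_var_commute:
  assumes "indep_var N X L Y"
  shows "indep_var L Y N X"
  using indep_var_of_indep_vars[OF assms[unfolded indep_var_def], of False True] by simp

text \<open>With \<open>S = X + Y\<close> and
  \<open>\<phi>(s) = s ^ (2 * j + 1) / (2 * j + 1)\<close> the Stein identity and the comparison of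
  weights would give \<open>E(S ^ (2 * j + 2)) \<le> (2 * j + 1) * (v / c) * E(S ^ (2 * j))\<close>,
  the moment recursion of a Gaussian law as an inequality. This \<open>\<phi>\<close> is not yet
  admissible, so it is replaced by approximants of linear growth, and the limit is taken with
  Fatou's lemma in \<open>ennreal\<close>.\<close>

lemma (in prob_space) stein_identity_even_moments:
  fixes X Y :: "'a \<Rightarrow> real" and a b c v :: real
  assumes indep: "indep_var borel X borel Y"
    and X2: "integrable M (\<lambda>x. (X x)\<^sup>2)" and Y2: "integrable M (\<lambda>x. (Y x)\<^sup>2)"
    and X0: "expectation X = 0" and Y0: "expectation Y = 0"
    and c: "0 < c" "c \<le> a" "c \<le> b"
    and stein: "\<And>t. expectation (\<lambda>x. (a * X x + b * Y x) * sin (t * (X x + Y x)))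
                  = v * t * expectation (\<lambda>x. cos (t * (X x + Y x)))"
  shows "0 \<le> v"
    and "(\<integral>\<^sup>+x. ennreal ((X x + Y x) ^ (2 * j)) \<partial>M) \<le> ennreal ((2 * (v / c)) ^ j * fact j)"
proof -
  have [measurable]: "X \<in> borel_measurable M" "Y \<in> borel_measurable M"
    using indep by (auto dest: indep_var_rv1 indep_var_rv2)
  have indep': "indep_var borel Y borel X"
    by (rule indep_var_commute[OF indep])
  define S where "S x = X x + Y x" for x
  define T where "T x = a * X x + b * Y x" for x
  have [measurable]: "S \<in> borel_measurable M" "T \<in> borel_measurable M"
    unfolding S_def T_def by measurable
  have iX: "integrable M X" by (rule square_integrable_imp_integrable[OF _ X2]) measurable
  have iY: "integrable M Y" by (rule square_integrable_imp_integrable[OF _ Y2]) measurable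
  have iT: "integrable M T" unfolding T_def using iX iY by auto
  \<comment> \<open>Both \<open>E(X \<phi>(S))\<close> and \<open>E(Y \<phi>(S))\<close> are
    nonnegative, so lowering the weights \<open>a\<close> and \<open>b\<close> to \<open>c\<close>
    can only decrease the sum.\<close>
  have compare: "integrable M (\<lambda>x. T x * \<phi> (S x)) \<and> integrable M (\<lambda>x. S x * \<phi> (S x)) \<and>
      0 \<le> expectation (\<lambda>x. S x * \<phi> (S x)) \<and>
      c * expectation (\<lambda>x. S x * \<phi> (S x)) \<le> expectation (\<lambda>x. T x * \<phi> (S x))"
    if "mono \<phi>" "\<And>s. \<bar>\<phi> s\<bar> \<le> K * \<bar>s\<bar>" for \<phi> K
  proof -
    note 1 = expectation_mult_mono_indep_nonneg[OF indep X2 Y2 X0 that]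
    have 2: "integrable M (\<lambda>x. Y x * \<phi> (X x + Y x))" "0 \<le> expectation (\<lambda>x. Y x * \<phi> (X x + Y x))"
      using expectation_mult_mono_indep_nonneg[OF indep' Y2 X2 Y0 that] by (simp_all add: add.commute)
    have T: "T x * \<phi> (S x) = a * (X x * \<phi> (X x + Y x)) + b * (Y x * \<phi> (X x + Y x))" for x
      by (simp add: T_def S_def algebra_simps)
    have S: "S x * \<phi> (S x) = X x * \<phi> (X x + Y x) + Y x * \<phi> (X x + Y x)" for x
      by (simp add: S_def algebra_simps)
    have "c * expectation (\<lambda>x. X x * \<phi> (X x + Y x)) \<le> a * expectation (\<lambda>x. X x * \<phi> (X x + Y x))"
      "c * expectation (\<lambda>x. Y x * \<phi> (X x + Y x)) \<le> b * expectation (\<lambda>x. Y x * \<phi> (X x + Y x))"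
      using 1 2 c by (auto intro: mult_right_mono)
    then show ?thesis
      unfolding T S using 1 2 by (auto simp: distrib_left)
  qed
  have id: "integrable M (\<lambda>x. T x * S x)" "0 \<le> expectation (\<lambda>x. S x * S x)"
     "c * expectation (\<lambda>x. S x * S x) \<le> expectation (\<lambda>x. T x * S x)"
    using compare[of "\<lambda>s. s" 1] by (auto simp: mono_def)
  have stein': "expectation (\<lambda>x. T x * sin (t * S x)) = v * t * expectation (\<lambda>x. cos (t * S x))" for t
    using stein by (simp add: T_def S_def)
  note st = stein_identity_trig_powers[OF \<open>S \<in> borel_measurable M\<close> iT id(1) stein']
  \<comment> \<open>With the identity as test function,
    \<open>v = E(T S) \<ge> c * E(S\<^sup>2) \<ge> 0\<close>.\<close>
  have "0 \<le> c * expectation (\<lambda>x. S x * S x)"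
    using id(2) c by (intro mult_nonneg_nonneg) auto
  then show v: "0 \<le> v" using st(1) id(3) by linarith
  define C where "C = v / c"
  have C: "0 \<le> C" using v c by (simp add: C_def)
  have step: "(\<integral>\<^sup>+x. ennreal (S x ^ (2 * j + 2) / real (2 * j + 1)) \<partial>M)
      \<le> ennreal C * (\<integral>\<^sup>+x. ennreal (S x ^ (2 * j)) \<partial>M)" for j
  proof -
    define e where "e n = inverse (real (Suc n))" for n
    have e0: "e \<longlonglongrightarrow> 0" unfolding e_def by (rule LIMSEQ_inverse_real_of_nat)
    have ep: "0 < e n" for n by (simp add: e_def)
    \<comment> \<open>\<open>k n s\<close> tends to \<open>s ^ (2 * j)\<close> from below and is, up to a factor, \<open>(1 - cos (2 * e n * s)) ^ j\<close>.\<close>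
    define k where "k n s = (sin (e n * s) / e n) ^ (2 * j)" for n s
    have k_eq: "((1 - cos (2 * e n * s)) ^ j * cos (0 * s)) / (2 * (e n)\<^sup>2) ^ j = k n s" for n s
    proof -
      have "(1 - cos (2 * e n * s)) / (2 * (e n)\<^sup>2) = (sin (e n * s) / e n)\<^sup>2"
        using cos_double_sin[of "e n * s"] by (simp add: power_divide mult.assoc)
      then show ?thesis
        by (simp only: mult_zero_left cos_zero mult_1_right k_def power_mult flip: power_divide)
    qed
    have sin_le: "\<bar>sin (e n * s) / e n\<bar> \<le> \<bar>s\<bar>" for n s
      using abs_sin_x_le_abs_x[of "e n * s"] ep[of n] by (simp add: abs_mult divide_le_eq mult.commute)
    have k_nonneg: "0 \<le> k n s" for n s by (simp add: k_def)
    have k_le: "k n s \<le> s ^ (2 * j)" for n s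
      using power_mono[OF sin_le[of n s] abs_ge_zero, of "2 * j"] by (simp add: k_def power_even_abs del: abs_divide)
    \<comment> \<open>This bound degenerates as \<open>n\<close> grows, but for each
      \<open>n\<close> it gives \<open>\<phi> n\<close> a linear bound and so admits it to
      \<open>compare\<close>; the passage to the limit relies on \<open>k_le\<close>.\<close>
    have k_le': "k n s \<le> inverse (e n) ^ (2 * j)" for n s
    proof -
      have "\<bar>sin (e n * s) / e n\<bar> \<le> inverse (e n)"
        using ep[of n] by (simp add: divide_le_eq)
      from power_mono[OF this abs_ge_zero, of "2 * j"] show ?thesis
        by (simp add: k_def power_even_abs del: abs_divide power_inverse)
    qed
    have "\<exists>\<phi>. \<phi> 0 = 0 \<and> (\<forall>s. (\<phi> has_real_derivative k n s) (at s)) \<and>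
           expectation (\<lambda>x. T x * \<phi> (S x)) = v * expectation (\<lambda>x. k n (S x))" for n
    proof -
      from st(2)[of "e n" j 0] obtain \<phi> where \<phi>: "\<phi> 0 = 0"
        "\<And>s. (\<phi> has_real_derivative (1 - cos (2 * e n * s)) ^ j * cos (0 * s)) (at s)"
        "integrable M (\<lambda>x. T x * \<phi> (S x))"
        "expectation (\<lambda>x. T x * \<phi> (S x)) = v * expectation (\<lambda>x. (1 - cos (2 * e n * S x)) ^ j * cos (0 * S x))"
        by blast
      define D where "D = (2 * (e n)\<^sup>2) ^ j"
      have "((\<lambda>s. \<phi> s / D) has_real_derivative k n s) (at s)" for s
        unfolding k_eq[symmetric] D_def by (intro DERIV_cdivide \<phi>)
      moreover have "expectation (\<lambda>x. T x * (\<phi> (S x) / D)) = v * expectation (\<lambda>x. k n (S x))"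
        using \<phi>(4) unfolding k_eq[symmetric] D_def[symmetric] by simp
      ultimately show ?thesis using \<phi>(1) by (intro exI[of _ "\<lambda>s. \<phi> s / D"]) auto
    qed
    then obtain \<phi> where \<phi>0: "\<And>n. \<phi> n 0 = 0" and \<phi>': "\<And>n s. (\<phi> n has_real_derivative k n s) (at s)"
      and \<phi>E: "\<And>n. expectation (\<lambda>x. T x * \<phi> n (S x)) = v * expectation (\<lambda>x. k n (S x))"
      by metis
    have \<phi>mono: "mono (\<phi> n)" for n
      by (rule monoI, erule DERIV_nonneg_imp_nondecreasing) (use \<phi>' k_nonneg in blast)
    have \<phi>bd: "\<bar>\<phi> n s\<bar> \<le> inverse (e n) ^ (2 * j) * \<bar>s\<bar>" for n s
      using field_differentiable_bound[of UNIV "\<phi> n" "k n" "inverse (e n) ^ (2 * j)" s 0] \<phi>' k_nonneg k_le' \<phi>0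
      by (simp add: has_field_derivative_at_within)
    have \<phi>sgn: "0 \<le> s * \<phi> n s" for n s
      using monoD[OF \<phi>mono, of 0 s n] monoD[OF \<phi>mono, of s 0 n] \<phi>0[of n]
      by (cases "s \<ge> 0") (auto intro: mult_nonneg_nonneg mult_nonpos_nonpos)
    have [measurable]: "\<phi> n \<in> borel_measurable borel" for n
      by (rule borel_measurable_mono[OF \<phi>mono])
    have [measurable]: "k n \<in> borel_measurable borel" for n
      unfolding k_def by measurable
    have main: "(\<integral>\<^sup>+x. ennreal (S x * \<phi> n (S x)) \<partial>M) \<le> ennreal C * (\<integral>\<^sup>+x. ennreal (S x ^ (2 * j)) \<partial>M)" for n
    proof -
      note cmp = compare[OF \<phi>mono[of n] \<phi>bd[of n]]
      have ik: "integrable M (\<lambda>x. k n (S x))"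
        by (rule Bochner_Integration.integrable_bound[where f = "\<lambda>x. inverse (e n) ^ (2 * j)"])
          (use k_nonneg k_le' in auto)
      have "(\<integral>\<^sup>+x. ennreal (S x * \<phi> n (S x)) \<partial>M) = ennreal (expectation (\<lambda>x. S x * \<phi> n (S x)))"
        using cmp \<phi>sgn by (intro nn_integral_eq_integral) auto
      also have "expectation (\<lambda>x. S x * \<phi> n (S x)) \<le> C * expectation (\<lambda>x. k n (S x))"
        using cmp \<phi>E[of n] c by (simp add: C_def field_simps)
      also have "ennreal (C * expectation (\<lambda>x. k n (S x))) = ennreal C * (\<integral>\<^sup>+x. ennreal (k n (S x)) \<partial>M)"
        using C ik k_nonneg by (simp add: ennreal_mult' nn_integral_eq_integral)
      also have "\<dots> \<le> ennreal C * (\<integral>\<^sup>+x. ennreal (S x ^ (2 * j)) \<partial>M)"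
        by (intro mult_left_mono nn_integral_mono ennreal_leI k_le) auto
      finally show ?thesis by (simp add: ennreal_leI)
    qed
    have lim: "(\<lambda>n. \<phi> n s) \<longlonglongrightarrow> s ^ (2 * j + 1) / real (2 * j + 1)" for s
    proof (rule antiderivative_tendsto[where \<phi> = \<phi> and \<psi> = "\<lambda>s. s ^ (2 * j + 1) / real (2 * j + 1)" and k = k and l = "\<lambda>s. s ^ (2 * j)" and h = "\<lambda>s. s ^ (2 * j)"])
      show "((\<lambda>s. s ^ (2 * j + 1) / real (2 * j + 1)) has_real_derivative s ^ (2 * j)) (at s)" for s :: real
      proof -
        have "((\<lambda>s :: real. s ^ N / real N) has_real_derivative s ^ (N - 1)) (at s)" if "N > 0" for N
          using DERIV_cdivide[OF DERIV_pow[of N s], of "real N"] that by simp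
        from this[of "2 * j + 1"] show ?thesis by simp
      qed
      show "(\<lambda>n. k n s) \<longlonglongrightarrow> s ^ (2 * j)" for s
        unfolding k_def using ep e0 by (intro tendsto_power sin_mult_divide_tendsto) (auto simp: less_imp_neq[symmetric])
      show "continuous_on UNIV (\<lambda>s :: real. s ^ (2 * j))" by (intro continuous_intros)
    qed (use \<phi>0 \<phi>' k_nonneg k_le in auto)
    show ?thesis
    proof (rule nn_integral_le_of_tendsto[OF _ _ main])
      show "(\<lambda>n. ennreal (S x * \<phi> n (S x))) \<longlonglongrightarrow> ennreal (S x ^ (2 * j + 2) / real (2 * j + 1))" for x
      proof -
        have "(\<lambda>n. S x * \<phi> n (S x)) \<longlonglongrightarrow> S x * (S x ^ (2 * j + 1) / real (2 * j + 1))"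
          by (intro tendsto_intros lim)
        then show ?thesis by (intro tendsto_ennrealI) simp
      qed
    qed measurable
  qed
  have "(\<integral>\<^sup>+x. ennreal (S x ^ (2 * j)) \<partial>M) \<le> ennreal ((2 * C) ^ j * fact j)" for j
  proof (induction j)
    case 0
    then show ?case by (simp add: emeasure_space_1)
  next
    case (Suc j)
    have "(\<integral>\<^sup>+x. ennreal (S x ^ (2 * Suc j)) \<partial>M)
        = (\<integral>\<^sup>+x. ennreal (real (2 * j + 1)) * ennreal (S x ^ (2 * j + 2) / real (2 * j + 1)) \<partial>M)"
    proof (intro nn_integral_cong)
      have "ennreal y = ennreal r * ennreal (y / r)" if "r > 0" for y r :: real
        using that by (simp flip: ennreal_mult')
      then show "ennreal (S x ^ (2 * Suc j)) = ennreal (real (2 * j + 1)) * ennreal (S x ^ (2 * j + 2) / real (2 * j + 1))" for x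
        by (metis add_2_eq_Suc' mult_Suc_right of_nat_0_less_iff zero_less_Suc Suc_eq_plus1 add.commute)
    qed
    also have "\<dots> = ennreal (real (2 * j + 1)) * (\<integral>\<^sup>+x. ennreal (S x ^ (2 * j + 2) / real (2 * j + 1)) \<partial>M)"
      by (rule nn_integral_cmult) measurable
    also have "\<dots> \<le> ennreal (real (2 * j + 1)) * (ennreal C * ennreal ((2 * C) ^ j * fact j))"
      by (intro mult_left_mono order_trans[OF step] Suc) auto
    also have "\<dots> = ennreal (real (2 * j + 1) * (C * ((2 * C) ^ j * fact j)))"
      using C by (simp only: ennreal_mult' ennreal_mult'' mult_nonneg_nonneg zero_le_power fact_ge_zero of_nat_0_le_iff zero_le_numeral)
    also have "\<dots> \<le> ennreal ((2 * C) ^ Suc j * fact (Suc j))"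
    proof (rule ennreal_leI)
      \<comment> \<open>The factor \<open>2 * j + 1\<close>, which would produce double factorials,
        is rounded up to \<open>2 * (j + 1)\<close> to keep the closed form
        \<open>(2 * C) ^ j * fact j\<close>.\<close>
      have "real (2 * j + 1) * (C * ((2 * C) ^ j * fact j)) \<le> (2 * real (Suc j)) * (C * ((2 * C) ^ j * fact j))"
        using C by (intro mult_right_mono) auto
      then show "real (2 * j + 1) * (C * ((2 * C) ^ j * fact j)) \<le> (2 * C) ^ Suc j * fact (Suc j)"
        by (simp add: algebra_simps)
    qed
    finally show ?case .
  qed
  then show "(\<integral>\<^sup>+x. ennreal ((X x + Y x) ^ (2 * j)) \<partial>M) \<le> ennreal ((2 * (v / c)) ^ j * fact j)"
    by (simp add: S_def C_def)
qed

section \<open>Square-exponential moments of the sum and of its summands\<close>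

lemma nn_integral_exp_square_of_even_moments:
  fixes S :: "'a \<Rightarrow> real"
  assumes [measurable]: "S \<in> borel_measurable M" and "0 \<le> B"
    and moments: "\<And>j. (\<integral>\<^sup>+x. ennreal (S x ^ (2 * j)) \<partial>M) \<le> ennreal (B ^ j * fact j)"
  obtains \<theta> where "\<theta> > 0" "(\<integral>\<^sup>+x. ennreal (exp (\<theta> * (S x)\<^sup>2)) \<partial>M) < \<infinity>"
proof -
  \<comment> \<open>Chosen so that \<open>\<theta> * B \<le> 1 / 2\<close>: the factorial of the
    exponential series cancels the one in the moment bound, and a geometric series with sum 2
    remains. The \<open>+ 1\<close> keeps \<open>\<theta>\<close> positive for
    \<open>B = 0\<close>.\<close>
  define \<theta> where "\<theta> = 1 / (2 * (B + 1))"
  have \<theta>: "\<theta> > 0" "\<theta> * B \<le> 1 / 2" using \<open>0 \<le> B\<close> by (auto simp: \<theta>_def field_simps)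
  have "(\<integral>\<^sup>+x. ennreal (exp (\<theta> * (S x)\<^sup>2)) \<partial>M) = (\<integral>\<^sup>+x. (\<Sum>j. ennreal (\<theta> ^ j / fact j) * ennreal (S x ^ (2 * j))) \<partial>M)"
  proof (intro nn_integral_cong)
    fix x
    have "(\<lambda>j. (\<theta> * (S x)\<^sup>2) ^ j / fact j) sums exp (\<theta> * (S x)\<^sup>2)"
      using exp_converges[of "\<theta> * (S x)\<^sup>2"] by (simp add: scaleR_conv_of_real field_simps)
    then have "(\<Sum>j. ennreal ((\<theta> * (S x)\<^sup>2) ^ j / fact j)) = ennreal (exp (\<theta> * (S x)\<^sup>2))"
      using \<theta> by (intro suminf_ennreal_eq) auto
    moreover have "ennreal ((\<theta> * (S x)\<^sup>2) ^ j / fact j) = ennreal (\<theta> ^ j / fact j) * ennreal (S x ^ (2 * j))" for j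
      using \<theta> by (simp add: power_mult_distrib power_mult flip: ennreal_mult)
    ultimately show "ennreal (exp (\<theta> * (S x)\<^sup>2)) = (\<Sum>j. ennreal (\<theta> ^ j / fact j) * ennreal (S x ^ (2 * j)))"
      by simp
  qed
  also have "\<dots> = (\<Sum>j. \<integral>\<^sup>+x. ennreal (\<theta> ^ j / fact j) * ennreal (S x ^ (2 * j)) \<partial>M)"
    by (rule nn_integral_suminf) measurable
  also have "\<dots> = (\<Sum>j. ennreal (\<theta> ^ j / fact j) * (\<integral>\<^sup>+x. ennreal (S x ^ (2 * j)) \<partial>M))"
    by (subst nn_integral_cmult) auto
  also have "\<dots> \<le> (\<Sum>j. ennreal ((1 / 2) ^ j))"
  proof (intro suminf_le)
    fix j
    have "ennreal (\<theta> ^ j / fact j) * (\<integral>\<^sup>+x. ennreal (S x ^ (2 * j)) \<partial>M)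
        \<le> ennreal (\<theta> ^ j / fact j) * ennreal (B ^ j * fact j)"
      by (intro mult_left_mono moments) auto
    also have "\<dots> = ennreal ((\<theta> * B) ^ j)"
      using \<theta> \<open>0 \<le> B\<close> by (simp add: power_mult_distrib flip: ennreal_mult)
    also have "\<dots> \<le> ennreal ((1 / 2) ^ j)"
      using \<theta> \<open>0 \<le> B\<close> by (intro ennreal_leI power_mono) auto
    finally show "ennreal (\<theta> ^ j / fact j) * (\<integral>\<^sup>+x. ennreal (S x ^ (2 * j)) \<partial>M) \<le> ennreal ((1 / 2) ^ j)" .
  qed auto
  also have "\<dots> = ennreal 2"
    using geometric_sums[of "1 / 2 :: real"] by (intro suminf_ennreal_eq) auto
  finally show thesis using that[OF \<theta>(1)] by (simp add: le_less_trans)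
qed

lemma (in prob_space) indep_var_nn_integral:
  fixes f g :: "'a \<Rightarrow> ennreal"
  assumes "indep_var borel f borel g"
  shows "(\<integral>\<^sup>+x. f x * g x \<partial>M) = (\<integral>\<^sup>+x. f x \<partial>M) * (\<integral>\<^sup>+x. g x \<partial>M)"
proof -
  have eq: "case_bool borel borel = (\<lambda>_. borel :: ennreal measure)" by (auto split: bool.split)
  have "indep_vars (\<lambda>_. borel) (case_bool f g) UNIV"
    using assms unfolding indep_var_def eq .
  from indep_vars_nn_integral[OF _ this] show ?thesis
    by (simp add: UNIV_bool mult.commute)
qed

text \<open>The events that \<open>\<bar>Y\<bar> \<le> K\<close> exhaust the space, so one of them
  has positive probability. On it
  \<open>X\<^sup>2 \<le> 2 * (X + Y)\<^sup>2 + 2 * K\<^sup>2\<close>, which costs the factor 1/2 in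
  the exponent, and by independence its probability splits off from the expectation in
  \<open>X\<close>.\<close>

lemma (in prob_space) exp_square_integrable_of_indep_sum:
  fixes X Y :: "'a \<Rightarrow> real"
  assumes indep: "indep_var borel X borel Y" and "\<theta> > 0"
    and fin: "(\<integral>\<^sup>+x. ennreal (exp (\<theta> * (X x + Y x)\<^sup>2)) \<partial>M) < \<infinity>"
  shows "integrable M (\<lambda>x. exp (\<theta> / 2 * (X x)\<^sup>2))"
proof -
  have [measurable]: "X \<in> borel_measurable M" "Y \<in> borel_measurable M"
    using indep by (auto dest: indep_var_rv1 indep_var_rv2)
  have "\<exists>K::nat. prob {x \<in> space M. \<bar>Y x\<bar> \<le> real K} \<noteq> 0"
  proof (rule ccontr)
    assume "\<not> ?thesis"
    then have "AE x in M. \<not> \<bar>Y x\<bar> \<le> real K" for K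
      using prob_eq_0[of "{x \<in> space M. \<bar>Y x\<bar> \<le> real K}"] by auto
    then have "AE x in M. \<forall>K::nat. \<not> \<bar>Y x\<bar> \<le> real K" by (simp add: AE_all_countable)
    then have "AE x in M. False"
      by (rule AE_mp) (auto intro!: AE_I2 simp: real_arch_simple)
    then show False by simp
  qed
  then obtain K :: nat where K: "prob {x \<in> space M. \<bar>Y x\<bar> \<le> real K} \<noteq> 0" by blast
  define F where "F x = ennreal (exp (\<theta> / 2 * x\<^sup>2))" for x :: real
  define G where "G y = (indicator {-real K..real K} y :: ennreal)" for y :: real
  have "indep_var borel (F \<circ> X) borel (G \<circ> Y)"
    by (rule indep_var_compose[OF indep]) (simp_all add: F_def[abs_def] G_def[abs_def])
  then have "(\<integral>\<^sup>+x. F (X x) * G (Y x) \<partial>M) = (\<integral>\<^sup>+x. F (X x) \<partial>M) * (\<integral>\<^sup>+x. G (Y x) \<partial>M)"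
    by (intro indep_var_nn_integral) (simp add: o_def)
  moreover have "(\<integral>\<^sup>+x. F (X x) * G (Y x) \<partial>M) \<le> (\<integral>\<^sup>+x. ennreal (exp (\<theta> * (real K)\<^sup>2)) * ennreal (exp (\<theta> * (X x + Y x)\<^sup>2)) \<partial>M)"
  proof (intro nn_integral_mono)
    fix x
    show "F (X x) * G (Y x) \<le> ennreal (exp (\<theta> * (real K)\<^sup>2)) * ennreal (exp (\<theta> * (X x + Y x)\<^sup>2))"
    proof (cases "Y x \<in> {-real K..real K}")
      case True
      then have "(Y x)\<^sup>2 \<le> (real K)\<^sup>2"
        by (intro abs_le_square_iff[THEN iffD1]) auto
      \<comment> \<open>The difference of the two sides is the square of
        \<open>X x + 2 * Y x\<close>.\<close>
      moreover have "(X x)\<^sup>2 \<le> 2 * (X x + Y x)\<^sup>2 + 2 * (Y x)\<^sup>2"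
        using zero_le_power2[of "X x + 2 * Y x"] by (simp add: power2_eq_square algebra_simps)
      ultimately have "\<theta> / 2 * (X x)\<^sup>2 \<le> \<theta> / 2 * (2 * (X x + Y x)\<^sup>2 + 2 * (real K)\<^sup>2)"
        using \<open>\<theta> > 0\<close> by (intro mult_left_mono) auto
      also have "\<dots> = \<theta> * (real K)\<^sup>2 + \<theta> * (X x + Y x)\<^sup>2"
        by (simp add: field_simps)
      finally show ?thesis
        using True by (simp add: F_def G_def ennreal_leI flip: ennreal_mult' exp_add)
    qed (simp add: G_def)
  qed
  moreover have "\<dots> < \<infinity>"
    using fin by (simp add: nn_integral_cmult ennreal_mult_less_top)
  moreover have "(\<integral>\<^sup>+x. G (Y x) \<partial>M) \<noteq> 0"
  proof -
    have "(\<integral>\<^sup>+x. G (Y x) \<partial>M) = (\<integral>\<^sup>+x. indicator {x \<in> space M. \<bar>Y x\<bar> \<le> real K} x \<partial>M)"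
      by (intro nn_integral_cong) (auto simp: G_def indicator_def)
    also have "\<dots> = emeasure M {x \<in> space M. \<bar>Y x\<bar> \<le> real K}"
      by (rule nn_integral_indicator) measurable
    finally show ?thesis using K by (simp add: emeasure_eq_measure)
  qed
  ultimately have "(\<integral>\<^sup>+x. F (X x) \<partial>M) < \<infinity>"
    by (auto simp: less_top[symmetric] top_unique ennreal_mult_eq_top_iff)
  then show ?thesis
    by (intro integrableI_bounded) (auto simp: F_def)
qed

subsection \<open>Characteristic functions\<close>

text \<open>The argument is complex from the start, so the characteristic function and its entire
  extension are one function. Off the real line the integrand need not be integrable, and then the
  integral has the default value 0; statements there wait for exponential moments.\<close>

definition (in prob_space) charfn :: "('a \<Rightarrow> real) \<Rightarrow> complex \<Rightarrow> complex" where
  "charfn X z = (CLINT \<omega>|M. exp (\<i> * z * of_real (X \<omega>)))"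

text \<open>This is \<open>- \<i>\<close> times the derivative of the characteristic function when
  second moments exist. It is kept in integral form because this is what arises when
  \<open>X\<close> is tested against exponentials.\<close>

definition (in prob_space) tilted_mean :: "('a \<Rightarrow> real) \<Rightarrow> real \<Rightarrow> complex" where
  "tilted_mean X t = (CLINT \<omega>|M. of_real (X \<omega>) * iexp (t * X \<omega>))"

lemma norm_integral_le_integral:
  fixes f :: "'a \<Rightarrow> 'b :: {banach, second_countable_topology}"
  assumes "integrable M f" "integrable M g" "\<And>x. x \<in> space M \<Longrightarrow> norm (f x) \<le> g x"
  shows "norm (integral\<^sup>L M f) \<le> integral\<^sup>L M g"
  by (rule order_trans[OF Bochner_Integration.integral_norm_bound integral_mono]) (use assms in auto)

context prob_space
begin

lemma charfn_of_real: "charfn X (of_real t) = (CLINT \<omega>|M. iexp (t * X \<omega>))"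
  by (simp add: charfn_def mult.assoc)

lemma char_distr_eq_charfn:
  assumes "random_variable borel X"
  shows "char (distr M borel X) t = charfn X (of_real t)"
  unfolding char_def charfn_of_real by (subst integral_distr) (use assms in auto)

lemma charfn_0: "charfn X 0 = 1"
  by (simp add: charfn_def prob_space)

lemma integrable_mult_iexp:
  assumes "integrable M W" and [measurable]: "random_variable borel X"
  shows "integrable M (\<lambda>\<omega>. of_real (W \<omega>) * iexp (t * X \<omega>))"
  by (rule Bochner_Integration.integrable_bound[OF assms(1)]) (use assms in \<open>auto simp: norm_mult\<close>)

lemma cnj_expectation_mult_iexp:
  "cnj (CLINT \<omega>|M. of_real (W \<omega>) * iexp (t * X \<omega>)) = (CLINT \<omega>|M. of_real (W \<omega>) * iexp (- t * X \<omega>))"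
  by (simp add: exp_cnj flip: Bochner_Integration.integral_cnj)

text \<open>The second moment bounds the error of the linear approximation by
  \<open>m * (y - t)\<^sup>2\<close>: the Taylor remainder of \<open>iexp\<close> is at most
  quadratic, and a unimodular factor \<open>iexp (t * X \<omega>)\<close> can be taken out.\<close>

lemma charfn_has_vector_derivative:
  assumes [measurable]: "random_variable borel X" and X2: "integrable M (\<lambda>\<omega>. (X \<omega>)\<^sup>2)"
  shows "((\<lambda>t. charfn X (of_real t)) has_vector_derivative \<i> * tilted_mean X t) (at t within A)"
proof -
  define m where "m = expectation (\<lambda>\<omega>. (X \<omega>)\<^sup>2)"
  have m: "m \<ge> 0" unfolding m_def by (intro integral_nonneg_AE) auto
  have iX: "integrable M X" by (rule square_integrable_imp_integrable[OF _ X2]) measurable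
  have ie: "integrable M (\<lambda>\<omega>. iexp (s * X \<omega>))" for s
    using integrable_mult_iexp[of "\<lambda>_. 1" X s] by simp
  have iXe: "integrable M (\<lambda>\<omega>. of_real (X \<omega>) * iexp (t * X \<omega>))"
    by (rule integrable_mult_iexp[OF iX]) measurable
  have bound: "cmod (charfn X (of_real y) - charfn X (of_real t) - (y - t) *\<^sub>R (\<i> * tilted_mean X t)) \<le> m * (y - t)\<^sup>2" for y
  proof -
    define W where "W \<omega> = iexp (y * X \<omega>) - iexp (t * X \<omega>) - of_real (y - t) * \<i> * (of_real (X \<omega>) * iexp (t * X \<omega>))" for \<omega>
    have "charfn X (of_real y) - charfn X (of_real t) - (y - t) *\<^sub>R (\<i> * tilted_mean X t) = (CLINT \<omega>|M. W \<omega>)"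
      using ie iXe by (simp add: W_def charfn_of_real tilted_mean_def scaleR_conv_of_real mult.assoc del: of_real_mult of_real_diff)
    also have "cmod \<dots> \<le> expectation (\<lambda>\<omega>. (y - t)\<^sup>2 * (X \<omega>)\<^sup>2)"
    proof (rule norm_integral_le_integral)
      show "integrable M W" unfolding W_def
        by (intro Bochner_Integration.integrable_diff integrable_mult_right ie iXe)
      show "integrable M (\<lambda>\<omega>. (y - t)\<^sup>2 * (X \<omega>)\<^sup>2)" using X2 by simp
      fix \<omega>
      define u where "u = (y - t) * X \<omega>"
      have "W \<omega> = iexp (t * X \<omega>) * (iexp u - 1 - \<i> * of_real u)"
        by (simp add: W_def u_def algebra_simps flip: exp_add)
      then have "cmod (W \<omega>) = cmod (iexp u - 1 - \<i> * of_real u)"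
        by (simp only: norm_mult norm_exp_i_times mult_1_left)
      also have "iexp u - 1 - \<i> * of_real u = iexp u - (\<Sum>k\<le>1. (\<i> * of_real u) ^ k / fact k)"
        by simp
      also have "cmod (iexp u - (\<Sum>k\<le>1. (\<i> * of_real u) ^ k / fact k)) \<le> \<bar>u\<bar> ^ Suc 1 / fact (Suc 1)"
        by (rule iexp_approx1)
      also have "\<dots> \<le> u\<^sup>2" using zero_le_square[of u] by (simp add: power2_eq_square)
      finally show "cmod (W \<omega>) \<le> (y - t)\<^sup>2 * (X \<omega>)\<^sup>2" by (simp add: u_def power_mult_distrib)
    qed
    finally show ?thesis by (simp add: m_def mult.commute)
  qed
  have "((\<lambda>t. charfn X (of_real t)) has_vector_derivative \<i> * tilted_mean X t) (at t)"
    unfolding has_vector_derivative_def has_derivative_at_alt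
  proof (intro conjI allI impI)
    show "bounded_linear (\<lambda>h. h *\<^sub>R (\<i> * tilted_mean X t))" by (rule bounded_linear_scaleR_left)
    fix e :: real assume e: "0 < e"
    show "\<exists>d>0. \<forall>y. norm (y - t) < d \<longrightarrow>
       norm (charfn X (of_real y) - charfn X (of_real t) - (y - t) *\<^sub>R (\<i> * tilted_mean X t)) \<le> e * norm (y - t)"
    proof (intro exI[of _ "e / (m + 1)"] conjI allI impI)
      show "0 < e / (m + 1)" using e m by simp
      fix y assume y: "norm (y - t) < e / (m + 1)"
      have "m * \<bar>y - t\<bar> \<le> (m + 1) * (e / (m + 1))"
        using y m by (intro mult_mono) auto
      then have "m * \<bar>y - t\<bar> * \<bar>y - t\<bar> \<le> e * \<bar>y - t\<bar>"
        using m by (intro mult_right_mono) auto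
      then show "norm (charfn X (of_real y) - charfn X (of_real t) - (y - t) *\<^sub>R (\<i> * tilted_mean X t)) \<le> e * norm (y - t)"
        using bound[of y] by (simp add: power2_eq_square mult.assoc)
    qed
  qed
  then show ?thesis by (rule has_vector_derivative_at_within)
qed

lemma tilted_mean_continuous:
  assumes [measurable]: "random_variable borel X" and iX: "integrable M X"
  shows "continuous_on A (tilted_mean X)"
  unfolding tilted_mean_def continuous_on_def
proof
  fix t assume "t \<in> A"
  have "((\<lambda>s. CLINT \<omega>|M. of_real (X \<omega>) * iexp (s * X \<omega>)) \<longlongrightarrow> (CLINT \<omega>|M. of_real (X \<omega>) * iexp (t * X \<omega>))) (at t)"
    unfolding tendsto_at_iff_sequentially o_def
  proof safe
    fix q assume q: "\<forall>i. q i \<in> UNIV - {t}" "q \<longlonglongrightarrow> t"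
    show "(\<lambda>i. CLINT \<omega>|M. of_real (X \<omega>) * iexp (q i * X \<omega>)) \<longlonglongrightarrow> (CLINT \<omega>|M. of_real (X \<omega>) * iexp (t * X \<omega>))"
    proof (rule integral_dominated_convergence[where w = "\<lambda>\<omega>. \<bar>X \<omega>\<bar>"])
      show "AE \<omega> in M. (\<lambda>i. of_real (X \<omega>) * iexp (q i * X \<omega>)) \<longlonglongrightarrow> of_real (X \<omega>) * iexp (t * X \<omega>)"
        by (intro AE_I2 tendsto_intros q)
    qed (use iX in \<open>auto simp: norm_mult\<close>)
  qed
  then show "((\<lambda>s. CLINT \<omega>|M. of_real (X \<omega>) * iexp (s * X \<omega>)) \<longlongrightarrow> (CLINT \<omega>|M. of_real (X \<omega>) * iexp (t * X \<omega>))) (at t within A)"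
    by (rule tendsto_within_subset) simp
qed

text \<open>Completing the square gives \<open>r * \<bar>x\<bar> \<le> \<theta> * x\<^sup>2 +
  r\<^sup>2 / (4 * \<theta>)\<close>. The last term is the source of order at most 2 for the
  characteristic functions.\<close>

lemma exp_mult_integrable:
  fixes X :: "'a \<Rightarrow> real" and r \<theta> :: real
  assumes [measurable]: "random_variable borel X" and "\<theta> > 0"
    and int: "integrable M (\<lambda>\<omega>. exp (\<theta> * (X \<omega>)\<^sup>2))"
  shows "integrable M (\<lambda>\<omega>. exp (r * \<bar>X \<omega>\<bar>))"
    and "expectation (\<lambda>\<omega>. exp (r * \<bar>X \<omega>\<bar>)) \<le> expectation (\<lambda>\<omega>. exp (\<theta> * (X \<omega>)\<^sup>2)) * exp (r\<^sup>2 / (4 * \<theta>))"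
proof -
  have le: "exp (r * \<bar>x\<bar>) \<le> exp (\<theta> * x\<^sup>2) * exp (r\<^sup>2 / (4 * \<theta>))" for x :: real
  proof -
    have "0 \<le> \<theta> * (\<bar>x\<bar> - r / (2 * \<theta>))\<^sup>2" using \<open>\<theta> > 0\<close> by simp
    also have "\<dots> = \<theta> * x\<^sup>2 - r * \<bar>x\<bar> + r\<^sup>2 / (4 * \<theta>)"
      using \<open>\<theta> > 0\<close> by (simp add: power2_diff field_simps power2_eq_square)
    finally show ?thesis by (simp flip: exp_add)
  qed
  show i: "integrable M (\<lambda>\<omega>. exp (r * \<bar>X \<omega>\<bar>))"
    by (rule Bochner_Integration.integrable_bound[where f = "\<lambda>\<omega>. exp (\<theta> * (X \<omega>)\<^sup>2) * exp (r\<^sup>2 / (4 * \<theta>))"])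
      (use int le in auto)
  have "expectation (\<lambda>\<omega>. exp (r * \<bar>X \<omega>\<bar>)) \<le> expectation (\<lambda>\<omega>. exp (\<theta> * (X \<omega>)\<^sup>2) * exp (r\<^sup>2 / (4 * \<theta>)))"
    by (rule integral_mono[OF i]) (use int le in auto)
  then show "expectation (\<lambda>\<omega>. exp (r * \<bar>X \<omega>\<bar>)) \<le> expectation (\<lambda>\<omega>. exp (\<theta> * (X \<omega>)\<^sup>2)) * exp (r\<^sup>2 / (4 * \<theta>))"
    by simp
qed

lemma cmod_exp_i_mult_le: "cmod (exp (\<i> * z * of_real x)) \<le> exp (cmod z * \<bar>x\<bar>)"
proof -
  have "- (Im z * x) \<le> \<bar>Im z\<bar> * \<bar>x\<bar>" by (metis abs_ge_minus_self abs_mult)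
  also have "\<dots> \<le> cmod z * \<bar>x\<bar>" by (intro mult_right_mono abs_Im_le_cmod) auto
  finally show ?thesis by simp
qed

lemma charfn_growth:
  assumes [measurable]: "random_variable borel X" and "\<theta> > 0"
    and int: "integrable M (\<lambda>\<omega>. exp (\<theta> * (X \<omega>)\<^sup>2))"
  shows "cmod (charfn X z) \<le> expectation (\<lambda>\<omega>. exp (\<theta> * (X \<omega>)\<^sup>2)) * exp ((cmod z)\<^sup>2 / (4 * \<theta>))"
proof -
  note e = exp_mult_integrable[OF assms]
  have "cmod (charfn X z) \<le> expectation (\<lambda>\<omega>. exp (cmod z * \<bar>X \<omega>\<bar>))"
    unfolding charfn_def
  proof (rule norm_integral_le_integral)
    show "integrable M (\<lambda>\<omega>. exp (\<i> * z * of_real (X \<omega>)))"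
      by (rule Bochner_Integration.integrable_bound[OF e(1)[of "cmod z"]]) (auto intro: cmod_exp_i_mult_le simp del: norm_exp_eq_Re)
  qed (auto intro: e cmod_exp_i_mult_le simp del: norm_exp_eq_Re)
  also note e(2)
  finally show ?thesis .
qed

text \<open>The exponential is expanded and integrated term by term, which gives a power series with
  the moments as coefficients. The interchange is justified because all partial sums of the norms
  stay below the integrable \<open>exp (cmod w * \<bar>X \<omega>\<bar>)\<close>.\<close>

lemma charfn_holomorphic:
  assumes [measurable]: "random_variable borel X" and "\<theta> > 0"
    and int: "integrable M (\<lambda>\<omega>. exp (\<theta> * (X \<omega>)\<^sup>2))"
  shows "charfn X holomorphic_on UNIV"
proof -
  note e = exp_mult_integrable[OF assms]
  have "charfn X holomorphic_on ball 0 r" for r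
  proof (rule power_series_holomorphic)
    fix w :: complex assume "w \<in> ball 0 r"
    let ?f = "\<lambda>n \<omega>. (\<i> * w * of_real (X \<omega>)) ^ n / fact n"
    have norm_f: "norm (?f n \<omega>) = (cmod w * \<bar>X \<omega>\<bar>) ^ n / fact n" for n \<omega>
      by (simp add: norm_divide norm_power norm_mult)
    have real_sums: "(\<lambda>n. (cmod w * \<bar>X \<omega>\<bar>) ^ n / fact n) sums exp (cmod w * \<bar>X \<omega>\<bar>)" for \<omega>
      using exp_converges[of "cmod w * \<bar>X \<omega>\<bar>"] by (simp add: scaleR_conv_of_real field_simps)
    have le: "(\<Sum>n<N. (cmod w * \<bar>X \<omega>\<bar>) ^ n / fact n) \<le> exp (cmod w * \<bar>X \<omega>\<bar>)" for N \<omega>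
      by (subst sums_unique[OF real_sums], rule sum_le_suminf) (use sums_summable[OF real_sums] in auto)
    have int_n: "integrable M (\<lambda>\<omega>. (cmod w * \<bar>X \<omega>\<bar>) ^ n / fact n)" for n
    proof (rule Bochner_Integration.integrable_bound[OF e(1)[of "cmod w"]])
      have "(cmod w * \<bar>X \<omega>\<bar>) ^ n / fact n \<le> exp (cmod w * \<bar>X \<omega>\<bar>)" for \<omega>
        using le[of \<omega> "Suc n"] sum_nonneg[of "{..<n}" "\<lambda>n. (cmod w * \<bar>X \<omega>\<bar>) ^ n / fact n"] by simp
      then show "AE \<omega> in M. norm ((cmod w * \<bar>X \<omega>\<bar>) ^ n / fact n) \<le> norm (exp (cmod w * \<bar>X \<omega>\<bar>))"
        by auto
    qed measurable
    have int_f: "integrable M (?f n)" for n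
      by (rule Bochner_Integration.integrable_bound[OF int_n[of n]]) (auto simp: norm_f)
    have "(\<lambda>n. integral\<^sup>L M (?f n)) sums (CLINT \<omega>|M. (\<Sum>n. ?f n \<omega>))"
    proof (rule sums_integral[OF int_f])
      show "AE \<omega> in M. summable (\<lambda>n. norm (?f n \<omega>))"
        unfolding norm_f using real_sums by (auto intro: sums_summable)
      show "summable (\<lambda>n. LINT \<omega>|M. norm (?f n \<omega>))"
        unfolding norm_f
      proof (rule summableI_nonneg_bounded)
        show "(\<Sum>n<N. LINT \<omega>|M. (cmod w * \<bar>X \<omega>\<bar>) ^ n / fact n) \<le> (LINT \<omega>|M. exp (cmod w * \<bar>X \<omega>\<bar>))" for N
        proof -
          have "(\<Sum>n<N. LINT \<omega>|M. (cmod w * \<bar>X \<omega>\<bar>) ^ n / fact n) = (LINT \<omega>|M. (\<Sum>n<N. (cmod w * \<bar>X \<omega>\<bar>) ^ n / fact n))"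
            using int_n by (subst Bochner_Integration.integral_sum) auto
          also have "\<dots> \<le> (LINT \<omega>|M. exp (cmod w * \<bar>X \<omega>\<bar>))"
            using int_n e(1) le by (intro integral_mono Bochner_Integration.integrable_sum) auto
          finally show ?thesis .
        qed
      qed auto
    qed
    moreover have "(\<Sum>n. ?f n \<omega>) = exp (\<i> * w * of_real (X \<omega>))" for \<omega>
      using exp_converges[of "\<i> * w * of_real (X \<omega>)"]
      by (intro sums_unique[symmetric]) (simp add: scaleR_conv_of_real field_simps)
    moreover have "integral\<^sup>L M (?f n) = (CLINT \<omega>|M. (\<i> * of_real (X \<omega>)) ^ n / fact n) * w ^ n" for n
      by (subst integral_mult_left_zero[symmetric]) (auto intro!: Bochner_Integration.integral_cong simp: power_mult_distrib)
    ultimately show "(\<lambda>n. (CLINT \<omega>|M. (\<i> * of_real (X \<omega>)) ^ n / fact n) * (w - 0) ^ n) sums charfn X w"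
      by (simp add: charfn_def)
  qed
  then have "charfn X field_differentiable at z" for z
    by (rule holomorphic_on_imp_differentiable_at[of _ "ball 0 (cmod z + 1)"]) auto
  then show ?thesis
    by (simp add: holomorphic_on_def)
qed

end

section \<open>Gaussian laws through their characteristic functions\<close>

context prob_space
begin

lemma charfn_affine:
  "charfn (\<lambda>\<omega>. p + q * X \<omega>) z = exp (\<i> * z * of_real p) * charfn X (of_real q * z)"
proof -
  have "exp (\<i> * z * of_real (p + q * X \<omega>)) = exp (\<i> * z * of_real p) * exp (\<i> * (of_real q * z) * of_real (X \<omega>))" for \<omega>
    by (simp add: algebra_simps flip: exp_add)
  then show ?thesis by (simp add: charfn_def)
qed

lemma cmod_charfn_le_1: "cmod (charfn X (of_real t)) \<le> 1"
\<comment> \<open>Measurability of \<open>X\<close> is not assumed; in the second case the integral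
  is 0 by convention.\<close>
proof (cases "integrable M (\<lambda>\<omega>. iexp (t * X \<omega>))")
  case True
  have "cmod (charfn X (of_real t)) \<le> expectation (\<lambda>_. 1)"
    unfolding charfn_of_real by (rule norm_integral_le_integral[OF True]) auto
  then show ?thesis by (simp add: prob_space)
qed (simp add: charfn_of_real not_integrable_integral_eq)

lemma cnj_charfn: "cnj (charfn X (of_real t)) = charfn X (of_real (- t))"
  using cnj_expectation_mult_iexp[of "\<lambda>_. 1" t X] by (simp add: charfn_of_real del: of_real_minus)

lemma cnj_tilted_mean: "cnj (tilted_mean X t) = tilted_mean X (- t)"
  unfolding tilted_mean_def by (rule cnj_expectation_mult_iexp)

text \<open>One formula with \<open>s \<ge> 0\<close> covers both alternatives of
  \<open>gaussian_rv\<close>, the value \<open>s = 0\<close> being the point mass. The positive case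
  is standardized to the standard normal law, and Levy's uniqueness theorem gives the way
  back.\<close>

lemma gaussian_rv_iff_charfn:
  assumes [measurable]: "random_variable borel X"
  shows "gaussian_rv M X \<longleftrightarrow> (\<exists>\<mu> s. s \<ge> 0 \<and> (\<forall>t::real. charfn X (of_real t) = exp (\<i> * of_real (\<mu> * t) - of_real (s\<^sup>2 * t\<^sup>2 / 2))))"
    (is "_ \<longleftrightarrow> (\<exists>\<mu> s. s \<ge> 0 \<and> ?C \<mu> s)")
proof
  assume g: "gaussian_rv M X"
  then obtain \<mu> where \<mu>: "(AE \<omega> in M. X \<omega> = \<mu>) \<or> (\<exists>\<sigma>>0. distributed M lborel X (normal_density \<mu> \<sigma>))"
    unfolding gaussian_rv_def by blast
  then show "\<exists>\<mu> s. s \<ge> 0 \<and> ?C \<mu> s"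
  proof (elim disjE exE conjE)
    assume ae: "AE \<omega> in M. X \<omega> = \<mu>"
    have "charfn X (of_real t) = iexp (t * \<mu>)" for t
    proof -
      have "charfn X (of_real t) = (CLINT \<omega>|M. iexp (t * \<mu>))"
        unfolding charfn_of_real by (rule integral_cong_AE) (use ae in auto)
      then show ?thesis by (simp add: prob_space)
    qed
    then show ?thesis by - (rule exI[of _ \<mu>], rule exI[of _ 0], simp add: mult.commute)
  next
    fix \<sigma> :: real assume \<sigma>: "\<sigma> > 0" "distributed M lborel X (normal_density \<mu> \<sigma>)"
    define Z where "Z \<omega> = (X \<omega> - \<mu>) / \<sigma>" for \<omega>
    have [measurable]: "random_variable borel Z" by (simp add: Z_def[abs_def])
    have "distributed M lborel Z std_normal_density"
      using \<sigma> normal_standard_normal_convert[OF \<sigma>(1)] by (simp add: Z_def[abs_def])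
    then have "distr M lborel Z = std_normal_distribution"
      by (simp add: distributed_def)
    moreover have "distr M lborel Z = distr M borel Z"
      by (rule distr_cong) auto
    ultimately have Zc: "charfn Z (of_real t) = exp (- (t\<^sup>2) / 2)" for t
      using char_std_normal_distribution char_distr_eq_charfn[of Z t] by simp
    have X: "X = (\<lambda>\<omega>. \<mu> + \<sigma> * Z \<omega>)" using \<sigma> by (auto simp: Z_def)
    have "charfn X (of_real t) = exp (\<i> * of_real (\<mu> * t) - of_real (\<sigma>\<^sup>2 * t\<^sup>2 / 2))" for t
    proof -
      have "charfn X (of_real t) = exp (\<i> * of_real t * of_real \<mu>) * charfn Z (of_real (\<sigma> * t))"
        by (subst X, subst charfn_affine) simp
      also have "charfn Z (of_real (\<sigma> * t)) = exp (of_real (- (\<sigma>\<^sup>2 * t\<^sup>2 / 2)))"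
        unfolding Zc by (simp add: power_mult_distrib flip: exp_of_real)
      also have "exp (\<i> * of_real t * of_real \<mu>) * exp (of_real (- (\<sigma>\<^sup>2 * t\<^sup>2 / 2)))
          = exp (\<i> * of_real (\<mu> * t) - of_real (\<sigma>\<^sup>2 * t\<^sup>2 / 2))"
        by (simp add: mult_ac flip: exp_add)
      finally show ?thesis .
    qed
    then show ?thesis using \<sigma> by - (rule exI[of _ \<mu>], rule exI[of _ \<sigma>], auto)
  qed
next
  assume "\<exists>\<mu> s. s \<ge> 0 \<and> ?C \<mu> s"
  then obtain \<mu> s where s: "s \<ge> 0" and C: "?C \<mu> s" by blast
  have "(AE \<omega> in M. X \<omega> = \<mu>) \<or> (\<exists>\<sigma>>0. distributed M lborel X (normal_density \<mu> \<sigma>))"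
  proof (cases "s = 0")
    case True
    interpret R: prob_space "return borel \<mu>" by (rule prob_space_return) simp
    have "distr M borel X = return borel \<mu>"
    proof (rule Levy_uniqueness)
      show "real_distribution (return borel \<mu>)" by unfold_locales simp
      show "char (distr M borel X) = char (return borel \<mu>)"
      proof
        fix t
        have "char (return borel \<mu>) t = iexp (t * \<mu>)"
          unfolding char_def by (rule integral_return) auto
        then show "char (distr M borel X) t = char (return borel \<mu>) t"
          using C True by (simp add: char_distr_eq_charfn mult.commute)
      qed
    qed simp
    moreover have "AE x in return borel \<mu>. x = \<mu>" by (subst AE_return) auto
    ultimately have "AE x in distr M borel X. x = \<mu>" by (simp only:)
    then have "AE \<omega> in M. X \<omega> = \<mu>" by (simp add: AE_distr_iff)
    then show ?thesis by blast
  next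
    case False
    with s have s: "s > 0" by simp
    define Z where "Z \<omega> = (X \<omega> - \<mu>) / s" for \<omega>
    have [measurable]: "random_variable borel Z" by (simp add: Z_def[abs_def])
    have Z: "Z = (\<lambda>\<omega>. - \<mu> / s + (1 / s) * X \<omega>)"
      using s by (auto simp: Z_def field_simps)
    have "distr M borel Z = std_normal_distribution"
    proof (rule Levy_uniqueness[OF _ real_dist_normal_dist], simp, rule ext)
      fix t
      have "char (distr M borel Z) t = exp (\<i> * of_real t * of_real (- \<mu> / s)) * charfn X (of_real (t / s))"
        by (subst char_distr_eq_charfn, simp, subst Z, subst charfn_affine) simp
      also have "\<dots> = exp (\<i> * of_real t * of_real (- \<mu> / s) + (\<i> * of_real (\<mu> * (t / s)) - of_real (s\<^sup>2 * (t / s)\<^sup>2 / 2)))"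
        unfolding C[rule_format] by (simp only: exp_add)
      also have "\<i> * of_real t * of_real (- \<mu> / s) + (\<i> * of_real (\<mu> * (t / s)) - of_real (s\<^sup>2 * (t / s)\<^sup>2 / 2)) = of_real (- (t\<^sup>2) / 2)"
        using s by (simp add: power_divide)
      finally show "char (distr M borel Z) t = char std_normal_distribution t"
        by (simp only: char_std_normal_distribution exp_of_real)
    qed
    moreover have "distr M lborel Z = distr M borel Z"
      by (rule distr_cong) auto
    ultimately have "distributed M lborel Z std_normal_density"
      by (simp add: distributed_def)
    then show ?thesis
      using normal_standard_normal_convert[OF s] s by (auto simp: Z_def[abs_def])
  qed
  then show "gaussian_rv M X" by (auto simp: gaussian_rv_def)
qed

text \<open>Modulus at most 1 forces \<open>p1\<close> to be imaginary and
  \<open>Re p2 \<le> 0\<close>; symmetry under conjugation forces \<open>p2\<close> to be real. The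
  constant \<open>p0\<close> can be a nonzero multiple of \<open>2 * pi * \<i>\<close>, so only
  \<open>exp p0 = 1\<close> can be concluded.\<close>

lemma gaussian_rv_of_quadratic_exponent:
  assumes [measurable]: "random_variable borel X"
    and eq: "\<And>t::real. charfn X (of_real t) = exp (p0 + p1 * of_real t + p2 * (of_real t)\<^sup>2)"
  shows "gaussian_rv M X"
proof -
  have p0: "exp p0 = 1" using eq[of 0] charfn_0 by simp
  have eq': "charfn X (of_real t) = exp (p1 * of_real t + p2 * (of_real t)\<^sup>2)" for t
    by (simp add: eq exp_add p0)
  have le: "Re p1 * t + Re p2 * t\<^sup>2 \<le> 0" for t
  proof -
    have "exp (Re p1 * t + Re p2 * t\<^sup>2) \<le> 1"
      using cmod_charfn_le_1[of X t] by (simp add: eq' power2_eq_square)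
    then show ?thesis by simp
  qed
  have w: "Re p2 \<le> - \<bar>Re p1\<bar>" using le[of 1] le[of "-1"] by auto
  have r: "Re p1 = 0"
  proof (rule ccontr)
    assume nz: "Re p1 \<noteq> 0"
    with w have w0: "Re p2 < 0" by auto
    \<comment> \<open>The vertex of the parabola \<open>Re p1 * t + Re p2 * t\<^sup>2\<close>, at
      which its value would be positive.\<close>
    have "Re p1 * (- Re p1 / (2 * Re p2)) + Re p2 * (- Re p1 / (2 * Re p2))\<^sup>2 = - ((Re p1)\<^sup>2 / (4 * Re p2))"
      using w0 by (simp add: field_simps power2_eq_square)
    moreover have "(Re p1)\<^sup>2 / (4 * Re p2) < 0"
      using nz w0 by (intro divide_pos_neg) auto
    ultimately show False using le[of "- Re p1 / (2 * Re p2)"] by simp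
  qed
  have "exp (cnj (p1 * of_real t + p2 * (of_real t)\<^sup>2)) = exp (p1 * of_real (- t) + p2 * (of_real (- t))\<^sup>2)" for t
    using cnj_charfn[of X t] unfolding eq' exp_cnj by simp
  moreover have "cnj p1 = - p1" using r by (simp add: complex_eq_iff)
  ultimately have "exp (- p1 * of_real t + cnj p2 * (of_real t)\<^sup>2) = exp (- p1 * of_real t + p2 * (of_real t)\<^sup>2)" for t
    by simp
  then have "exp (- p1 * of_real t) * exp (cnj p2 * (of_real t)\<^sup>2) = exp (- p1 * of_real t) * exp (p2 * (of_real t)\<^sup>2)" for t
    by (simp only: exp_add)
  then have ex: "exp (cnj p2 * (of_real t)\<^sup>2) = exp (p2 * (of_real t)\<^sup>2)" for t
    by simp
  have im: "Im p2 = 0"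
  proof (rule ccontr)
    assume nz: "Im p2 \<noteq> 0"
    \<comment> \<open>Chosen so that \<open>\<bar>Im p2\<bar> * t\<^sup>2 = pi / 2\<close>: the
      exponential of \<open>p2 * t\<^sup>2\<close> is then purely imaginary and nonzero, although
      \<open>ex\<close> says that it equals its own conjugate.\<close>
    define t where "t = sqrt (pi / (2 * \<bar>Im p2\<bar>))"
    have t2: "t\<^sup>2 = pi / (2 * \<bar>Im p2\<bar>)" using nz by (simp add: t_def)
    have "Im p2 * t\<^sup>2 = pi / 2 \<or> Im p2 * t\<^sup>2 = - (pi / 2)"
      using nz unfolding t2 by (cases "Im p2 > 0") (auto simp: field_simps)
    then have "sin (Im p2 * t\<^sup>2) = 1 \<or> sin (Im p2 * t\<^sup>2) = - 1"
      by (metis sin_minus sin_pi_half)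
    then have "sin (- (Im p2 * t\<^sup>2)) \<noteq> sin (Im p2 * t\<^sup>2)"
      by (auto simp only: sin_minus)
    moreover have "Im (exp (cnj p2 * (of_real t)\<^sup>2)) = exp (Re p2 * t\<^sup>2) * sin (- (Im p2 * t\<^sup>2))"
      "Im (exp (p2 * (of_real t)\<^sup>2)) = exp (Re p2 * t\<^sup>2) * sin (Im p2 * t\<^sup>2)"
      by (simp_all add: Im_exp flip: of_real_power)
    ultimately show False using ex[of t] by simp
  qed
  show ?thesis
    unfolding gaussian_rv_iff_charfn[OF assms(1)]
  proof (rule exI[of _ "Im p1"], rule exI[of _ "sqrt (- 2 * Re p2)"], intro conjI allI)
    show "0 \<le> sqrt (- 2 * Re p2)" using w by simp
    fix t :: real
    have "p1 = \<i> * of_real (Im p1)" "p2 = of_real (Re p2)"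
      using r im by (simp_all add: complex_eq_iff)
    then have "p1 * of_real t + p2 * (of_real t)\<^sup>2 = \<i> * of_real (Im p1 * t) + of_real (Re p2 * t\<^sup>2)"
      by (metis mult.assoc of_real_mult of_real_power)
    also have "Re p2 * t\<^sup>2 = - ((sqrt (- 2 * Re p2))\<^sup>2 * t\<^sup>2 / 2)"
      using w by simp
    finally show "charfn X (of_real t) = exp (\<i> * of_real (Im p1 * t) - of_real ((sqrt (- 2 * Re p2))\<^sup>2 * t\<^sup>2 / 2))"
      unfolding eq' by simp
  qed
qed

lemma gaussian_rv_shift:
  assumes "gaussian_rv M (\<lambda>\<omega>. X \<omega> - m)"
  shows "gaussian_rv M X"
proof -
  have m1: "random_variable borel (\<lambda>\<omega>. X \<omega> - m)"
    using assms by (simp add: gaussian_rv_def)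
  have "random_variable borel (\<lambda>\<omega>. (X \<omega> - m) + m)"
    using m1 by (rule borel_measurable_add) simp
  then have m2: "random_variable borel X" by simp
  obtain \<mu> s where s: "s \<ge> 0" and
    C: "\<And>t::real. charfn (\<lambda>\<omega>. X \<omega> - m) (of_real t) = exp (\<i> * of_real (\<mu> * t) - of_real (s\<^sup>2 * t\<^sup>2 / 2))"
    using assms unfolding gaussian_rv_iff_charfn[OF m1] by blast
  have "charfn X (of_real t) = exp (\<i> * of_real ((m + \<mu>) * t) - of_real (s\<^sup>2 * t\<^sup>2 / 2))" for t
    using charfn_affine[of m 1 "\<lambda>\<omega>. X \<omega> - m" "of_real t"] C[of t]
    by (simp add: algebra_simps flip: exp_add)
  then show ?thesis unfolding gaussian_rv_iff_charfn[OF m2] using s by blast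
qed

text \<open>The identity theorem carries the equation from the real line to the plane. Growth and
  conclusion concern \<open>F\<close> alone; \<open>G\<close> is treated by a second application
  with the roles exchanged.\<close>

lemma entire_stein_equation_imp_quadratic:
  fixes F G :: "complex \<Rightarrow> complex" and a b v A B :: real
  assumes hol: "F holomorphic_on UNIV" "G holomorphic_on UNIV" and "a > 0" "b > 0"
    and one: "F 0 = 1" "G 0 = 1"
    and growth: "\<And>z. cmod (F z) \<le> A * exp (B * (cmod z)\<^sup>2)"
    and eq: "\<And>t::real. a * deriv F t * G t + b * F t * deriv G t = - v * t * F t * G t"
  obtains p0 p1 p2 where "\<And>z. F z = exp (p0 + p1 * z + p2 * z\<^sup>2)"
proof -
  have "a * deriv F z * G z + b * F z * deriv G z - (- v * z) * F z * G z = 0" for z :: complex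
  proof (rule analytic_continuation[where f = "\<lambda>z :: complex. a * deriv F z * G z + b * F z * deriv G z - (- v * z) * F z * G z"
        and w = z and S = UNIV and U = "range complex_of_real" and \<xi> = 0])
    show "(\<lambda>z :: complex. a * deriv F z * G z + b * F z * deriv G z - (- v * z) * F z * G z) holomorphic_on UNIV"
      by (intro holomorphic_intros holomorphic_deriv hol) auto
    have "(0::complex) islimpt range complex_of_real"
      unfolding islimpt_sequential
    proof (intro exI[of _ "\<lambda>n. complex_of_real (inverse (real (Suc n)))"] conjI allI)
      have "(\<lambda>n. complex_of_real (inverse (real (Suc n)))) \<longlonglongrightarrow> of_real 0"
        by (rule tendsto_of_real) (rule LIMSEQ_inverse_real_of_nat)
      then show "(\<lambda>n. complex_of_real (inverse (real (Suc n)))) \<longlonglongrightarrow> 0" by simp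
      show "complex_of_real (inverse (real (Suc n))) \<in> range complex_of_real - {0}" for n
        by (rule DiffI, rule rangeI) (simp del: of_nat_Suc)
    qed
    then show "(0::complex) islimpt range complex_of_real" .
  qed (use eq in auto)
  then have eq': "a * deriv F z * G z + b * F z * deriv G z = (- v * z) * F z * G z" for z :: complex
    by (rule iffD2[OF eq_iff_diff_eq_0])
  have nz: "F z \<noteq> 0" for z
  proof -
    have "continuous_on UNIV (\<lambda>z :: complex. - v * z)"
      by (intro continuous_intros)
    from entire_weighted_product_nonvanishing[OF \<open>a > 0\<close> \<open>b > 0\<close> hol this eq'] one
    show ?thesis by simp
  qed
  obtain P where P: "P holomorphic_on UNIV" "\<And>z. F z = exp (P z)"
    using contractible_imp_holomorphic_log[OF hol(1) _ nz] by (metis UNIV_I contractible_UNIV)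
  \<comment> \<open>Makes \<open>ln A\<close> nonnegative, so that it is absorbed into a multiple of
    \<open>1 + (cmod z)\<^sup>2\<close>.\<close>
  have "1 \<le> A" using growth[of 0] one by simp
  have "Re (P z) \<le> (ln A + \<bar>B\<bar>) * (1 + (cmod z)\<^sup>2)" for z
  proof -
    have "exp (Re (P z)) \<le> exp (ln A + B * (cmod z)\<^sup>2)"
      using growth[of z] \<open>1 \<le> A\<close> by (simp add: P(2) exp_add)
    then have "Re (P z) \<le> ln A + B * (cmod z)\<^sup>2" by simp
    also have "\<dots> \<le> ln A * (1 + (cmod z)\<^sup>2) + \<bar>B\<bar> * (1 + (cmod z)\<^sup>2)"
    proof (rule add_mono)
      show "ln A \<le> ln A * (1 + (cmod z)\<^sup>2)"
        using \<open>1 \<le> A\<close> by (simp add: mult_le_cancel_left1)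
      show "B * (cmod z)\<^sup>2 \<le> \<bar>B\<bar> * (1 + (cmod z)\<^sup>2)"
        by (intro mult_mono) auto
    qed
    finally show ?thesis by (simp add: distrib_right)
  qed
  then obtain p0 p1 p2 where "\<And>z. P z = p0 + p1 * z + p2 * z\<^sup>2"
    using entire_quadratic[OF P(1)] by blast
  then show thesis using that P(2) by simp
qed

lemma charfn_tilted_mean_shift:
  assumes [measurable]: "random_variable borel X" and "integrable M X"
  shows "charfn (\<lambda>\<omega>. X \<omega> - m) (of_real t) = iexp (- t * m) * charfn X (of_real t)"
    and "tilted_mean (\<lambda>\<omega>. X \<omega> - m) t = iexp (- t * m) * (tilted_mean X t - m * charfn X (of_real t))"
proof -
  show "charfn (\<lambda>\<omega>. X \<omega> - m) (of_real t) = iexp (- t * m) * charfn X (of_real t)"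
    using charfn_affine[of "- m" 1 X "of_real t"] by (simp add: mult_ac)
  have i: "integrable M (\<lambda>\<omega>. of_real (X \<omega>) * iexp (t * X \<omega>))" "integrable M (\<lambda>\<omega>. iexp (t * X \<omega>))"
    using integrable_mult_iexp[OF assms(2), of X t] integrable_mult_iexp[of "\<lambda>_. 1" X t] by auto
  have "of_real (X \<omega> - m) * iexp (t * (X \<omega> - m)) =
      iexp (- t * m) * (of_real (X \<omega>) * iexp (t * X \<omega>) - m * iexp (t * X \<omega>))" for \<omega>
  proof -
    have "iexp (t * (X \<omega> - m)) = iexp (- t * m) * iexp (t * X \<omega>)"
      by (simp add: algebra_simps flip: exp_add)
    then show ?thesis by (simp only: of_real_diff) (simp add: algebra_simps)
  qed
  then show "tilted_mean (\<lambda>\<omega>. X \<omega> - m) t = iexp (- t * m) * (tilted_mean X t - m * charfn X (of_real t))"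
    unfolding tilted_mean_def charfn_of_real using i by simp
qed

end

subsection \<open>Gaussianity from an affine logarithmic derivative\<close>

lemma continuous_additive_real:
  fixes h :: "real \<Rightarrow> real"
  assumes cont: "continuous_on UNIV h" and add: "\<And>s t. h (s + t) = h s + h t"
  shows "h t = h 1 * t"
proof -
  have h0: "h 0 = 0" using add[of 0 0] by simp
  have neg: "h (- t) = - h t" for t using add[of t "- t"] h0 by simp
  have nat: "h (real n * t) = real n * h t" for n t
    by (induction n) (simp_all add: h0 add distrib_right)
  have int: "h (of_int k * t) = of_int k * h t" for k t
  proof (cases k rule: int_cases2)
    case (nonneg n) then show ?thesis by (simp add: nat)
  next
    case (nonpos n) then show ?thesis by (simp add: nat neg)
  qed
  have rat: "h t - h 1 * t = 0" if rt: "t \<in> \<rat>" for t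
  proof -
    obtain p q :: int where q: "q > 0" "t = of_int p / of_int q"
      using Rats_cases'[OF rt] by metis
    have e: "real_of_int p = of_int q * t" using q by simp
    have "of_int q * h t = h (of_int p * 1)" using int[of q t] e by simp
    also have "\<dots> = of_int p * h 1" by (simp only: int)
    finally have "of_int q * h t = of_int q * (h 1 * t)" unfolding e by (simp only: mult_ac)
    then have "h t = h 1 * t" using q(1) by (metis mult_cancel_left of_int_eq_0_iff less_irrefl)
    then show ?thesis by (simp only: diff_self)
  qed
  have "continuous_on (closure \<rat>) (\<lambda>t. h t - h 1 * t)"
    unfolding Rats_closure_real by (intro continuous_intros cont)
  from continuous_constant_on_closure[OF this rat, of t]
  have "h t - h 1 * t = 0" by (simp add: Rats_closure_real)
  then show ?thesis by (simp only: eq_iff_diff_eq_0[of "h t"])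
qed

context prob_space
begin

text \<open>The hypothesis speaks only of frequencies at which neither function vanishes, so
  additivity cannot be used globally at first. It is used on \<open>x / 2, x / 2, - x\<close> below
  a hypothetical first zero to rule that zero out, and only then for all frequencies, where Cauchy's
  functional equation with continuity gives linearity.\<close>

lemma log_derivative_linear_of_zero_sum_relation:
  fixes X Y :: "'a \<Rightarrow> real" and a b :: real
  defines "f t \<equiv> charfn X (complex_of_real t)" and "g t \<equiv> charfn Y (complex_of_real t)"
    and "r t \<equiv> a * tilted_mean X t / charfn X (complex_of_real t) + b * tilted_mean Y t / charfn Y (complex_of_real t)"
  assumes X: "random_variable borel X" "integrable M (\<lambda>\<omega>. (X \<omega>)\<^sup>2)"
    and Y: "random_variable borel Y" "integrable M (\<lambda>\<omega>. (Y \<omega>)\<^sup>2)"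
    and ab: "a > 0" "b > 0"
    and rel: "\<And>s t u. s + t + u = 0 \<Longrightarrow> \<forall>x\<in>{s, t, u}. f x \<noteq> 0 \<and> g x \<noteq> 0 \<Longrightarrow> r s + r t + r u = 3 * r 0"
  obtains v where "\<And>t. f t \<noteq> 0" "\<And>t. g t \<noteq> 0" "\<And>t. r t = r 0 + \<i> * of_real (v * t)"
proof -
  have iX: "integrable M X" by (rule square_integrable_imp_integrable[OF X])
  have iY: "integrable M Y" by (rule square_integrable_imp_integrable[OF Y])
  have fd: "(f has_vector_derivative \<i> * tilted_mean X t) (at t within A)"
    and gd: "(g has_vector_derivative \<i> * tilted_mean Y t) (at t within A)" for t A
    unfolding f_def g_def by (intro charfn_has_vector_derivative X Y)+
  have fc: "continuous_on A f" and gc: "continuous_on A g" for A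
    unfolding continuous_on_eq_continuous_within
    using fd gd by (blast intro: has_vector_derivative_continuous)+
  have rc: "continuous_on A r" if "\<And>t. t \<in> A \<Longrightarrow> f t \<noteq> 0 \<and> g t \<noteq> 0" for A
    unfolding r_def using that fc[of A] gc[of A] unfolding f_def g_def
    by (intro continuous_intros tilted_mean_continuous X Y iX iY) auto
  have f0: "f 0 = 1" and g0: "g 0 = 1" by (simp_all add: f_def g_def charfn_0)
  have f_minus: "f (- t) = cnj (f t)" and g_minus: "g (- t) = cnj (g t)" for t
    by (simp_all only: f_def g_def cnj_charfn)
  have r_minus: "r (- t) = cnj (r t)" for t
    by (simp add: r_def cnj_charfn cnj_tilted_mean del: of_real_minus)
  have r0: "cnj (r 0) = r 0" using r_minus[of 0] by simp
  have odd: "r t + r (- t) = 2 * r 0" if "f t \<noteq> 0" "g t \<noteq> 0" for t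
    using rel[of t "- t" 0] that f0 g0 by (auto simp: f_minus g_minus)
  have nz_pos: "f t \<noteq> 0 \<and> g t \<noteq> 0" if "t \<ge> 0" for t
  proof (rule weighted_product_nonvanishing[OF ab that fd gd])
    fix d assume d: "d \<in> {0<..t}" and nz: "\<And>t. t \<in> {0..<d} \<Longrightarrow> f t \<noteq> 0 \<and> g t \<noteq> 0"
    \<comment> \<open>Halving keeps the argument away from the possible zero \<open>d\<close>; the
      identity \<open>r x = 2 * r (x / 2) - r 0\<close> then carries the bound to all of the open
      interval up to \<open>d\<close>.\<close>
    have "compact (r ` {0..d / 2})"
      using d nz by (intro compact_continuous_image rc) auto
    then obtain R where R: "\<And>x. x \<in> {0..d / 2} \<Longrightarrow> cmod (r x) \<le> R"
      using compact_imp_bounded bounded_iff by (metis imageI)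
    have "- (2 * R + cmod (r 0)) \<le> Re (a * (\<i> * tilted_mean X x) / f x + b * (\<i> * tilted_mean Y x) / g x)"
      if x: "x \<in> {0<..<d}" for x
    proof -
      have n: "f x \<noteq> 0 \<and> g x \<noteq> 0" "f (x / 2) \<noteq> 0 \<and> g (x / 2) \<noteq> 0" using nz x by auto
      have "r (x / 2) + r (x / 2) + r (- x) = 3 * r 0"
        using n by (intro rel) (auto simp: f_minus g_minus)
      moreover have "r x + r (- x) = 2 * r 0" using odd n by blast
      ultimately have "r x = 2 * r (x / 2) - r 0" by algebra
      then have "cmod (r x) \<le> cmod (2 * r (x / 2)) + cmod (r 0)"
        by (simp only: norm_triangle_ineq4)
      also have "\<dots> \<le> 2 * R + cmod (r 0)"
        using R[of "x / 2"] x by (simp add: norm_mult)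
      finally have "cmod (\<i> * r x) \<le> 2 * R + cmod (r 0)"
        by (simp add: norm_mult)
      moreover have "a * (\<i> * tilted_mean X x) / f x + b * (\<i> * tilted_mean Y x) / g x = \<i> * r x"
        by (simp add: r_def f_def g_def algebra_simps)
      ultimately show ?thesis
        using abs_Re_le_cmod[of "\<i> * r x"] by simp
    qed
    then show "\<exists>K. \<forall>x\<in>{0<..<d}. - K \<le> Re (a * (\<i> * tilted_mean X x) / f x + b * (\<i> * tilted_mean Y x) / g x)"
      by blast
  qed (simp_all add: f0 g0)
  have nz: "f t \<noteq> 0 \<and> g t \<noteq> 0" for t
    using nz_pos[of t] nz_pos[of "- t"] by (cases "t \<ge> 0") (auto simp: f_minus g_minus)
  have odd': "r (- t) = 2 * r 0 - r t" for t
    using odd[of t] nz[of t] by (simp add: eq_diff_eq add.commute)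
  have add: "r (s + t) = r s + r t - r 0" for s t
  proof -
    have "r s + r t + r (- (s + t)) = 3 * r 0"
      by (rule rel) (use nz in auto)
    then show ?thesis unfolding odd' by algebra
  qed
  \<comment> \<open>Only the imaginary part is open: \<open>r (- t) = cnj (r t)\<close> together
    with the oddness of \<open>r - r 0\<close> makes the real part constant.\<close>
  define h where "h t = Im (r t - r 0)" for t
  have "continuous_on UNIV h"
    unfolding h_def using nz by (intro continuous_intros rc) auto
  moreover have "h (s + t) = h s + h t" for s t
    by (simp add: h_def add)
  ultimately have h: "h t = h 1 * t" for t
    by (rule continuous_additive_real)
  have "r t = r 0 + \<i> * of_real (h 1 * t)" for t
  proof -
    have "Re (r t - r 0) = 0"
    proof -
      have "cnj (r t) + r t = 2 * r 0" using odd'[of t] r_minus[of t] by simp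
      then have "Re (cnj (r t) + r t) = Re (2 * r 0)" by simp
      then show ?thesis by simp
    qed
    then show ?thesis
      using h[of t] by (simp add: complex_eq_iff h_def)
  qed
  then show thesis using that nz by blast
qed

lemma deriv_charfn:
  assumes "random_variable borel X" "integrable M (\<lambda>\<omega>. (X \<omega>)\<^sup>2)" "charfn X holomorphic_on UNIV"
  shows "deriv (charfn X) (of_real t) = \<i> * tilted_mean X t"
proof (rule vector_derivative_unique_at)
  show "((\<lambda>t. charfn X (of_real t)) has_vector_derivative deriv (charfn X) (of_real t)) (at t)"
    using assms(3) by (intro has_vector_derivative_real_field) (auto intro: holomorphic_derivI)
  show "((\<lambda>t. charfn X (of_real t)) has_vector_derivative \<i> * tilted_mean X t) (at t)"
    by (rule charfn_has_vector_derivative[OF assms(1,2)])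
qed

lemma gaussian_of_centered_stein_equation:
  fixes X Y :: "'a \<Rightarrow> real" and a b v :: real
  assumes indep: "indep_var borel X borel Y"
    and X2: "integrable M (\<lambda>\<omega>. (X \<omega>)\<^sup>2)" and Y2: "integrable M (\<lambda>\<omega>. (Y \<omega>)\<^sup>2)"
    and X0: "expectation X = 0" and Y0: "expectation Y = 0" and ab: "a > 0" "b > 0"
    and eq: "\<And>t. a * tilted_mean X t * charfn Y (of_real t) + b * charfn X (of_real t) * tilted_mean Y t
        = \<i> * of_real (v * t) * charfn X (of_real t) * charfn Y (of_real t)"
  shows "gaussian_rv M X" and "gaussian_rv M Y"
proof -
  have X[measurable]: "random_variable borel X" and Y[measurable]: "random_variable borel Y"
    using indep by (auto dest: indep_var_rv1 indep_var_rv2)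
  have iX: "integrable M X" by (rule square_integrable_imp_integrable[OF X X2])
  have iY: "integrable M Y" by (rule square_integrable_imp_integrable[OF Y Y2])
  \<comment> \<open>By independence \<open>eq\<close> reads
    \<open>E((aX + bY) exp(itS)) = \<i> v t E(exp(itS))\<close> for \<open>S = X + Y\<close>; this
    is its imaginary part.\<close>
  have stein: "expectation (\<lambda>\<omega>. (a * X \<omega> + b * Y \<omega>) * sin (t * (X \<omega> + Y \<omega>)))
        = v * t * expectation (\<lambda>\<omega>. cos (t * (X \<omega> + Y \<omega>)))" for t
  proof -
    have comp: "indep_var borel (\<lambda>\<omega>. F (X \<omega>)) borel (\<lambda>\<omega>. G (Y \<omega>))"
      if "F \<in> borel_measurable borel" "G \<in> borel_measurable borel" for F G :: "real \<Rightarrow> complex"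
      using indep_var_compose[OF indep that] by (simp add: o_def)
    have int: "integrable M (\<lambda>\<omega>. iexp (t * X \<omega>))" "integrable M (\<lambda>\<omega>. iexp (t * Y \<omega>))"
      "integrable M (\<lambda>\<omega>. of_real (X \<omega>) * iexp (t * X \<omega>))" "integrable M (\<lambda>\<omega>. of_real (Y \<omega>) * iexp (t * Y \<omega>))"
      using integrable_mult_iexp[of "\<lambda>_. 1" X t] integrable_mult_iexp[of "\<lambda>_. 1" Y t]
        integrable_mult_iexp[OF iX X, of t] integrable_mult_iexp[OF iY Y, of t] by auto
    have i1: "indep_var borel (\<lambda>\<omega>. iexp (t * X \<omega>)) borel (\<lambda>\<omega>. iexp (t * Y \<omega>))"
      and i2: "indep_var borel (\<lambda>\<omega>. of_real (X \<omega>) * iexp (t * X \<omega>)) borel (\<lambda>\<omega>. iexp (t * Y \<omega>))"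
      and i3: "indep_var borel (\<lambda>\<omega>. iexp (t * X \<omega>)) borel (\<lambda>\<omega>. of_real (Y \<omega>) * iexp (t * Y \<omega>))"
      by (rule comp; measurable)+
    have e: "iexp (t * (X \<omega> + Y \<omega>)) = iexp (t * X \<omega>) * iexp (t * Y \<omega>)" for \<omega>
      by (simp add: algebra_simps flip: exp_add)
    have W: "(CLINT \<omega>|M. iexp (t * (X \<omega> + Y \<omega>))) = charfn X (of_real t) * charfn Y (of_real t)"
      unfolding e charfn_of_real by (rule indep_var_lebesgue_integral[OF i1 int(1,2)])
    have Wi: "integrable M (\<lambda>\<omega>. iexp (t * (X \<omega> + Y \<omega>)))"
      unfolding e by (rule indep_var_integrable[OF i1 int(1,2)])
    have split: "of_real (a * X \<omega> + b * Y \<omega>) * iexp (t * (X \<omega> + Y \<omega>)) =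
        a * (of_real (X \<omega>) * iexp (t * X \<omega>) * iexp (t * Y \<omega>)) + b * (iexp (t * X \<omega>) * (of_real (Y \<omega>) * iexp (t * Y \<omega>)))" for \<omega>
      unfolding e by (simp only: of_real_add of_real_mult) algebra
    note j2 = indep_var_integrable[OF i2 int(3,2)] indep_var_lebesgue_integral[OF i2 int(3,2)]
    note j3 = indep_var_integrable[OF i3 int(1,4)] indep_var_lebesgue_integral[OF i3 int(1,4)]
    have T: "(CLINT \<omega>|M. of_real (a * X \<omega> + b * Y \<omega>) * iexp (t * (X \<omega> + Y \<omega>)))
        = a * tilted_mean X t * charfn Y (of_real t) + b * charfn X (of_real t) * tilted_mean Y t"
      unfolding split tilted_mean_def charfn_of_real
      by (subst Bochner_Integration.integral_add,
          simp_all only: integral_mult_right_zero j2 j3 integrable_mult_right) (simp only: mult.assoc)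
    have Ti: "integrable M (\<lambda>\<omega>. of_real (a * X \<omega> + b * Y \<omega>) * iexp (t * (X \<omega> + Y \<omega>)))"
      unfolding split using j2(1) j3(1) by (intro Bochner_Integration.integrable_add integrable_mult_right)
    have "expectation (\<lambda>\<omega>. (a * X \<omega> + b * Y \<omega>) * sin (t * (X \<omega> + Y \<omega>)))
        = expectation (\<lambda>\<omega>. Im (of_real (a * X \<omega> + b * Y \<omega>) * iexp (t * (X \<omega> + Y \<omega>))))"
      by (intro Bochner_Integration.integral_cong) (simp_all add: Im_exp del: of_real_add of_real_mult)
    also have "\<dots> = Im (CLINT \<omega>|M. of_real (a * X \<omega> + b * Y \<omega>) * iexp (t * (X \<omega> + Y \<omega>)))"
      using Ti by (rule integral_Im)
    also have "\<dots> = Im (\<i> * of_real (v * t) * (CLINT \<omega>|M. iexp (t * (X \<omega> + Y \<omega>))))"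
      unfolding T eq W by (simp only: mult.assoc)
    also have "\<dots> = v * t * Re (CLINT \<omega>|M. iexp (t * (X \<omega> + Y \<omega>)))"
      by simp
    also have "Re (CLINT \<omega>|M. iexp (t * (X \<omega> + Y \<omega>))) = expectation (\<lambda>\<omega>. Re (iexp (t * (X \<omega> + Y \<omega>))))"
      using Wi by (rule integral_Re[symmetric])
    also have "\<dots> = expectation (\<lambda>\<omega>. cos (t * (X \<omega> + Y \<omega>)))"
      by (intro Bochner_Integration.integral_cong) (simp_all add: Re_exp del: of_real_add of_real_mult)
    finally show ?thesis .
  qed
  define c where "c = min a b"
  have c: "0 < c" "c \<le> a" "c \<le> b" using ab by (auto simp: c_def)
  note moments = stein_identity_even_moments[OF indep X2 Y2 X0 Y0 c stein]
  obtain \<theta> where \<theta>: "\<theta> > 0" "(\<integral>\<^sup>+\<omega>. ennreal (exp (\<theta> * (X \<omega> + Y \<omega>)\<^sup>2)) \<partial>M) < \<infinity>"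
    by (rule nn_integral_exp_square_of_even_moments[OF _ _ moments(2)]) (use moments(1) c in auto)
  have eX: "integrable M (\<lambda>\<omega>. exp (\<theta> / 2 * (X \<omega>)\<^sup>2))"
    by (rule exp_square_integrable_of_indep_sum[OF indep \<theta>])
  have eY: "integrable M (\<lambda>\<omega>. exp (\<theta> / 2 * (Y \<omega>)\<^sup>2))"
    by (rule exp_square_integrable_of_indep_sum[OF indep_var_commute[OF indep] \<theta>(1)])
      (use \<theta>(2) in \<open>simp add: add.commute\<close>)
  have \<theta>2: "\<theta> / 2 > 0" using \<theta> by simp
  note hX = charfn_holomorphic[OF X \<theta>2 eX] and hY = charfn_holomorphic[OF Y \<theta>2 eY]
  note dX = deriv_charfn[OF X X2 hX] and dY = deriv_charfn[OF Y Y2 hY]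
  have ode: "a * deriv (charfn X) t * charfn Y t + b * charfn X t * deriv (charfn Y) t = - v * t * charfn X t * charfn Y t" for t :: real
  proof -
    have "a * deriv (charfn X) t * charfn Y t + b * charfn X t * deriv (charfn Y) t
        = \<i> * (a * tilted_mean X t * charfn Y t + b * charfn X t * tilted_mean Y t)"
      unfolding dX dY by algebra
    also have "\<dots> = - v * t * charfn X t * charfn Y t"
      unfolding eq by (simp add: mult.assoc[symmetric])
    finally show ?thesis .
  qed
  have growth: "cmod (charfn Z z) \<le> expectation (\<lambda>\<omega>. exp (\<theta> / 2 * (Z \<omega>)\<^sup>2)) * exp (1 / (4 * (\<theta> / 2)) * (cmod z)\<^sup>2)"
    if "random_variable borel Z" "integrable M (\<lambda>\<omega>. exp (\<theta> / 2 * (Z \<omega>)\<^sup>2))" for Z z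
    using charfn_growth[OF that(1) \<theta>2 that(2), of z] by simp
  show "gaussian_rv M X"
  proof (rule entire_stein_equation_imp_quadratic[OF hX hY ab charfn_0 charfn_0 growth[OF X eX] ode])
    fix p0 p1 p2 assume "\<And>z. charfn X z = exp (p0 + p1 * z + p2 * z\<^sup>2)"
    then show "gaussian_rv M X"
      by (intro gaussian_rv_of_quadratic_exponent[of X p0 p1 p2]) auto
  qed
  have ode': "b * deriv (charfn Y) t * charfn X t + a * charfn Y t * deriv (charfn X) t = - v * t * charfn Y t * charfn X t" for t :: real
    using ode[of t] by (simp only: mult_ac add_ac)
  show "gaussian_rv M Y"
  proof (rule entire_stein_equation_imp_quadratic[OF hY hX ab(2,1) charfn_0 charfn_0 growth[OF Y eY] ode'])
    fix p0 p1 p2 assume "\<And>z. charfn Y z = exp (p0 + p1 * z + p2 * z\<^sup>2)"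
    then show "gaussian_rv M Y"
      by (intro gaussian_rv_of_quadratic_exponent[of Y p0 p1 p2]) auto
  qed
qed

text \<open>Centering multiplies the transforms by unimodular exponentials, which cancel, and
  subtracts from \<open>r\<close> exactly its value at 0, namely \<open>a * E(X) + b * E(Y)\<close>.
  The linear term that remains is the centered equation after multiplication by both characteristic
  functions.\<close>

lemma gaussian_of_linear_log_derivative:
  fixes X Y :: "'a \<Rightarrow> real" and a b v :: real
  defines "r t \<equiv> a * tilted_mean X t / charfn X (complex_of_real t) + b * tilted_mean Y t / charfn Y (complex_of_real t)"
  assumes indep: "indep_var borel X borel Y"
    and X2: "integrable M (\<lambda>\<omega>. (X \<omega>)\<^sup>2)" and Y2: "integrable M (\<lambda>\<omega>. (Y \<omega>)\<^sup>2)" and ab: "a > 0" "b > 0"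
    and nz: "\<And>t. charfn X (complex_of_real t) \<noteq> 0" "\<And>t. charfn Y (complex_of_real t) \<noteq> 0"
    and lin: "\<And>t. r t = r 0 + \<i> * of_real (v * t)"
  shows "gaussian_rv M X" and "gaussian_rv M Y"
proof -
  have X[measurable]: "random_variable borel X" and Y[measurable]: "random_variable borel Y"
    using indep by (auto dest: indep_var_rv1 indep_var_rv2)
  have iX: "integrable M X" by (rule square_integrable_imp_integrable[OF X X2])
  have iY: "integrable M Y" by (rule square_integrable_imp_integrable[OF Y Y2])
  define p q where "p = expectation X" and "q = expectation Y"
  have "indep_var borel ((\<lambda>x. x - p) \<circ> X) borel ((\<lambda>y. y - q) \<circ> Y)"
    by (rule indep_var_compose[OF indep]) auto
  then have ind: "indep_var borel (\<lambda>\<omega>. X \<omega> - p) borel (\<lambda>\<omega>. Y \<omega> - q)" by (simp add: o_def)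
  have r0: "r 0 = a * p + b * q"
    by (simp add: r_def charfn_0 tilted_mean_def p_def q_def)
  note sX = charfn_tilted_mean_shift[OF X iX, of p] and sY = charfn_tilted_mean_shift[OF Y iY, of q]
  have eq: "a * tilted_mean (\<lambda>\<omega>. X \<omega> - p) t * charfn (\<lambda>\<omega>. Y \<omega> - q) (of_real t) +
      b * charfn (\<lambda>\<omega>. X \<omega> - p) (of_real t) * tilted_mean (\<lambda>\<omega>. Y \<omega> - q) t
      = \<i> * of_real (v * t) * charfn (\<lambda>\<omega>. X \<omega> - p) (of_real t) * charfn (\<lambda>\<omega>. Y \<omega> - q) (of_real t)" for t
  proof -
    define f g F G where "f = charfn X (complex_of_real t)" and "g = charfn Y (complex_of_real t)"
      and "F = tilted_mean X t" and "G = tilted_mean Y t"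
    have "f \<noteq> 0" "g \<noteq> 0" using nz by (auto simp: f_def g_def)
    have "a * F / f + b * G / g = a * p + b * q + \<i> * of_real (v * t)"
      using lin[of t] unfolding r0 unfolding r_def f_def g_def F_def G_def by simp
    then have "(a * F / f + b * G / g) * (f * g) = (a * p + b * q + \<i> * of_real (v * t)) * (f * g)"
      by simp
    moreover have "(a * F / f + b * G / g) * (f * g) = a * F * g + b * G * f"
      using \<open>f \<noteq> 0\<close> \<open>g \<noteq> 0\<close> by (simp add: field_simps)
    ultimately have *: "a * F * g + b * G * f = (a * p + b * q + \<i> * of_real (v * t)) * (f * g)" by simp
    have **: "a * (ep * (F - p * f)) * (eq * g) + b * (ep * f) * (eq * (G - q * g)) = w * (ep * f) * (eq * g)"
      if "a * F * g + b * G * f = (a * p + b * q + w) * (f * g)" for ep eq w a b p q :: complex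
      using that by algebra
    show ?thesis
      unfolding sX sY f_def[symmetric] g_def[symmetric] F_def[symmetric] G_def[symmetric]
      by (rule **) (use * in simp)
  qed
  have sq: "integrable M (\<lambda>\<omega>. (X \<omega> - p)\<^sup>2)" "integrable M (\<lambda>\<omega>. (Y \<omega> - q)\<^sup>2)"
    using iX iY X2 Y2 by (simp_all add: power2_diff)
  have zero: "expectation (\<lambda>\<omega>. X \<omega> - p) = 0" "expectation (\<lambda>\<omega>. Y \<omega> - q) = 0"
    using iX iY by (simp_all add: p_def q_def prob_space)
  note g = gaussian_of_centered_stein_equation[OF ind sq zero ab eq]
  show "gaussian_rv M X" "gaussian_rv M Y"
    using g by (auto intro: gaussian_rv_shift)
qed

end

subsection \<open>Conditional expectation and exponential test functions\<close>

text \<open>Fourier uniqueness for the signed image of \<open>W\<close> under \<open>S\<close>. The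
  positive and negative parts have the same mass \<open>m\<close> (take \<open>t = 0\<close>);
  divided by \<open>m\<close> and pushed forward by \<open>S\<close> they become probability laws
  with equal characteristic functions, and Levy's theorem applies.\<close>

lemma (in prob_space) real_weight_zero_of_iexp:
  fixes S W :: "'a \<Rightarrow> real"
  assumes S[measurable]: "random_variable borel S" and W: "integrable M W"
    and zero: "\<And>t. (CLINT \<omega>|M. of_real (W \<omega>) * iexp (t * S \<omega>)) = 0" and B: "B \<in> sets borel"
  shows "expectation (\<lambda>\<omega>. W \<omega> * indicator B (S \<omega>)) = 0"
proof -
  have [measurable]: "random_variable borel W" using W by auto
  note [measurable] = B
  define P N where "P \<omega> = max (W \<omega>) 0" and "N \<omega> = max (- W \<omega>) 0" for \<omega>
  have [measurable]: "random_variable borel P" "random_variable borel N"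
    by (simp_all add: P_def[abs_def] N_def[abs_def])
  have P0: "0 \<le> P \<omega>" and N0: "0 \<le> N \<omega>" and PN: "W \<omega> = P \<omega> - N \<omega>" for \<omega> by (auto simp: P_def N_def)
  have iP: "integrable M P" and iN: "integrable M N"
    unfolding P_def N_def using W by auto
  have "(CLINT \<omega>|M. of_real (W \<omega>)) = 0" using zero[of 0] by simp
  then have "expectation W = 0" by simp
  moreover have "expectation W = expectation P - expectation N"
  proof -
    have "W = (\<lambda>\<omega>. P \<omega> - N \<omega>)" using PN by blast
    then show ?thesis using iP iN by simp
  qed
  ultimately have PNe: "expectation P = expectation N" by simp
  show ?thesis
  \<comment> \<open>Without mass nothing can be normalized, but then \<open>W\<close> vanishes
    almost surely.\<close>
  proof (cases "expectation P = 0")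
    case True
    then have "AE \<omega> in M. P \<omega> = 0" "AE \<omega> in M. N \<omega> = 0"
      using integral_nonneg_eq_0_iff_AE[OF iP] integral_nonneg_eq_0_iff_AE[OF iN] P0 N0 PNe by auto
    then have "AE \<omega> in M. W \<omega> * indicator B (S \<omega>) = 0"
      by eventually_elim (simp add: PN)
    then show ?thesis by (simp add: integral_eq_zero_AE)
  next
    case False
    define m where "m = expectation P"
    have m: "m > 0" using False P0 by (simp add: m_def less_le integral_nonneg_AE)
    define D where "D Q = distr (density M (\<lambda>\<omega>. ennreal (Q \<omega> / m))) borel S" for Q
    have real_D: "real_distribution (D Q)" 
      if [measurable]: "random_variable borel Q" and "\<And>\<omega>. 0 \<le> Q \<omega>" "integrable M Q" "expectation Q = m" for Q
    proof -
      have "(\<integral>\<^sup>+\<omega>. ennreal (Q \<omega> / m) \<partial>M) = ennreal (expectation (\<lambda>\<omega>. Q \<omega> / m))"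
        using that m by (intro nn_integral_eq_integral) auto
      also have "\<dots> = 1" using that m by simp
      finally have "prob_space (density M (\<lambda>\<omega>. ennreal (Q \<omega> / m)))"
        by (intro prob_spaceI) (simp add: emeasure_density nn_integral_multc cong: nn_integral_cong)
      then interpret Q: prob_space "density M (\<lambda>\<omega>. ennreal (Q \<omega> / m))" .
      show ?thesis unfolding D_def by (rule Q.real_distribution_distr) simp
    qed
    have char_D: "char (D Q) t = (CLINT \<omega>|M. of_real (Q \<omega>) * iexp (t * S \<omega>)) / of_real m"
      if [measurable]: "random_variable borel Q" and "\<And>\<omega>. 0 \<le> Q \<omega>" for Q t
    proof -
      have "char (D Q) t = (CLINT \<omega>|density M (\<lambda>\<omega>. ennreal (Q \<omega> / m)). iexp (t * S \<omega>))"
        unfolding char_def D_def by (subst integral_distr) auto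
      also have "\<dots> = (CLINT \<omega>|M. (Q \<omega> / m) *\<^sub>R iexp (t * S \<omega>))"
        using that m by (subst integral_density) auto
      also have "\<dots> = (CLINT \<omega>|M. of_real (Q \<omega>) * iexp (t * S \<omega>) / of_real m)"
        by (simp add: scaleR_conv_of_real)
      finally show ?thesis by simp
    qed
    have "char (D P) t = char (D N) t" for t
    proof -
      have "(CLINT \<omega>|M. of_real (P \<omega>) * iexp (t * S \<omega>)) - (CLINT \<omega>|M. of_real (N \<omega>) * iexp (t * S \<omega>)) = 0"
        using zero[of t] integrable_mult_iexp[OF iP S, of t] integrable_mult_iexp[OF iN S, of t]
        by (simp add: PN left_diff_distrib)
      then show ?thesis using P0 N0 by (simp add: char_D)
    qed
    then have DD: "D P = D N"
      using P0 N0 iP iN PNe by (intro Levy_uniqueness real_D) (auto simp: m_def)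
    have D_B: "emeasure (D Q) B = ennreal (expectation (\<lambda>\<omega>. Q \<omega> * indicator B (S \<omega>)) / m)"
      if [measurable]: "random_variable borel Q" and Q: "\<And>\<omega>. 0 \<le> Q \<omega>" "integrable M Q" for Q
    proof -
      have i: "integrable M (\<lambda>\<omega>. Q \<omega> * indicator B (S \<omega>))"
        by (rule Bochner_Integration.integrable_bound[OF Q(2)]) (auto simp: indicator_def)
      have "emeasure (D Q) B = (\<integral>\<^sup>+\<omega>. ennreal (Q \<omega> / m) * indicator (S -` B \<inter> space M) \<omega> \<partial>M)"
        unfolding D_def by (simp add: emeasure_distr emeasure_density)
      also have "\<dots> = (\<integral>\<^sup>+\<omega>. ennreal (Q \<omega> * indicator B (S \<omega>) / m) \<partial>M)"
        by (intro nn_integral_cong) (auto simp: indicator_def)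
      also have "\<dots> = ennreal (expectation (\<lambda>\<omega>. Q \<omega> * indicator B (S \<omega>) / m))"
        using i Q m by (intro nn_integral_eq_integral) (auto simp: indicator_def)
      finally show ?thesis by simp
    qed
    have "expectation (\<lambda>\<omega>. P \<omega> * indicator B (S \<omega>)) / m = expectation (\<lambda>\<omega>. N \<omega> * indicator B (S \<omega>)) / m"
      using DD D_B[of P] D_B[of N] P0 N0 iP iN m by (simp add: integral_nonneg_AE ennreal_inj)
    moreover have "integrable M (\<lambda>\<omega>. P \<omega> * indicator B (S \<omega>))" "integrable M (\<lambda>\<omega>. N \<omega> * indicator B (S \<omega>))"
      by (rule Bochner_Integration.integrable_bound[OF iP] Bochner_Integration.integrable_bound[OF iN]; auto simp: indicator_def)+
    ultimately show ?thesis using m by (simp add: PN left_diff_distrib)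
  qed
qed

text \<open>The transform of the conjugate weight vanishes as well, by changing \<open>t\<close> to
  \<open>- t\<close>; so the real part is covered by the real case, and the imaginary part is the
  real part of \<open>- \<i> * W\<close>. Complex weights occur because the remaining exponentials
  are part of the weight when one coordinate is treated.\<close>

lemma (in prob_space) complex_weight_zero_of_iexp:
  fixes S :: "'a \<Rightarrow> real" and W :: "'a \<Rightarrow> complex"
  assumes S[measurable]: "random_variable borel S" and W: "integrable M W"
    and zero: "\<And>t. (CLINT \<omega>|M. W \<omega> * iexp (t * S \<omega>)) = 0" and B: "B \<in> sets borel"
  shows "(CLINT \<omega>|M. W \<omega> * indicator B (S \<omega>)) = 0"
proof -
  have [measurable]: "random_variable borel W" using W by auto
  note [measurable] = B
  have int: "integrable M (\<lambda>\<omega>. V \<omega> * iexp (t * S \<omega>))" if V: "integrable M V" for V :: "'a \<Rightarrow> complex" and t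
  proof -
    have [measurable]: "random_variable borel V" using V by auto
    show ?thesis by (rule Bochner_Integration.integrable_bound[OF V]) (auto simp: norm_mult)
  qed
  have re: "expectation (\<lambda>\<omega>. Re (V \<omega>) * indicator B (S \<omega>)) = 0"
    if V: "integrable M V" and z: "\<And>t. (CLINT \<omega>|M. V \<omega> * iexp (t * S \<omega>)) = 0" for V :: "'a \<Rightarrow> complex"
  proof (rule real_weight_zero_of_iexp[OF S _ _ B])
    show "integrable M (\<lambda>\<omega>. Re (V \<omega>))" using V by simp
    fix t
    have iV: "integrable M (\<lambda>\<omega>. cnj (V \<omega>))" using V by simp
    have "(CLINT \<omega>|M. cnj (V \<omega>) * iexp (t * S \<omega>)) = cnj (CLINT \<omega>|M. V \<omega> * iexp (- t * S \<omega>))"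
      unfolding Bochner_Integration.integral_cnj[symmetric] by (simp add: exp_cnj)
    also have "\<dots> = 0" unfolding z by simp
    finally have "(CLINT \<omega>|M. cnj (V \<omega>) * iexp (t * S \<omega>)) = 0" .
    moreover have eq: "of_real (Re (V \<omega>)) * iexp (t * S \<omega>) = (V \<omega> * iexp (t * S \<omega>) + cnj (V \<omega>) * iexp (t * S \<omega>)) / 2" for \<omega>
      by (simp add: complex_add_cnj flip: distrib_right)
    moreover have "(CLINT \<omega>|M. of_real (Re (V \<omega>)) * iexp (t * S \<omega>)) =
        ((CLINT \<omega>|M. V \<omega> * iexp (t * S \<omega>)) + (CLINT \<omega>|M. cnj (V \<omega>) * iexp (t * S \<omega>))) / 2"
      unfolding eq using int[OF V, of t] int[OF iV, of t] by simp
    ultimately show "(CLINT \<omega>|M. of_real (Re (V \<omega>)) * iexp (t * S \<omega>)) = 0"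
      using z[of t] by simp
  qed
  have r: "expectation (\<lambda>\<omega>. Re (W \<omega>) * indicator B (S \<omega>)) = 0" by (rule re[OF W zero])
  have i: "expectation (\<lambda>\<omega>. Im (W \<omega>) * indicator B (S \<omega>)) = 0"
  proof -
    have "(CLINT \<omega>|M. - \<i> * W \<omega> * iexp (t * S \<omega>)) = 0" for t
      using zero[of t] by (simp only: mult.assoc integral_mult_right_zero mult_zero_right)
    then have "expectation (\<lambda>\<omega>. Re (- \<i> * W \<omega>) * indicator B (S \<omega>)) = 0"
      by (intro re) (use W in auto)
    then show ?thesis by simp
  qed
  have "integrable M (\<lambda>\<omega>. W \<omega> * indicator B (S \<omega>))"
    by (rule Bochner_Integration.integrable_bound[OF W]) (auto simp: indicator_def)
  moreover have "Re (W \<omega> * indicator B (S \<omega>)) = Re (W \<omega>) * indicator B (S \<omega>)"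
    "Im (W \<omega> * indicator B (S \<omega>)) = Im (W \<omega>) * indicator B (S \<omega>)" for \<omega>
    by (simp_all add: indicator_def)
  ultimately have "Re (CLINT \<omega>|M. W \<omega> * indicator B (S \<omega>)) = 0" "Im (CLINT \<omega>|M. W \<omega> * indicator B (S \<omega>)) = 0"
    using r i by (simp_all only: integral_Re[symmetric] integral_Im[symmetric])
  then show ?thesis by (simp add: complex_eq_iff)
qed

text \<open>The exponentials are replaced by indicators one coordinate at a time, so one-dimensional uniqueness suffices.\<close>

lemma (in prob_space) joint_weight_zero_of_iexp:
  fixes R :: "'i \<Rightarrow> 'a \<Rightarrow> real" and U :: "'a \<Rightarrow> real"
  assumes J: "finite J" and R: "\<And>j. j \<in> J \<Longrightarrow> random_variable borel (R j)" and U: "integrable M U"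
    and zero: "\<And>t. (CLINT \<omega>|M. of_real (U \<omega>) * iexp (\<Sum>j\<in>J. t j * R j \<omega>)) = 0"
    and B: "\<And>j. j \<in> J \<Longrightarrow> B j \<in> sets borel"
  shows "expectation (\<lambda>\<omega>. U \<omega> * (\<Prod>j\<in>J. indicator (B j) (R j \<omega>))) = 0"
proof -
  have [measurable]: "random_variable borel U" using U by auto
  have "(CLINT \<omega>|M. of_real (U \<omega>) * (\<Prod>j\<in>K. indicator (B j) (R j \<omega>)) * iexp (\<Sum>j\<in>J - K. t j * R j \<omega>)) = 0"
    if "finite K" "K \<subseteq> J" for K t
    using that
  proof (induction K arbitrary: t rule: finite_induct)
    case empty
    then show ?case using zero[of t] by simp
  next
    case (insert k K)
    let ?P = "\<lambda>\<omega>. \<Prod>j\<in>K. indicator (B j) (R j \<omega>) :: complex"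
    let ?L = "\<lambda>\<omega>. \<Sum>j\<in>J - insert k K. t j * R j \<omega>"
    have k: "k \<in> J" "k \<notin> K" "K \<subseteq> J" using insert by auto
    have mP: "?P \<in> borel_measurable M"
      using k B R by (intro borel_measurable_prod measurable_compose[OF R borel_measurable_indicator]) auto
    have mL: "random_variable borel ?L"
      using R by (intro borel_measurable_sum borel_measurable_times) auto
    have normP: "cmod (?P \<omega>) \<le> 1" for \<omega>
      unfolding prod_norm[symmetric] by (intro prod_le_1) (auto simp: indicator_def)
    have iW: "integrable M (\<lambda>\<omega>. of_real (U \<omega>) * ?P \<omega> * iexp (?L \<omega>))"
    proof (rule Bochner_Integration.integrable_bound[OF U])
      show "random_variable borel (\<lambda>\<omega>. of_real (U \<omega>) * ?P \<omega> * iexp (?L \<omega>))"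
        using mP mL by measurable
      show "AE \<omega> in M. cmod (of_real (U \<omega>) * ?P \<omega> * iexp (?L \<omega>)) \<le> norm (U \<omega>)"
        using normP by (auto simp: norm_mult mult_left_le)
    qed
    have "(CLINT \<omega>|M. of_real (U \<omega>) * ?P \<omega> * iexp (?L \<omega>) * iexp (u * R k \<omega>)) = 0" for u
    proof -
      \<comment> \<open>Only the frequency at \<open>k\<close> is varied; indicators on
        \<open>K\<close> and exponentials on the other coordinates form the fixed weight.\<close>
      have "(\<Sum>j\<in>J - K. (t(k := u)) j * R j \<omega>) = u * R k \<omega> + ?L \<omega>" for \<omega>
      proof -
        have eqJ: "J - K = insert k (J - insert k K)" using k by auto
        have "(\<Sum>j\<in>J - K. (t(k := u)) j * R j \<omega>) = u * R k \<omega> + (\<Sum>j\<in>J - insert k K. (t(k := u)) j * R j \<omega>)"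
          unfolding eqJ by (subst sum.insert) (use J in auto)
        also have "(\<Sum>j\<in>J - insert k K. (t(k := u)) j * R j \<omega>) = ?L \<omega>"
          by (intro sum.cong) auto
        finally show ?thesis .
      qed
      then have "iexp (\<Sum>j\<in>J - K. (t(k := u)) j * R j \<omega>) = iexp (?L \<omega>) * iexp (u * R k \<omega>)" for \<omega>
        by (simp only: of_real_add distrib_left exp_add mult.commute)
      then show ?thesis using insert.IH[of "t(k := u)"] k by (simp only: mult.assoc)
    qed
    from complex_weight_zero_of_iexp[OF R[OF k(1)] iW this B[OF k(1)]]
    show ?case unfolding prod.insert[OF insert.hyps(1,2)] by (simp only: mult_ac)
  qed
  from this[OF J order_refl, of "\<lambda>_. 0"]
  have "(CLINT \<omega>|M. of_real (U \<omega> * (\<Prod>j\<in>J. indicator (B j) (R j \<omega>)))) = 0"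
    by (simp add: of_real_indicator)
  then show ?thesis by (simp only: integral_complex_of_real of_real_eq_0_iff)
qed

section \<open>Exponential tests of a constant conditional expectation\<close>

context prob_space
begin

text \<open>Independence factorizes every term. The coordinate \<open>k\<close> of the linear form
  changes only the \<open>k\<close>-th factor, from the characteristic function to the tilted mean;
  nonvanishing allows this to be written as a quotient in front of the common product.\<close>

lemma expectation_linear_form_mult_iexp:
  fixes Z :: "'i \<Rightarrow> 'a \<Rightarrow> real" and w s :: "'i \<Rightarrow> real" and c :: real
  assumes I: "finite I" and indep: "indep_vars (\<lambda>_. borel) Z I"
    and Z: "\<And>i. i \<in> I \<Longrightarrow> integrable M (Z i)"
    and nz: "\<And>i. i \<in> I \<Longrightarrow> charfn (Z i) (of_real (s i)) \<noteq> 0"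
  shows "(CLINT \<omega>|M. of_real ((\<Sum>i\<in>I. w i * Z i \<omega>) - c) * iexp (\<Sum>i\<in>I. s i * Z i \<omega>))
    = ((\<Sum>i\<in>I. w i * tilted_mean (Z i) (s i) / charfn (Z i) (of_real (s i))) - c)
      * (\<Prod>i\<in>I. charfn (Z i) (of_real (s i)))"
proof -
  define \<phi> where "\<phi> i = charfn (Z i) (of_real (s i))" for i
  have rv: "random_variable borel (Z i)" if "i \<in> I" for i
    using indep that by (auto simp: indep_vars_def)
  have L: "iexp (\<Sum>i\<in>I. s i * Z i \<omega>) = (\<Prod>i\<in>I. iexp (s i * Z i \<omega>))" for \<omega>
    by (simp only: of_real_sum sum_distrib_left exp_sum[OF I])
  have mom: "integrable M (\<lambda>\<omega>. \<Prod>i\<in>I. h i (Z i \<omega>))"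
    "(CLINT \<omega>|M. (\<Prod>i\<in>I. h i (Z i \<omega>))) = (\<Prod>i\<in>I. CLINT \<omega>|M. h i (Z i \<omega>))"
    if "\<And>i. h i \<in> borel_measurable borel" "\<And>i. i \<in> I \<Longrightarrow> integrable M (\<lambda>\<omega>. h i (Z i \<omega>))"
    for h :: "'i \<Rightarrow> real \<Rightarrow> complex"
  proof -
    have "indep_vars (\<lambda>_. borel) (\<lambda>i \<omega>. h i (Z i \<omega>)) I"
      by (rule indep_vars_compose2[OF indep]) (use that in auto)
    from indep_vars_integrable[OF I this that(2)] indep_vars_lebesgue_integral[OF I this that(2)]
    show "integrable M (\<lambda>\<omega>. \<Prod>i\<in>I. h i (Z i \<omega>))"
      "(CLINT \<omega>|M. (\<Prod>i\<in>I. h i (Z i \<omega>))) = (\<Prod>i\<in>I. CLINT \<omega>|M. h i (Z i \<omega>))" by auto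
  qed
  have int0: "integrable M (\<lambda>\<omega>. iexp (s i * Z i \<omega>))" if "i \<in> I" for i
    using integrable_mult_iexp[of "\<lambda>_. 1" "Z i" "s i"] rv[OF that] by simp
  have e0: "integrable M (\<lambda>\<omega>. \<Prod>i\<in>I. iexp (s i * Z i \<omega>))"
    "(CLINT \<omega>|M. (\<Prod>i\<in>I. iexp (s i * Z i \<omega>))) = (\<Prod>i\<in>I. \<phi> i)"
    using mom[of "\<lambda>i x. iexp (s i * x)"] int0 by (auto simp: \<phi>_def charfn_of_real)
  have ek: "integrable M (\<lambda>\<omega>. of_real (Z k \<omega>) * (\<Prod>i\<in>I. iexp (s i * Z i \<omega>)))"
    "(CLINT \<omega>|M. of_real (Z k \<omega>) * (\<Prod>i\<in>I. iexp (s i * Z i \<omega>))) = tilted_mean (Z k) (s k) / \<phi> k * (\<Prod>i\<in>I. \<phi> i)"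
    if k: "k \<in> I" for k
  proof -
    define h where "h i x = (if i = k then of_real x * iexp (s i * x) else iexp (s i * x))" for i and x :: real
    have h: "of_real (Z k \<omega>) * (\<Prod>i\<in>I. iexp (s i * Z i \<omega>)) = (\<Prod>i\<in>I. h i (Z i \<omega>))" for \<omega>
    proof -
      have "(\<Prod>i\<in>I - {k}. h i (Z i \<omega>)) = (\<Prod>i\<in>I - {k}. iexp (s i * Z i \<omega>))"
        by (rule prod.cong) (auto simp: h_def)
      then show ?thesis
        by (simp only: prod.remove[OF I k] h_def if_True mult.assoc refl)
    qed
    have "h i \<in> borel_measurable borel" for i
      unfolding h_def by (cases "i = k") simp_all
    moreover have "integrable M (\<lambda>\<omega>. h i (Z i \<omega>))" if "i \<in> I" for i
      using int0[OF that] integrable_mult_iexp[OF Z[OF that] rv[OF that], of "s i"]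
      by (cases "i = k") (simp_all add: h_def)
    ultimately have m: "integrable M (\<lambda>\<omega>. \<Prod>i\<in>I. h i (Z i \<omega>))"
      "(CLINT \<omega>|M. (\<Prod>i\<in>I. h i (Z i \<omega>))) = (\<Prod>i\<in>I. CLINT \<omega>|M. h i (Z i \<omega>))"
      using mom[of h] by auto
    have "(\<Prod>i\<in>I - {k}. CLINT \<omega>|M. h i (Z i \<omega>)) = (\<Prod>i\<in>I - {k}. \<phi> i)"
      by (rule prod.cong) (auto simp: h_def \<phi>_def charfn_of_real)
    moreover have "(CLINT \<omega>|M. h k (Z k \<omega>)) = tilted_mean (Z k) (s k)"
      by (simp add: h_def tilted_mean_def)
    ultimately have "(\<Prod>i\<in>I. CLINT \<omega>|M. h i (Z i \<omega>)) = tilted_mean (Z k) (s k) / \<phi> k * (\<Prod>i\<in>I. \<phi> i)"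
      using nz[OF k] by (simp add: prod.remove[OF I k] flip: \<phi>_def)
    then show "integrable M (\<lambda>\<omega>. of_real (Z k \<omega>) * (\<Prod>i\<in>I. iexp (s i * Z i \<omega>)))"
      "(CLINT \<omega>|M. of_real (Z k \<omega>) * (\<Prod>i\<in>I. iexp (s i * Z i \<omega>))) = tilted_mean (Z k) (s k) / \<phi> k * (\<Prod>i\<in>I. \<phi> i)"
      using m unfolding h by auto
  qed
  let ?P = "\<lambda>\<omega>. \<Prod>i\<in>I. iexp (s i * Z i \<omega>)"
  have "of_real ((\<Sum>i\<in>I. w i * Z i \<omega>) - c) * ?P \<omega> = (\<Sum>i\<in>I. of_real (w i) * (of_real (Z i \<omega>) * ?P \<omega>)) - of_real c * ?P \<omega>" for \<omega>
    by (simp only: of_real_diff of_real_sum of_real_mult left_diff_distrib sum_distrib_right mult.assoc)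
  then have "(CLINT \<omega>|M. of_real ((\<Sum>i\<in>I. w i * Z i \<omega>) - c) * ?P \<omega>)
      = (CLINT \<omega>|M. (\<Sum>i\<in>I. of_real (w i) * (of_real (Z i \<omega>) * ?P \<omega>)) - of_real c * ?P \<omega>)"
    by (simp only:)
  also have "\<dots> = (CLINT \<omega>|M. (\<Sum>i\<in>I. of_real (w i) * (of_real (Z i \<omega>) * ?P \<omega>))) - (CLINT \<omega>|M. of_real c * ?P \<omega>)"
    by (intro Bochner_Integration.integral_diff Bochner_Integration.integrable_sum integrable_mult_right ek e0)
  also have "(CLINT \<omega>|M. of_real c * ?P \<omega>) = of_real c * (\<Prod>i\<in>I. \<phi> i)"
    by (simp only: integral_mult_right_zero e0)
  also have "(CLINT \<omega>|M. (\<Sum>i\<in>I. of_real (w i) * (of_real (Z i \<omega>) * ?P \<omega>)))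
      = (\<Sum>i\<in>I. CLINT \<omega>|M. of_real (w i) * (of_real (Z i \<omega>) * ?P \<omega>))"
    by (intro Bochner_Integration.integral_sum integrable_mult_right ek)
  also have "\<dots> = (\<Sum>i\<in>I. w i * tilted_mean (Z i) (s i) / \<phi> i * (\<Prod>i\<in>I. \<phi> i))"
    by (intro sum.cong refl) (simp only: integral_mult_right_zero ek times_divide_eq_right times_divide_eq_left mult.assoc)
  finally show ?thesis
    unfolding L \<phi>_def[symmetric] by (simp only: left_diff_distrib sum_distrib_right)
qed

lemma measurable_generated_algebra:
  assumes "j \<in> J"
  shows "R j \<in> borel_measurable (generated_algebra M J R)"
proof (rule measurableI)
  have sub: "(\<Union>i\<in>J. {R i -` A \<inter> space M | A. A \<in> sets borel}) \<subseteq> Pow (space M)" by auto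
  fix A :: "real set" assume "A \<in> sets borel"
  then have "R j -` A \<inter> space M \<in> sigma_sets (space M) (\<Union>i\<in>J. {R i -` A \<inter> space M | A. A \<in> sets borel})"
    using assms by (intro sigma_sets.Basic) auto
  then show "R j -` A \<inter> space (generated_algebra M J R) \<in> sets (generated_algebra M J R)"
    unfolding generated_algebra_def using sub by (simp add: space_measure_of_conv sets_measure_of)
qed simp

text \<open>The linear form is measurable for the generated algebra, so bounded functions of it pass
  through the conditional expectation. Cosine and sine are tested separately because
  \<open>real_cond_exp\<close> is real-valued.\<close>

lemma iexp_zero_of_real_cond_exp_const:
  fixes R :: "'i \<Rightarrow> 'a \<Rightarrow> real" and U :: "'a \<Rightarrow> real"
  assumes R: "\<And>j. j \<in> J \<Longrightarrow> random_variable borel (R j)" and U: "integrable M U"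
    and const: "AE \<omega> in M. real_cond_exp M (generated_algebra M J R) U \<omega> = c"
  shows "(CLINT \<omega>|M. of_real (U \<omega> - c) * iexp (\<Sum>j\<in>J. t j * R j \<omega>)) = 0"
proof -
  let ?F = "generated_algebra M J R" and ?L = "\<lambda>\<omega>. \<Sum>j\<in>J. t j * R j \<omega>"
  interpret F: finite_measure_subalgebra M ?F
    by unfold_locales (rule subalgebra_generated_algebra[OF R])
  have L: "?L \<in> borel_measurable ?F"
    by (intro borel_measurable_sum borel_measurable_times measurable_generated_algebra) auto
  have [measurable]: "random_variable borel U" using U by auto
  have [measurable]: "random_variable borel ?L"
    by (rule measurable_from_subalg[OF F.subalg L])
  have "expectation (\<lambda>\<omega>. (U \<omega> - c) * h (?L \<omega>)) = 0 \<and> integrable M (\<lambda>\<omega>. (U \<omega> - c) * h (?L \<omega>))"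
    if [measurable]: "h \<in> borel_measurable borel" and h1: "\<And>x. \<bar>h x\<bar> \<le> 1" for h
  proof -
    have hL: "(\<lambda>\<omega>. h (?L \<omega>)) \<in> borel_measurable ?F"
      by (rule measurable_compose[OF L that(1)])
    have iU: "integrable M (\<lambda>\<omega>. h (?L \<omega>) * U \<omega>)"
      by (rule Bochner_Integration.integrable_bound[OF U]) (use h1 in \<open>auto simp: abs_mult mult_left_le_one_le\<close>)
    have ih: "integrable M (\<lambda>\<omega>. h (?L \<omega>))"
      by (rule Bochner_Integration.integrable_bound[of M "\<lambda>_. 1 :: real"]) (use h1 in auto)
    have "expectation (\<lambda>\<omega>. h (?L \<omega>) * U \<omega>) = expectation (\<lambda>\<omega>. h (?L \<omega>) * real_cond_exp M ?F U \<omega>)"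
      by (rule F.real_cond_exp_intg(2)[OF iU hL, symmetric]) simp
    also have "\<dots> = expectation (\<lambda>\<omega>. h (?L \<omega>) * c)"
      by (rule integral_cong_AE) (use const in auto)
    finally have eq: "expectation (\<lambda>\<omega>. h (?L \<omega>) * U \<omega>) = expectation (\<lambda>\<omega>. h (?L \<omega>) * c)" .
    have d: "(U \<omega> - c) * h (?L \<omega>) = h (?L \<omega>) * U \<omega> - h (?L \<omega>) * c" for \<omega>
      by (simp only: left_diff_distrib mult.commute)
    show ?thesis
      unfolding d using eq iU ih by (subst Bochner_Integration.integral_diff) auto
  qed
  from this[of cos] this[of sin]
  have cs: "expectation (\<lambda>\<omega>. (U \<omega> - c) * cos (?L \<omega>)) = 0" "integrable M (\<lambda>\<omega>. (U \<omega> - c) * cos (?L \<omega>))"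
    "expectation (\<lambda>\<omega>. (U \<omega> - c) * sin (?L \<omega>)) = 0" "integrable M (\<lambda>\<omega>. (U \<omega> - c) * sin (?L \<omega>))"
    by auto
  have "of_real u * iexp x = of_real (u * cos x) + \<i> * of_real (u * sin x)" for u x :: real
    by (simp add: complex_eq_iff Re_exp Im_exp)
  then have "(CLINT \<omega>|M. of_real (U \<omega> - c) * iexp (?L \<omega>))
      = (CLINT \<omega>|M. of_real ((U \<omega> - c) * cos (?L \<omega>)) + \<i> * of_real ((U \<omega> - c) * sin (?L \<omega>)))"
    by (simp only:)
  also have "\<dots> = of_real (expectation (\<lambda>\<omega>. (U \<omega> - c) * cos (?L \<omega>))) + \<i> * of_real (expectation (\<lambda>\<omega>. (U \<omega> - c) * sin (?L \<omega>)))"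
    using cs(2,4) by (subst Bochner_Integration.integral_add)
      (simp_all only: integral_mult_right_zero integral_complex_of_real integrable_mult_right integrable_of_real)
  finally show ?thesis by (simp only: cs of_real_0 mult_zero_right add_0_left)
qed

text \<open>The joint uniqueness lemma makes the integral of \<open>U - c\<close> vanish on the
  rectangles in \<open>G\<close>, which are stable under intersection and generate the algebra;
  Dynkin's theorem extends this to all its sets.\<close>

lemma real_cond_exp_const_of_iexp_zero:
  fixes R :: "'i \<Rightarrow> 'a \<Rightarrow> real" and U :: "'a \<Rightarrow> real"
  assumes J: "finite J" and R: "\<And>j. j \<in> J \<Longrightarrow> random_variable borel (R j)" and U: "integrable M U"
    and zero: "\<And>t. (CLINT \<omega>|M. of_real (U \<omega> - c) * iexp (\<Sum>j\<in>J. t j * R j \<omega>)) = 0"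
  shows "AE \<omega> in M. real_cond_exp M (generated_algebra M J R) U \<omega> = c"
proof -
  let ?F = "generated_algebra M J R"
  interpret F: finite_measure_subalgebra M ?F
    by unfold_locales (rule subalgebra_generated_algebra[OF R])
  have iV: "integrable M (\<lambda>\<omega>. U \<omega> - c)" using U by simp
  have si: "set_integrable M A V" if "A \<in> events" "integrable M V" for A and V :: "'a \<Rightarrow> real"
    using integrable_mult_indicator[OF that] by (simp add: set_integrable_def)
  define G where "G = {{\<omega> \<in> space M. \<forall>j\<in>J. R j \<omega> \<in> B j} | B. \<forall>j\<in>J. B j \<in> sets (borel :: real measure)}"
  have GPow: "G \<subseteq> Pow (space M)" by (auto simp: G_def)
  have GM: "G \<subseteq> events"
  proof
    fix A assume "A \<in> G"
    then obtain B where B: "A = {\<omega> \<in> space M. \<forall>j\<in>J. R j \<omega> \<in> B j}" "\<forall>j\<in>J. B j \<in> sets borel"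
      by (auto simp: G_def)
    have "{\<omega> \<in> space M. R j \<omega> \<in> B j} \<in> events" if "j \<in> J" for j
      using measurable_sets[OF R[OF that], of "B j"] B that by (simp add: vimage_def Int_def conj_commute)
    then show "A \<in> events" unfolding B(1) by (intro sets.sets_Collect_finite_All' sets.sets_Collect_finite_All J) auto
  qed
  have Int_stable: "Int_stable G"
  proof (rule Int_stableI)
    fix A A' assume "A \<in> G" "A' \<in> G"
    then obtain B B' where "A = {\<omega> \<in> space M. \<forall>j\<in>J. R j \<omega> \<in> B j}" "\<forall>j\<in>J. B j \<in> sets borel"
      "A' = {\<omega> \<in> space M. \<forall>j\<in>J. R j \<omega> \<in> B' j}" "\<forall>j\<in>J. B' j \<in> sets borel"
      by (auto simp: G_def)
    then show "A \<inter> A' \<in> G"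
      unfolding G_def by (intro CollectI exI[of _ "\<lambda>j. B j \<inter> B' j"]) auto
  qed
  have sets_F: "sets ?F \<subseteq> sigma_sets (space M) G"
  proof -
    have C: "(\<Union>i\<in>J. {R i -` A \<inter> space M | A. A \<in> sets borel}) \<subseteq> G"
    proof safe
      fix i and A :: "real set" assume "i \<in> J" "A \<in> sets borel"
      then show "R i -` A \<inter> space M \<in> G"
        unfolding G_def by (intro CollectI exI[of _ "\<lambda>j. if j = i then A else UNIV"]) auto
    qed
    then have "sets ?F = sigma_sets (space M) (\<Union>i\<in>J. {R i -` A \<inter> space M | A. A \<in> sets borel})"
      unfolding generated_algebra_def using GPow by (intro sets_measure_of) blast
    then show ?thesis using sigma_sets_mono'[OF C] by simp
  qed
  have set_zero: "(LINT \<omega>:A|M. U \<omega> - c) = 0" if "A \<in> sigma_sets (space M) G" for A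
  proof (induction rule: sigma_sets_induct_disjoint[OF Int_stable GPow that])
    case (1 A)
    then obtain B where B: "A = {\<omega> \<in> space M. \<forall>j\<in>J. R j \<omega> \<in> B j}" "\<And>j. j \<in> J \<Longrightarrow> B j \<in> sets borel"
      by (auto simp: G_def)
    have "(LINT \<omega>:A|M. U \<omega> - c) = expectation (\<lambda>\<omega>. (U \<omega> - c) * (\<Prod>j\<in>J. indicator (B j) (R j \<omega>)))"
      unfolding set_lebesgue_integral_def
    proof (rule Bochner_Integration.integral_cong)
      fix \<omega> assume "\<omega> \<in> space M"
      then have "(\<Prod>j\<in>J. indicator (B j) (R j \<omega>)) = (indicator A \<omega> :: real)"
        using J by (auto simp: B(1) indicator_def)
      then show "indicator A \<omega> *\<^sub>R (U \<omega> - c) = (U \<omega> - c) * (\<Prod>j\<in>J. indicator (B j) (R j \<omega>))" by simp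
    qed simp
    also have "\<dots> = 0"
      by (rule joint_weight_zero_of_iexp[OF J R iV zero B(2)])
    finally show ?case .
  next
    case 2
    show ?case by (simp add: set_lebesgue_integral_def)
  next
    case (3 A)
    have A: "A \<in> events" using 3(1) GM sets.sigma_sets_subset by blast
    \<comment> \<open>Complements also need the total expectation to be 0, which is
      \<open>zero\<close> with all frequencies 0.\<close>
    have "(LINT \<omega>:space M - A|M. U \<omega> - c) + (LINT \<omega>:A|M. U \<omega> - c) = expectation (\<lambda>\<omega>. U \<omega> - c)"
    proof -
      have "(LINT \<omega>:space M - A|M. U \<omega> - c) + (LINT \<omega>:A|M. U \<omega> - c) = (LINT \<omega>:(space M - A) \<union> A|M. U \<omega> - c)"
        using A iV by (intro set_integral_Un[symmetric] si) auto
      also have "(space M - A) \<union> A = space M" using sets.sets_into_space[OF A] by auto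
      finally show ?thesis using iV by (simp add: set_integral_space)
    qed
    moreover have "(CLINT \<omega>|M. of_real (U \<omega> - c)) = 0" using zero[of "\<lambda>_. 0"] by simp
    then have "expectation (\<lambda>\<omega>. U \<omega> - c) = 0"
      by (simp only: integral_complex_of_real of_real_eq_0_iff)
    ultimately show ?case using 3(2) by simp
  next
    case (4 A)
    have A: "A i \<in> events" for i using 4(2) GM sets.sigma_sets_subset by blast
    have "(LINT \<omega>:(\<Union>i. A i)|M. U \<omega> - c) = (\<Sum>i. (LINT \<omega>:A i|M. U \<omega> - c))"
    proof (rule lebesgue_integral_countable_add)
      show "set_integrable M (\<Union>i. A i) (\<lambda>\<omega>. U \<omega> - c)"
        using A iV by (intro si) auto
    qed (use A 4(1) in \<open>auto simp: disjoint_family_on_def\<close>)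
    then show ?case using 4(3) by simp
  qed
  show ?thesis
  proof (rule F.real_cond_exp_charact)
    fix A assume "A \<in> sets ?F"
    then have A: "A \<in> sigma_sets (space M) G" using sets_F by blast
    then have "A \<in> events" using GM sets.sigma_sets_subset by blast
    then have "(LINT \<omega>:A|M. U \<omega> - c) = (LINT \<omega>:A|M. U \<omega>) - (LINT \<omega>:A|M. c)"
      using U by (intro set_integral_diff si) auto
    then show "(LINT \<omega>:A|M. U \<omega>) = (LINT \<omega>:A|M. c)"
      using set_zero[OF A] by simp
  qed (use U in auto)
qed

end

section \<open>From the zero-sum relation to the equivalence\<close>

context prob_space
begin

text \<open>Changing the signs of both \<open>a\<close> and \<open>b\<close> changes that of
  \<open>r\<close> and preserves the relation, so \<open>a * b > 0\<close> reduces to two positive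
  weights.\<close>

lemma gaussian_of_zero_sum_relation:
  fixes X Y :: "'a \<Rightarrow> real" and a b :: real
  defines "r t \<equiv> a * tilted_mean X t / charfn X (complex_of_real t) + b * tilted_mean Y t / charfn Y (complex_of_real t)"
  assumes indep: "indep_var borel X borel Y"
    and X2: "integrable M (\<lambda>\<omega>. (X \<omega>)\<^sup>2)" and Y2: "integrable M (\<lambda>\<omega>. (Y \<omega>)\<^sup>2)" and ab: "a * b > 0"
    and rel: "\<And>s t u :: real. s + t + u = 0 \<Longrightarrow>
        \<forall>x\<in>{s, t, u}. charfn X (of_real x) \<noteq> 0 \<and> charfn Y (of_real x) \<noteq> 0 \<Longrightarrow>
        r s + r t + r u = 3 * r 0"
  shows "gaussian_rv M X \<and> gaussian_rv M Y"
proof -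
  have X: "random_variable borel X" and Y: "random_variable borel Y"
    using indep by (auto dest: indep_var_rv1 indep_var_rv2)
  define q where "q a b t = a * tilted_mean X t / charfn X (complex_of_real t) + b * tilted_mean Y t / charfn Y (complex_of_real t)"
    for a b t :: real
  have pos: "gaussian_rv M X \<and> gaussian_rv M Y" if pos: "a > 0" "b > 0"
    and rel: "\<And>s t u :: real. s + t + u = 0 \<Longrightarrow>
        \<forall>x\<in>{s, t, u}. charfn X (of_real x) \<noteq> 0 \<and> charfn Y (of_real x) \<noteq> 0 \<Longrightarrow>
        q a b s + q a b t + q a b u = 3 * q a b 0" for a b
  proof -
    obtain v where "\<And>t :: real. charfn X (of_real t) \<noteq> 0" "\<And>t :: real. charfn Y (of_real t) \<noteq> 0"
      "\<And>t. q a b t = q a b 0 + \<i> * of_real (v * t)"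
      using log_derivative_linear_of_zero_sum_relation[OF X X2 Y Y2 pos rel[unfolded q_def]]
      unfolding q_def by blast
    then show ?thesis
      using gaussian_of_linear_log_derivative[OF indep X2 Y2 pos] unfolding q_def by blast
  qed
  show ?thesis
  proof (cases "a > 0")
    case True
    moreover have "q a b t = r t" for t by (simp add: q_def r_def)
    ultimately show ?thesis using ab rel by (intro pos[of a b]) (auto simp: zero_less_mult_iff)
  next
    case False
    then have neg: "- a > 0" "- b > 0" using ab by (auto simp: zero_less_mult_iff)
    have nq: "q (- a) (- b) t = - r t" for t by (simp add: q_def r_def)
    have eq: "q (- a) (- b) s + q (- a) (- b) t + q (- a) (- b) u = 3 * q (- a) (- b) 0"
      if "r s + r t + r u = 3 * r 0" for s t u
      using that unfolding nq by algebra
    show ?thesis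
      by (rule pos[OF neg], rule eq, rule rel)
  qed
qed

text \<open>The explicit characteristic function is differentiated and the result compared with
  \<open>\<i> * tilted_mean X t\<close>, by uniqueness of derivatives.\<close>

lemma gaussian_tilted_mean:
  assumes "random_variable borel X" "integrable M (\<lambda>\<omega>. (X \<omega>)\<^sup>2)" "gaussian_rv M X"
  shows "\<exists>\<mu> v :: real. \<forall>t :: real. charfn X (of_real t) \<noteq> 0 \<and>
    tilted_mean X t / charfn X (of_real t) = of_real \<mu> + \<i> * of_real (v * t)"
proof -
  obtain \<mu> s where C: "\<And>t :: real. charfn X (of_real t) = exp (\<i> * of_real (\<mu> * t) - of_real (s\<^sup>2 * t\<^sup>2 / 2))"
    using assms unfolding gaussian_rv_iff_charfn[OF assms(1)] by blast
  have "tilted_mean X t / charfn X (of_real t) = \<mu> + \<i> * (s\<^sup>2 * t)" for t :: real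
  proof -
    let ?E = "exp (\<i> * of_real (\<mu> * t) - of_real (s\<^sup>2 * t\<^sup>2 / 2))"
    have "((\<lambda>z. exp (\<i> * (of_real \<mu> * z) - (of_real s)\<^sup>2 * z\<^sup>2 / 2)) has_field_derivative
        ?E * (\<i> * of_real \<mu> - (of_real s)\<^sup>2 * of_real t)) (at (of_real t))"
      by (auto intro!: derivative_eq_intros)
    from has_vector_derivative_real_field[OF this]
    have "((\<lambda>t. charfn X (of_real t)) has_vector_derivative ?E * (\<i> * of_real \<mu> - (of_real s)\<^sup>2 * of_real t)) (at t)"
      by (simp add: C)
    from vector_derivative_unique_at[OF this charfn_has_vector_derivative[OF assms(1,2)]]
    have "\<i> * tilted_mean X t = ?E * (\<i> * of_real \<mu> - (of_real s)\<^sup>2 * of_real t)" ..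
    also have "\<dots> = \<i> * (?E * (\<mu> + \<i> * (s\<^sup>2 * t)))"
      by (simp add: algebra_simps)
    finally have "tilted_mean X t = ?E * (\<mu> + \<i> * (s\<^sup>2 * t))" by simp
    then show ?thesis by (simp add: C)
  qed
  then show ?thesis using C by (intro exI[where x = \<mu>] exI[where x = "s\<^sup>2"]) simp
qed

lemma charfn_cong_distr:
  assumes "random_variable borel X" "random_variable borel Y" "distr M borel X = distr M borel Y"
  shows "charfn X (of_real t) = charfn Y (of_real t)"
  using char_distr_eq_charfn[OF assms(1), of t] char_distr_eq_charfn[OF assms(2), of t] assms(3) by simp

lemma tilted_mean_cong_distr:
  assumes "random_variable borel X" "random_variable borel Y" "distr M borel X = distr M borel Y"
  shows "tilted_mean X t = tilted_mean Y t"
proof -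
  have "tilted_mean Z t = (CLINT x|distr M borel Z. of_real x * iexp (t * x))" if "random_variable borel Z" for Z
    unfolding tilted_mean_def using that by (subst integral_distr) auto
  then show ?thesis using assms by simp
qed

end

text \<open>Centering is a symmetric linear map, so it can be moved from the variables to the
  coefficients. A linear form in the residuals thus becomes one in the variables, with coefficients
  of sum zero when \<open>n\<close> is the size of \<open>J\<close>.\<close>

lemma sum_mult_centered:
  fixes t x :: "'i \<Rightarrow> real"
  shows "(\<Sum>j\<in>J. t j * (x j - (\<Sum>i\<in>J. x i) / n)) = (\<Sum>j\<in>J. (t j - (\<Sum>i\<in>J. t i) / n) * x j)"
proof -
  have "(\<Sum>j\<in>J. t j * (x j - (\<Sum>i\<in>J. x i) / n)) = (\<Sum>j\<in>J. t j * x j) - (\<Sum>j\<in>J. t j) * ((\<Sum>i\<in>J. x i) / n)"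
    by (simp only: right_diff_distrib sum_subtractf sum_distrib_right)
  also have "(\<Sum>j\<in>J. t j) * ((\<Sum>i\<in>J. x i) / n) = (\<Sum>i\<in>J. t i) / n * (\<Sum>j\<in>J. x j)"
    by simp
  finally show ?thesis
    by (simp only: left_diff_distrib sum_subtractf sum_distrib_left)
qed

theorem theorem1:
  fixes M :: "'a measure" and X Y :: "nat \<Rightarrow> 'a \<Rightarrow> real"
    and n :: nat and a b :: real
  assumes "prob_space M"
    and "n \<ge> 3"
    and "a * b > 0"
    and "prob_space.indep_vars M (\<lambda>_. borel) (case_sum X Y) ({1..n} <+> {1..n})"
    and "\<forall>i\<in>{1..n}. \<forall>j\<in>{1..n}. distr M borel (X i) = distr M borel (X j)"
    and "\<forall>i\<in>{1..n}. integrable M (\<lambda>\<omega>. (X i \<omega>)\<^sup>2)"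
    and "\<forall>i\<in>{1..n}. \<forall>j\<in>{1..n}. distr M borel (Y i) = distr M borel (Y j)"
    and "\<forall>i\<in>{1..n}. integrable M (\<lambda>\<omega>. (Y i \<omega>)\<^sup>2)"
  shows "(\<exists>c. AE \<omega> in M.
            real_cond_exp M
              (generated_algebra M {1..n}
                (\<lambda>i \<omega>. X i \<omega> - sample_mean n X \<omega> + Y i \<omega> - sample_mean n Y \<omega>))
              (\<lambda>\<omega>. a * sample_mean n X \<omega> + b * sample_mean n Y \<omega>) \<omega> = c)
         \<longleftrightarrow> (\<forall>i\<in>{1..n}. gaussian_rv M (X i) \<and> gaussian_rv M (Y i))"
proof -
  interpret prob_space M by fact
  define I where "I = {1..n} <+> {1..n}"
  define Z where "Z = case_sum X Y"
  define R where "R = (\<lambda>i \<omega>. X i \<omega> - sample_mean n X \<omega> + Y i \<omega> - sample_mean n Y \<omega>)"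
  define U where "U = (\<lambda>\<omega>. a * sample_mean n X \<omega> + b * sample_mean n Y \<omega>)"
  have n: "real n > 0" "1 \<in> {1..n}" using assms(2) by auto
  have I: "finite I" by (simp add: I_def)
  have indep: "indep_vars (\<lambda>_. borel) Z I" using assms(4) by (simp add: I_def Z_def)
  have rvZ: "random_variable borel (Z i)" if "i \<in> I" for i
    using indep that by (auto simp: indep_vars_def)
  have mem: "Inl i \<in> I" "Inr i \<in> I" if "i \<in> {1..n}" for i
    using that by (auto simp: I_def)
  have X: "random_variable borel (X i)" and Y: "random_variable borel (Y i)" if "i \<in> {1..n}" for i
    using rvZ[OF mem(1)[OF that]] rvZ[OF mem(2)[OF that]] by (simp_all add: Z_def)
  have iX: "integrable M (X i)" and iY: "integrable M (Y i)" if "i \<in> {1..n}" for i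
    using that assms(6,8) square_integrable_imp_integrable[OF X] square_integrable_imp_integrable[OF Y] by auto
  have iZ: "integrable M (Z i)" if "i \<in> I" for i
    using that iX iY by (auto simp: I_def Z_def)
  have rvR: "random_variable borel (R j)" if "j \<in> {1..n}" for j
    unfolding R_def sample_mean_def using X Y that
    by (intro borel_measurable_diff borel_measurable_add borel_measurable_divide borel_measurable_sum) auto
  have iU: "integrable M U"
    unfolding U_def sample_mean_def using iX iY
    by (intro Bochner_Integration.integrable_add integrable_mult_right integrable_divide Bochner_Integration.integrable_sum) auto
  have indepXY: "indep_var borel (X 1) borel (Y 1)"
    using indep_var_of_indep_vars[OF indep mem[OF n(2)]] by (simp add: Z_def)
  have X2: "integrable M (\<lambda>\<omega>. (X 1 \<omega>)\<^sup>2)" and Y2: "integrable M (\<lambda>\<omega>. (Y 1 \<omega>)\<^sup>2)"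
    using assms(6,8) n by auto
  have cX: "charfn (X i) (of_real t) = charfn (X 1) (of_real t)" "tilted_mean (X i) t = tilted_mean (X 1) t"
    and cY: "charfn (Y i) (of_real t) = charfn (Y 1) (of_real t)" "tilted_mean (Y i) t = tilted_mean (Y 1) t"
    if "i \<in> {1..n}" for i t
  proof -
    have "distr M borel (X i) = distr M borel (X 1)" "distr M borel (Y i) = distr M borel (Y 1)"
      using assms(5,7) that n(2) by blast+
    note dX = X[OF that] X[OF n(2)] this(1) and dY = Y[OF that] Y[OF n(2)] this(2)
    show "charfn (X i) (of_real t) = charfn (X 1) (of_real t)" "tilted_mean (X i) t = tilted_mean (X 1) t"
      "charfn (Y i) (of_real t) = charfn (Y 1) (of_real t)" "tilted_mean (Y i) t = tilted_mean (Y 1) t"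
      by (rule charfn_cong_distr[OF dX] tilted_mean_cong_distr[OF dX] charfn_cong_distr[OF dY] tilted_mean_cong_distr[OF dY])+
  qed
  define r where "r t = a * tilted_mean (X 1) t / charfn (X 1) (complex_of_real t)
      + b * tilted_mean (Y 1) t / charfn (Y 1) (complex_of_real t)" for t
  define nz where "nz t \<longleftrightarrow> charfn (X 1) (complex_of_real t) \<noteq> 0 \<and> charfn (Y 1) (complex_of_real t) \<noteq> 0" for t
  \<comment> \<open>Both samples form one independent family indexed by \<open>I\<close>. Each
    residual contains \<open>X j\<close> and \<open>Y j\<close>, so both receive the same centered
    frequency. The witness \<open>P\<close> is the product of all \<open>2 * n\<close>
    characteristic functions at these frequencies.\<close>
  have key: "\<exists>P. P \<noteq> 0 \<and> (CLINT \<omega>|M. of_real (U \<omega> - c) * iexp (\<Sum>j\<in>{1..n}. t j * R j \<omega>))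
      = ((\<Sum>j\<in>{1..n}. r (t j - (\<Sum>i=1..n. t i) / n)) / n - c) * P"
    if nzt: "\<And>j. j \<in> {1..n} \<Longrightarrow> nz (t j - (\<Sum>i=1..n. t i) / n)" for t :: "nat \<Rightarrow> real" and c :: real
  proof -
    define s where "s j = t j - (\<Sum>i=1..n. t i) / n" for j
    define w where "w = case_sum (\<lambda>_ :: nat. a / n) (\<lambda>_ :: nat. b / n)"
    define S where "S = case_sum s s"
    have L: "(\<Sum>j\<in>{1..n}. t j * R j \<omega>) = (\<Sum>i\<in>I. S i * Z i \<omega>)" for \<omega>
    proof -
      have "(\<Sum>j\<in>{1..n}. t j * R j \<omega>) = (\<Sum>j\<in>{1..n}. t j * (X j \<omega> - (\<Sum>i=1..n. X i \<omega>) / n))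
          + (\<Sum>j\<in>{1..n}. t j * (Y j \<omega> - (\<Sum>i=1..n. Y i \<omega>) / n))"
        unfolding R_def sample_mean_def sum.distrib[symmetric]
        by (intro sum.cong refl) (simp add: algebra_simps)
      then show ?thesis
        unfolding sum_mult_centered by (simp add: I_def S_def Z_def s_def sum.Plus)
    qed
    have Uw: "U \<omega> = (\<Sum>i\<in>I. w i * Z i \<omega>)" for \<omega>
      by (simp add: U_def sample_mean_def I_def w_def Z_def sum.Plus sum_distrib_left sum_divide_distrib)
    have nzs: "nz (s j)" if "j \<in> {1..n}" for j
      using nzt[OF that] by (simp only: s_def)
    have nzZ: "charfn (Z i) (of_real (S i)) \<noteq> 0" if "i \<in> I" for i
    proof (cases i)
      case (Inl j)
      then have j: "j \<in> {1..n}" using that by (auto simp: I_def)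
      show ?thesis using nzs[OF j] by (simp add: Inl Z_def S_def nz_def cX(1)[OF j])
    next
      case (Inr j)
      then have j: "j \<in> {1..n}" using that by (auto simp: I_def)
      show ?thesis using nzs[OF j] by (simp add: Inr Z_def S_def nz_def cY(1)[OF j])
    qed
    have "(\<Sum>i\<in>I. w i * tilted_mean (Z i) (S i) / charfn (Z i) (of_real (S i))) = (\<Sum>j\<in>{1..n}. r (s j)) / n"
    proof -
      have tX: "of_real (w (Inl j)) * tilted_mean (Z (Inl j)) (S (Inl j)) / charfn (Z (Inl j)) (of_real (S (Inl j)))
          = of_real (a / n) * tilted_mean (X 1) (s j) / charfn (X 1) (of_real (s j))"
        and tY: "of_real (w (Inr j)) * tilted_mean (Z (Inr j)) (S (Inr j)) / charfn (Z (Inr j)) (of_real (S (Inr j)))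
          = of_real (b / n) * tilted_mean (Y 1) (s j) / charfn (Y 1) (of_real (s j))" if "j \<in> {1..n}" for j
        by (simp_all add: w_def Z_def S_def cX[OF that] cY[OF that])
      have "(\<Sum>i\<in>I. w i * tilted_mean (Z i) (S i) / charfn (Z i) (of_real (S i)))
          = (\<Sum>j\<in>{1..n}. of_real (a / n) * tilted_mean (X 1) (s j) / charfn (X 1) (of_real (s j)))
          + (\<Sum>j\<in>{1..n}. of_real (b / n) * tilted_mean (Y 1) (s j) / charfn (Y 1) (of_real (s j)))"
        unfolding I_def sum.Plus[OF finite_atLeastAtMost finite_atLeastAtMost]
        by (simp only: o_def tX tY cong: sum.cong)
      also have "\<dots> = (\<Sum>j\<in>{1..n}. r (s j) / n)"
        unfolding sum.distrib[symmetric] r_def by (intro sum.cong refl) (simp add: add_divide_distrib mult_ac)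
      finally show ?thesis by (simp only: sum_divide_distrib)
    qed
    moreover have "(\<Prod>i\<in>I. charfn (Z i) (of_real (S i))) \<noteq> 0"
      using I nzZ by simp
    ultimately show ?thesis
      using expectation_linear_form_mult_iexp[OF I indep iZ nzZ, of w c]
      unfolding L Uw s_def[symmetric] by auto
  qed
  have gauss_all: "gaussian_rv M (X i) \<longleftrightarrow> gaussian_rv M (X 1)" "gaussian_rv M (Y i) \<longleftrightarrow> gaussian_rv M (Y 1)"
    if "i \<in> {1..n}" for i
    using that n by (simp_all only: gaussian_rv_iff_charfn X Y cX(1)[OF that] cY(1)[OF that])
  have "(\<exists>c. AE \<omega> in M. real_cond_exp M (generated_algebra M {1..n} R) U \<omega> = c)
      \<longleftrightarrow> gaussian_rv M (X 1) \<and> gaussian_rv M (Y 1)"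
  proof
    assume "\<exists>c. AE \<omega> in M. real_cond_exp M (generated_algebra M {1..n} R) U \<omega> = c"
    then obtain c where c: "AE \<omega> in M. real_cond_exp M (generated_algebra M {1..n} R) U \<omega> = c" by blast
    \<comment> \<open>Frequencies with sum zero are their own centering.\<close>
    have sum0: "(\<Sum>j\<in>{1..n}. r (t j)) = n * c"
      if t: "(\<Sum>i=1..n. t i) = 0" "\<And>j. j \<in> {1..n} \<Longrightarrow> nz (t j)" for t
    proof -
      obtain P where "P \<noteq> 0" "0 = ((\<Sum>j\<in>{1..n}. r (t j)) / n - of_real c) * P"
        using key[of t c] t iexp_zero_of_real_cond_exp_const[OF rvR iU c, of t] by auto
      then show ?thesis using n by (simp add: field_simps)
    qed
    have nz0: "nz 0" by (simp add: nz_def charfn_0)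
    show "gaussian_rv M (X 1) \<and> gaussian_rv M (Y 1)"
    proof (rule gaussian_of_zero_sum_relation[OF indepXY X2 Y2 assms(3), folded r_def nz_def])
      fix x y z :: real assume xyz: "x + y + z = 0" "\<forall>u\<in>{x, y, z}. nz u"
      \<comment> \<open>The three given frequencies are padded with zeros, for which
        \<open>n \<ge> 3\<close> leaves room. Each padded place contributes \<open>r 0\<close>,
        hence the differences \<open>r - r 0\<close> below.\<close>
      define t where "t = (\<lambda>_ :: nat. 0 :: real)(1 := x, 2 := y, 3 := z)"
      have split: "(\<Sum>j\<in>{1..n}. f (t j)) = f x + f y + f z" if "f 0 = 0" for f :: "real \<Rightarrow> 'b :: comm_monoid_add"
      proof -
        have "(\<Sum>j\<in>{1..n}. f (t j)) = (\<Sum>j\<in>{1, 2, 3}. f (t j))"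
          using assms(2) that by (intro sum.mono_neutral_right) (auto simp: t_def)
        then show ?thesis by (simp add: t_def add.assoc)
      qed
      have e1: "(\<Sum>j\<in>{1..n}. r (t j) - r 0) = (r x - r 0) + (r y - r 0) + (r z - r 0)"
        by (rule split) simp
      have e2: "(\<Sum>j\<in>{1..n}. r (t j)) = n * c"
      proof (rule sum0)
        show "(\<Sum>i=1..n. t i) = 0" unfolding split[of "\<lambda>u. u", OF refl] by (rule xyz)
        show "nz (t j)" for j using xyz nz0 by (simp add: t_def)
      qed
      \<comment> \<open>All frequencies 0: this identifies \<open>c\<close> with \<open>r 0\<close>
        and removes it from the relation.\<close>
      have e3: "(\<Sum>j\<in>{1..n}. r 0) = n * c"
        by (rule sum0) (simp_all add: nz0)
      from e1 have "0 = (r x - r 0) + (r y - r 0) + (r z - r 0)"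
        unfolding sum_subtractf e2 e3 by simp
      then show "r x + r y + r z = 3 * r 0" by algebra
    qed
  next
    assume g: "gaussian_rv M (X 1) \<and> gaussian_rv M (Y 1)"
    obtain \<mu> v :: real where \<mu>: "\<forall>t :: real. charfn (X 1) (of_real t) \<noteq> 0 \<and>
        tilted_mean (X 1) t / charfn (X 1) (of_real t) = of_real \<mu> + \<i> * of_real (v * t)"
      using gaussian_tilted_mean[OF X[OF n(2)] X2 conjunct1[OF g]] by (elim exE)
    obtain \<nu> u :: real where \<nu>: "\<forall>t :: real. charfn (Y 1) (of_real t) \<noteq> 0 \<and>
        tilted_mean (Y 1) t / charfn (Y 1) (of_real t) = of_real \<nu> + \<i> * of_real (u * t)"
      using gaussian_tilted_mean[OF Y[OF n(2)] Y2 conjunct2[OF g]] by (elim exE)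
    have nz: "nz t" for t using \<mu> \<nu> by (simp add: nz_def)
    have r: "r t = of_real (a * \<mu> + b * \<nu>) + \<i> * (a * v + b * u) * of_real t" for t
      unfolding r_def times_divide_eq_right[symmetric] \<mu>[rule_format, THEN conjunct2] \<nu>[rule_format, THEN conjunct2]
      by (simp add: algebra_simps)
    have "AE \<omega> in M. real_cond_exp M (generated_algebra M {1..n} R) U \<omega> = a * \<mu> + b * \<nu>"
    proof (rule real_cond_exp_const_of_iexp_zero[OF _ rvR iU])
      fix t :: "nat \<Rightarrow> real"
      \<comment> \<open>The centered frequencies sum to 0, so the linear part of the affine
        \<open>r\<close> cancels and only the constant survives.\<close>
      define s where "s j = t j - (\<Sum>i=1..n. t i) / n" for j
      have "(\<Sum>j\<in>{1..n}. s j) = 0"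
        using n by (simp add: s_def sum_subtractf)
      then have "(\<Sum>j\<in>{1..n}. complex_of_real (s j)) = 0"
        by (simp only: of_real_sum[symmetric] of_real_0)
      then have "(\<Sum>j\<in>{1..n}. r (s j)) = n * of_real (a * \<mu> + b * \<nu>)"
        unfolding r sum.distrib sum_distrib_left[symmetric] by simp
      then have "(\<Sum>j\<in>{1..n}. r (s j)) / n - of_real (a * \<mu> + b * \<nu>) = 0"
        using n by simp
      then show "(CLINT \<omega>|M. of_real (U \<omega> - (a * \<mu> + b * \<nu>)) * iexp (\<Sum>j\<in>{1..n}. t j * R j \<omega>)) = 0"
        using key[of t "a * \<mu> + b * \<nu>"] nz unfolding s_def by auto
    qed simp
    then show "\<exists>c. AE \<omega> in M. real_cond_exp M (generated_algebra M {1..n} R) U \<omega> = c" by blast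
  qed
  then show ?thesis
    using gauss_all n(2) unfolding R_def U_def by blast
qed

end
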